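(* Let $K_*$ be a finite one-critical simplicial $\mathbf{Z}^n$-filtration. If $H_d(K_* )$ has finite total dimension for all $d$, then there is a natural isomorphism $H_d(K_* ) \cong H^{d+n}(N^\bullet(K_* ))^*$ of $\mathbf{Z}^n$-persistence modules for all $d$.
   Context: Let $k$ be a field. A $\mathbf{Z}^n$-persistence module is a functor $M\colon \mathbf{Z}^n \to \mathbf{vec}$ from the poset $\mathbf{Z}^n$ (product order) to finite-dimensional $k$-vector spaces; morphisms are natural transformations. Its total dimension is $\sum_{z} \dim M_z$. The dual $M^*$ has $(M^* )_z = (M_{-z})^* = \mathrm{Hom}_k(M_{-z},k)$ and $(M^* )_{z\le z'} = (M_{-z'\le -z})^*$. For $z\in\mathbf{Z}^n$, $F(z)$ is the module with $F(z)_w = k$ if $z\le w$ and $0$ otherwise, with identity structure maps between nonzero components. Let $\epsilon = (1,\dots,1)\in\mathbf{Z}^n$. A simplicial $\mathbf{Z}^n$-filtration $K_*$ is a functor from $\mathbf{Z}^n$ to simplicial complexes all of whose structure maps are inclusions; $K=\bigcup_z K_z$. It is finite if $K$ is finite, and one-critical if for every $\sigma\in K$ the set $\{z : \sigma\in K_z\}$ has a unique minimal element $g(\sigma)$, called the grade of $\sigma$ (so $\sigma \in K_z$ iff $g(\sigma)\le z$). Homology is reduced simplicial homology with coefficients in $k$: the chain complex $C_\bullet(K_* )$ is augmented, with the empty simplex (dimension $-1$) regarded as a simplex of $K_*$ with its own grade (so $K_z$ is allowed to be void, i.e. to contain no simplices at all, not even the empty one). Thus $C_d(K_* ) = \bigoplus_{\dim\sigma=d}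 F(g(\sigma))$ with the simplicial boundary map $\partial_\bullet$ (simplices are oriented by a fixed choice), and $H_d(K_* )=H_d(C_\bullet(K_* ))$. $N^\bullet(K_* )$ is the cochain complex of free modules with $N^d(K_* ) = \bigoplus_{\dim \sigma = d} F(-g(\sigma)+\epsilon)$, whose coboundary $N^{d-1}(K_* )\to N^d(K_* )$ is given, with respect to the standard bases, by the transpose of the matrix of $\partial_d\colon C_d(K_* )\to C_{d-1}(K_* )$; i.e. its component $F(-g(\tau)+\epsilon)\to F(-g(\sigma)+\epsilon)$ for $\dim\tau=d-1$, $\dim\sigma=d$ is the coefficient of $\tau$ in $\partial\sigma$ times the canonical inclusion. *)

theory Defs
  imports
    "HOL-Analysis.Analysis"
    "HOL-Algebra.AbelCoset"
    "HOL-Combinatorics.Permutations"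
    "Jordan_Normal_Form.VS_Connect"
begin

section \<open>Vector spaces\<close>

text \<open>
  The base field is a type \<^typ>\<open>'k\<close> of class \<^class>\<open>field\<close>. Vector spaces over it are
  modules over \<^term>\<open>class_ring\<close> with an explicit carrier. As in the library constructions of
  modules, the ring fields \<open>mult\<close> and \<open>one\<close> of the module record carry no meaning.
\<close>

definition field_mod :: "('k::field, 'k) module" where
  "field_mod = \<lparr>carrier = UNIV, mult = (\<lambda>_ _. 0), one = 0, zero = 0, add = (+), smult = (*)\<rparr>"

definition quot_mod :: "('k, 'a) module \<Rightarrow> 'a set \<Rightarrow> ('k, 'a set) module" where
  "quot_mod V W =
    \<lparr>carrier = a_rcosets\<^bsub>V\<^esub> W, mult = (\<lambda>_ _. W), one = W, zero = W,
     add = (\<lambda>X Y. X <+>\<^bsub>V\<^esub> Y),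
     smult = (\<lambda>c X. \<Union>x\<in>X. W +>\<^bsub>V\<^esub> (c \<odot>\<^bsub>V\<^esub> x))\<rparr>"

text \<open>The map induced by \<open>h\<close> from a quotient of its domain to the quotient of \<open>V'\<close> by \<open>W'\<close>.
  The union is over the same coset for all \<open>x \<in> X\<close>.\<close>

definition quot_map :: "('k, 'b) module \<Rightarrow> 'b set \<Rightarrow> ('a \<Rightarrow> 'b) \<Rightarrow> 'a set \<Rightarrow> 'b set" where
  "quot_map V' W' h X = (\<Union>x\<in>X. W' +>\<^bsub>V'\<^esub> h x)"

text \<open>Functionals are normalised to be \<open>undefined\<close> outside of the carrier, so that equality of
  functionals is equality of HOL functions.\<close>

definition dual_mod :: "('k::field, 'a) module \<Rightarrow> ('k, 'a \<Rightarrow> 'k) module" where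
  "dual_mod V = (ring.func_space class_ring (carrier V))
     \<lparr>carrier := LinearCombinations.module_hom class_ring V field_mod
                   \<inter> (carrier V \<rightarrow>\<^sub>E UNIV)\<rparr>"

text \<open>Elements of the direct sum vanish outside of the index set \<open>I\<close>.\<close>

definition dsum_mod :: "'i set \<Rightarrow> ('i \<Rightarrow> ('k, 'a) module) \<Rightarrow> ('k, 'i \<Rightarrow> 'a) module" where
  "dsum_mod I V =
    \<lparr>carrier = {f. (\<forall>i\<in>I. f i \<in> carrier (V i)) \<and> (\<forall>i. i \<notin> I \<longrightarrow> f i = \<zero>\<^bsub>V i\<^esub>) \<and>
                   finite {i. f i \<noteq> \<zero>\<^bsub>V i\<^esub>}},
     mult = (\<lambda>_ _ i. \<zero>\<^bsub>V i\<^esub>), one = (\<lambda>i. \<zero>\<^bsub>V i\<^esub>), zero = (\<lambda>i. \<zero>\<^bsub>V i\<^esub>),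
     add = (\<lambda>f g i. f i \<oplus>\<^bsub>V i\<^esub> g i),
     smult = (\<lambda>c f i. c \<odot>\<^bsub>V i\<^esub> f i)\<rparr>"


section \<open>Persistence modules\<close>

text \<open>The poset is \<^typ>\<open>int^'n\<close> with its componentwise order, and \<^term>\<open>1 :: int^'n\<close> is the
  vector all of whose components are 1. The value \<open>arr M z w\<close> matters for \<open>z \<le> w\<close> only.\<close>

record ('k, 'a, 'n) pmod =
  obj :: "int^'n \<Rightarrow> ('k, 'a) module"
  arr :: "int^'n \<Rightarrow> int^'n \<Rightarrow> 'a \<Rightarrow> 'a"

definition persistence_module :: "('k::field, 'a, 'n::finite) pmod \<Rightarrow> bool" where
  "persistence_module M \<longleftrightarrow>
    (\<forall>z. vectorspace class_ring (obj M z) \<and> vectorspace.fin_dim class_ring (obj M z)) \<and>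
    (\<forall>z w. z \<le> w \<longrightarrow> linear_map class_ring (obj M z) (obj M w) (arr M z w)) \<and>
    (\<forall>z. \<forall>x\<in>carrier (obj M z). arr M z z x = x) \<and>
    (\<forall>u v w. u \<le> v \<longrightarrow> v \<le> w \<longrightarrow>
      (\<forall>x\<in>carrier (obj M u). arr M v w (arr M u v x) = arr M u w x))"

definition pmod_hom :: "('k::field, 'a, 'n::finite) pmod \<Rightarrow> ('k, 'b, 'n) pmod \<Rightarrow>
    (int^'n \<Rightarrow> 'a \<Rightarrow> 'b) \<Rightarrow> bool" where
  "pmod_hom M N \<phi> \<longleftrightarrow>
    persistence_module M \<and> persistence_module N \<and>
    (\<forall>z. linear_map class_ring (obj M z) (obj N z) (\<phi> z)) \<and>
    (\<forall>z w. z \<le> w \<longrightarrow>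
      (\<forall>x\<in>carrier (obj M z). \<phi> w (arr M z w x) = arr N z w (\<phi> z x)))"

definition pmod_iso :: "('k::field, 'a, 'n::finite) pmod \<Rightarrow> ('k, 'b, 'n) pmod \<Rightarrow>
    (int^'n \<Rightarrow> 'a \<Rightarrow> 'b) \<Rightarrow> bool" where
  "pmod_iso M N \<phi> \<longleftrightarrow>
    pmod_hom M N \<phi> \<and> (\<forall>z. bij_betw (\<phi> z) (carrier (obj M z)) (carrier (obj N z)))"

definition total_dim :: "('k::field, 'a, 'n::finite) pmod \<Rightarrow> enat" where
  "total_dim M = (\<Sum>\<^sub>\<infinity>z. enat (vectorspace.dim class_ring (obj M z)))"

text \<open>The identity of \<^typ>\<open>'k\<close> restricts to the zero map where \<open>F(z)\<close> vanishes.\<close>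

definition free_pmod :: "int^'n::finite \<Rightarrow> ('k::field, 'k, 'n) pmod" where
  "free_pmod z =
    \<lparr>obj = (\<lambda>w. field_mod\<lparr>carrier := if z \<le> w then UNIV else {0}\<rparr>), arr = (\<lambda>_ _ x. x)\<rparr>"

definition dsum_pmod :: "'i set \<Rightarrow> ('i \<Rightarrow> ('k, 'a, 'n::finite) pmod) \<Rightarrow> ('k, 'i \<Rightarrow> 'a, 'n) pmod"
  where
  "dsum_pmod I M =
    \<lparr>obj = (\<lambda>z. dsum_mod I (\<lambda>i. obj (M i) z)), arr = (\<lambda>z w f i. arr (M i) z w (f i))\<rparr>"

definition dual_pmod :: "('k::field, 'a, 'n::finite) pmod \<Rightarrow> ('k, 'a \<Rightarrow> 'k, 'n) pmod" where
  "dual_pmod M =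
    \<lparr>obj = (\<lambda>z. dual_mod (obj M (- z))),
     arr = (\<lambda>z w \<phi>. restrict (\<phi> \<circ> arr M (- w) (- z)) (carrier (obj M (- w))))\<rparr>"

text \<open>The dual, from the dual of \<open>N\<close> to the dual of \<open>M\<close>, of a morphism \<open>h\<close> from \<open>M\<close> to \<open>N\<close>.\<close>

definition dual_map :: "('k, 'a, 'n::finite) pmod \<Rightarrow> (int^'n \<Rightarrow> 'a \<Rightarrow> 'b) \<Rightarrow>
    int^'n \<Rightarrow> ('b \<Rightarrow> 'k) \<Rightarrow> 'a \<Rightarrow> 'k" where
  "dual_map M h z \<phi> = restrict (\<phi> \<circ> h (- z)) (carrier (obj M (- z)))"

text \<open>Kernel of \<open>g\<close> modulo image of \<open>f\<close> for morphisms \<open>f\<close> from \<open>A\<close> to \<open>B\<close> and \<open>g\<close> from \<open>B\<close> to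
  \<open>C\<close>.\<close>

definition ker_mod :: "('k, 'b, 'n::finite) pmod \<Rightarrow> ('k, 'c, 'n) pmod \<Rightarrow>
    (int^'n \<Rightarrow> 'b \<Rightarrow> 'c) \<Rightarrow> int^'n \<Rightarrow> ('k, 'b) module" where
  "ker_mod B C g z = (obj B z)\<lparr>carrier := {x \<in> carrier (obj B z). g z x = \<zero>\<^bsub>obj C z\<^esub>}\<rparr>"

definition homology_pmod :: "('k, 'a, 'n::finite) pmod \<Rightarrow> ('k, 'b, 'n) pmod \<Rightarrow>
    ('k, 'c, 'n) pmod \<Rightarrow> (int^'n \<Rightarrow> 'a \<Rightarrow> 'b) \<Rightarrow> (int^'n \<Rightarrow> 'b \<Rightarrow> 'c) \<Rightarrow> ('k, 'b set, 'n) pmod"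
  where
  "homology_pmod A B C f g =
    \<lparr>obj = (\<lambda>z. quot_mod (ker_mod B C g z) (f z ` carrier (obj A z))),
     arr = (\<lambda>z w. quot_map (ker_mod B C g w) (f w ` carrier (obj A w)) (arr B z w))\<rparr>"


section \<open>Simplicial filtrations\<close>

text \<open>A simplicial complex may be void, and every non-void one contains the empty simplex.\<close>

definition simplicial_complex :: "'v set set \<Rightarrow> bool" where
  "simplicial_complex X \<longleftrightarrow> (\<forall>\<sigma>\<in>X. finite \<sigma> \<and> (\<forall>\<tau>. \<tau> \<subseteq> \<sigma> \<longrightarrow> \<tau> \<in> X))"

definition simplicial_filtration :: "(int^'n::finite \<Rightarrow> 'v set set) \<Rightarrow> bool" where
  "simplicial_filtration K \<longleftrightarrow>
    (\<forall>z. simplicial_complex (K z)) \<and> (\<forall>z w. z \<le> w \<longrightarrow> K z \<subseteq> K w)"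

definition total_complex :: "(int^'n::finite \<Rightarrow> 'v set set) \<Rightarrow> 'v set set" where
  "total_complex K = (\<Union>z. K z)"

definition finite_filtration :: "(int^'n::finite \<Rightarrow> 'v set set) \<Rightarrow> bool" where
  "finite_filtration K \<longleftrightarrow> finite (total_complex K)"

text \<open>The minimal grade is required to be least, so that a simplex belongs to \<open>K z\<close> if and only
  if its grade is at most \<open>z\<close>. This also applies to the empty simplex.\<close>

definition one_critical :: "(int^'n::finite \<Rightarrow> 'v set set) \<Rightarrow> bool" where
  "one_critical K \<longleftrightarrow> (\<forall>\<sigma>\<in>total_complex K. \<exists>g. \<sigma> \<in> K g \<and> (\<forall>z. \<sigma> \<in> K z \<longrightarrow> g \<le> z))"

definition grade :: "(int^'n::finite \<Rightarrow> 'v set set) \<Rightarrow> 'v set \<Rightarrow> int^'n" where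
  "grade K \<sigma> = (LEAST z. \<sigma> \<in> K z)"

definition simplices :: "(int^'n::finite \<Rightarrow> 'v set set) \<Rightarrow> int \<Rightarrow> 'v set set" where
  "simplices K d = {\<sigma> \<in> total_complex K. int (card \<sigma>) - 1 = d}"

text \<open>An orientation of a simplex is represented by an ordering of its vertices.\<close>

definition orientation :: "(int^'n::finite \<Rightarrow> 'v set set) \<Rightarrow> ('v set \<Rightarrow> 'v list) \<Rightarrow> bool" where
  "orientation K ori \<longleftrightarrow> (\<forall>\<sigma>\<in>total_complex K. distinct (ori \<sigma>) \<and> set (ori \<sigma>) = \<sigma>)"

text \<open>The sign relating two orderings of the same vertices.\<close>

definition rel_sign :: "'v list \<Rightarrow> 'v list \<Rightarrow> int" where
  "rel_sign xs ys = sign (THE p. p permutes set xs \<and> map p xs = ys)"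

text \<open>A filtered simplicial map. It is a vertex map, of which only the values on the vertices of
  \<open>K\<close> matter.\<close>

definition filtered_map :: "(int^'n::finite \<Rightarrow> 'v set set) \<Rightarrow> (int^'n \<Rightarrow> 'w set set) \<Rightarrow>
    ('v \<Rightarrow> 'w) \<Rightarrow> bool" where
  "filtered_map K L f \<longleftrightarrow> (\<forall>z. \<forall>\<sigma>\<in>K z. f ` \<sigma> \<in> L z)"


section \<open>Chains and cochains\<close>

definition del_nth :: "nat \<Rightarrow> 'v list \<Rightarrow> 'v list" where
  "del_nth i xs = take i xs @ drop (Suc i) xs"

text \<open>The coefficient of \<open>\<tau>\<close> in the boundary of \<open>\<sigma>\<close>.\<close>

definition incidence :: "('v set \<Rightarrow> 'v list) \<Rightarrow> 'v set \<Rightarrow> 'v set \<Rightarrow> int" where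
  "incidence ori \<sigma> \<tau> =
    (\<Sum>i<length (ori \<sigma>). if set (del_nth i (ori \<sigma>)) = \<tau>
                         then (- 1) ^ i * rel_sign (del_nth i (ori \<sigma>)) (ori \<tau>) else 0)"

text \<open>The coefficient of \<open>\<tau>\<close> in the image of \<open>\<sigma>\<close> under the chain map induced by \<open>f\<close>.\<close>

definition map_coeff :: "('v set \<Rightarrow> 'v list) \<Rightarrow> ('w set \<Rightarrow> 'w list) \<Rightarrow> ('v \<Rightarrow> 'w) \<Rightarrow>
    'v set \<Rightarrow> 'w set \<Rightarrow> int" where
  "map_coeff ori ori' f \<sigma> \<tau> =
    (if inj_on f \<sigma> \<and> f ` \<sigma> = \<tau> then rel_sign (map f (ori \<sigma>)) (ori' \<tau>) else 0)"

text \<open>The morphism between direct sums of free modules, with basis elements indexed by \<open>S\<close> and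
  \<open>T\<close>, in which \<open>A s t\<close> is the coefficient at \<open>t\<close> of the image of \<open>s\<close>.\<close>

definition matrix_map :: "'s set \<Rightarrow> 't set \<Rightarrow> ('s \<Rightarrow> 't \<Rightarrow> int) \<Rightarrow>
    int^'n::finite \<Rightarrow> ('s \<Rightarrow> 'k::field) \<Rightarrow> 't \<Rightarrow> 'k" where
  "matrix_map S T A z x = (\<lambda>t. if t \<in> T then \<Sum>s\<in>S. of_int (A s t) * x s else 0)"

definition chains :: "(int^'n::finite \<Rightarrow> 'v set set) \<Rightarrow> int \<Rightarrow> ('k::field, 'v set \<Rightarrow> 'k, 'n) pmod"
  where
  "chains K d = dsum_pmod (simplices K d) (\<lambda>\<sigma>. free_pmod (grade K \<sigma>))"

definition boundary :: "(int^'n::finite \<Rightarrow> 'v set set) \<Rightarrow> ('v set \<Rightarrow> 'v list) \<Rightarrow> int \<Rightarrow>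
    int^'n \<Rightarrow> ('v set \<Rightarrow> 'k::field) \<Rightarrow> 'v set \<Rightarrow> 'k" where
  "boundary K ori d = matrix_map (simplices K d) (simplices K (d - 1)) (incidence ori)"

definition homology :: "(int^'n::finite \<Rightarrow> 'v set set) \<Rightarrow> ('v set \<Rightarrow> 'v list) \<Rightarrow> int \<Rightarrow>
    ('k::field, ('v set \<Rightarrow> 'k) set, 'n) pmod" where
  "homology K ori d =
    homology_pmod (chains K (d + 1)) (chains K d) (chains K (d - 1))
      (boundary K ori (d + 1)) (boundary K ori d)"

definition cochains :: "(int^'n::finite \<Rightarrow> 'v set set) \<Rightarrow> int \<Rightarrow>
    ('k::field, 'v set \<Rightarrow> 'k, 'n) pmod" where
  "cochains K d = dsum_pmod (simplices K d) (\<lambda>\<sigma>. free_pmod (- grade K \<sigma> + 1))"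

text \<open>The coboundary from degree \<open>d\<close> to degree \<open>d + 1\<close>.\<close>

definition coboundary :: "(int^'n::finite \<Rightarrow> 'v set set) \<Rightarrow> ('v set \<Rightarrow> 'v list) \<Rightarrow> int \<Rightarrow>
    int^'n \<Rightarrow> ('v set \<Rightarrow> 'k::field) \<Rightarrow> 'v set \<Rightarrow> 'k" where
  "coboundary K ori d =
    matrix_map (simplices K d) (simplices K (d + 1)) (\<lambda>\<tau> \<sigma>. incidence ori \<sigma> \<tau>)"

definition cohomology :: "(int^'n::finite \<Rightarrow> 'v set set) \<Rightarrow> ('v set \<Rightarrow> 'v list) \<Rightarrow> int \<Rightarrow>
    ('k::field, ('v set \<Rightarrow> 'k) set, 'n) pmod" where
  "cohomology K ori d =
    homology_pmod (cochains K (d - 1)) (cochains K d) (cochains K (d + 1))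
      (coboundary K ori (d - 1)) (coboundary K ori d)"

text \<open>The maps induced by a filtered simplicial map \<open>f\<close> from \<open>K\<close> to \<open>L\<close>: covariantly on homology,
  and contravariantly, by the transposed matrix, on cohomology.\<close>

definition homology_map :: "(int^'n::finite \<Rightarrow> 'v set set) \<Rightarrow> ('v set \<Rightarrow> 'v list) \<Rightarrow>
    (int^'n \<Rightarrow> 'w set set) \<Rightarrow> ('w set \<Rightarrow> 'w list) \<Rightarrow> ('v \<Rightarrow> 'w) \<Rightarrow> int \<Rightarrow>
    int^'n \<Rightarrow> ('v set \<Rightarrow> 'k::field) set \<Rightarrow> ('w set \<Rightarrow> 'k) set" where
  "homology_map K ori L ori' f d z =
    quot_map (ker_mod (chains L d) (chains L (d - 1)) (boundary L ori' d) z)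
      (boundary L ori' (d + 1) z ` carrier (obj (chains L (d + 1)) z))
      (matrix_map (simplices K d) (simplices L d) (map_coeff ori ori' f) z)"

definition cohomology_map :: "(int^'n::finite \<Rightarrow> 'v set set) \<Rightarrow> ('v set \<Rightarrow> 'v list) \<Rightarrow>
    (int^'n \<Rightarrow> 'w set set) \<Rightarrow> ('w set \<Rightarrow> 'w list) \<Rightarrow> ('v \<Rightarrow> 'w) \<Rightarrow> int \<Rightarrow>
    int^'n \<Rightarrow> ('w set \<Rightarrow> 'k::field) set \<Rightarrow> ('v set \<Rightarrow> 'k) set" where
  "cohomology_map K ori L ori' f d z =
    quot_map (ker_mod (cochains K d) (cochains K (d + 1)) (coboundary K ori d) z)
      (coboundary K ori (d - 1) z ` carrier (obj (cochains K (d - 1)) z))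
      (matrix_map (simplices L d) (simplices K d) (\<lambda>\<tau> \<sigma>. map_coeff ori ori' f \<sigma> \<tau>) z)"

text \<open>The objects between which naturality is formulated: finite one-critical filtrations with
  oriented simplices all of whose homology modules over \<^typ>\<open>'k\<close> have finite total dimension.\<close>

definition finite_homology_filtration ::
    "'k::field itself \<Rightarrow> (int^'n::finite \<Rightarrow> 'v set set) \<Rightarrow> ('v set \<Rightarrow> 'v list) \<Rightarrow> bool" where
  "finite_homology_filtration _ K ori \<longleftrightarrow>
    simplicial_filtration K \<and> finite_filtration K \<and> one_critical K \<and> orientation K ori \<and>
    (\<forall>d. total_dim (homology K ori d :: ('k, ('v set \<Rightarrow> 'k) set, 'n) pmod) < \<infinity>)"

end

theory Submission
  imports Defs "HOL-Library.Function_Algebras"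
begin

text \<open>Fix \<open>z\<close>. For disjoint sets \<open>I\<close>, \<open>J\<close> of coordinates let \<open>C J I\<close> be the complex of chains on the
  simplices whose grade exceeds \<open>z\<close> strictly in the coordinates in \<open>J\<close>, is unrestricted in those
  in \<open>I\<close>, and is at most \<open>z\<close> in the others; its boundary operator is truncated. For a coordinate \<open>i\<close> outside
  of \<open>I\<close> and \<open>J\<close> there is a short exact sequence from \<open>C J I\<close> through \<open>C J (I \<union> {i})\<close> to \<open>C (J \<union> {i}) I\<close>.
  Since the homology has finite total dimension, \<open>C {} I\<close> is exact for nonempty \<open>I\<close>, and then so is
  \<open>C J I\<close>. Hence all connecting homomorphisms for \<open>I = {}\<close> are isomorphisms, and composing them over the
  \<open>n\<close> coordinates identifies the homology of \<open>C {} {}\<close> in degree \<open>d\<close>, which is that of the filtration at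
  \<open>z\<close>, with the homology of \<open>C UNIV {}\<close> in degree \<open>d + n\<close>. The latter complex is dual to the cochain
  complex at \<open>-z\<close>. Each step is compatible with filtered chain maps and with increasing \<open>z\<close>.\<close>

text \<open>The shift by \<open>1\<close> in the cochains supplies the strict inequality: over the
  integers, \<open>z $ j < g $ j\<close> in every coordinate says the same as
  \<open>- g + 1 \<le> - z\<close>. The obstacle is naturality. A connecting homomorphism is
  computed through a lift, and a composite of \<open>n\<close> of them through \<open>n\<close>
  successive lifts. Each is therefore kept as a relation between cycles; a chain map only has to
  send related pairs to related pairs, and a representative is chosen once, at the very end. The
  order of the coordinates must be the same for all filtrations, since exchanging two consecutive
  connecting homomorphisms changes the sign of the composite. All chain groups are spaces of
  functions on simplices with prescribed support, so that inclusions are identities and projections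
  are restrictions of functions. Over a field the last step is the perfect pairing between homology
  and cohomology of a finite complex.\<close>

no_notation vec_index (infixl "$" 100)

section \<open>Linear algebra of function spaces\<close>

definition fscale :: "'k::field \<Rightarrow> ('s \<Rightarrow> 'k) \<Rightarrow> 's \<Rightarrow> 'k" where
  "fscale c x = (\<lambda>s. c * x s)"

interpretation fs: vector_space "fscale :: 'k::field \<Rightarrow> ('s \<Rightarrow> 'k) \<Rightarrow> 's \<Rightarrow> 'k"
  by unfold_locales (auto simp: fscale_def fun_eq_iff algebra_simps)

interpretation fsp: vector_space_pair
  "fscale :: 'k::field \<Rightarrow> ('s \<Rightarrow> 'k) \<Rightarrow> 's \<Rightarrow> 'k" "fscale :: 'k \<Rightarrow> ('t \<Rightarrow> 'k) \<Rightarrow> 't \<Rightarrow> 'k"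
  by unfold_locales

lemma fscale_apply [simp]: "fscale c x s = c * x s"
  by (simp add: fscale_def)

lemma fscale_0 [simp]: "fscale c 0 = 0" "fscale 0 x = 0"
  by (simp_all add: fun_eq_iff)

text \<open>The identity on a basis of \<open>U\<close> extends linearly with range its span.
  Composing with this projection extends functionals from \<open>U\<close> and presents
  \<open>U\<close> as a linear image of a larger space.\<close>

lemma subspace_projection:
  fixes U :: "('s \<Rightarrow> 'k::field) set"
  assumes "fs.subspace U"
  obtains P where "Vector_Spaces.linear fscale fscale P" "range P = U" "\<And>u. u \<in> U \<Longrightarrow> P u = u"
proof -
  obtain B where B: "B \<subseteq> U" "fs.independent B" "U \<subseteq> fs.span B"
    using fs.maximal_independent_subset by blast
  have U: "fs.span B = U"
    using B assms fs.span_minimal by blast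
  obtain P :: "('s \<Rightarrow> 'k) \<Rightarrow> ('s \<Rightarrow> 'k)" where
    P: "Vector_Spaces.linear fscale fscale P" "\<forall>x\<in>B. P x = x" "range P = fs.span ((\<lambda>x. x) ` B)"
    using fsp.linear_independent_extend_subspace[OF B(2), of "\<lambda>x. x"] by blast
  have "P u = u" if "u \<in> U" for u
    using fsp.linear_eq_on[of P "\<lambda>x. x" u B] P that U fs.linear_ident by auto
  with P U that show thesis by simp
qed

section \<open>Finite-dimensional spaces of functions\<close>

definition supported :: "'s set \<Rightarrow> ('s \<Rightarrow> 'k::zero) set" where
  "supported E = {x. \<forall>s. s \<notin> E \<longrightarrow> x s = 0}"

lemma supported_subspace: "fs.subspace (supported E)"
  by (auto simp: supported_def fs.subspace_def)

definition fn_mod :: "('s \<Rightarrow> 'k) set \<Rightarrow> ('k::field, 's \<Rightarrow> 'k) module" where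
  "fn_mod U = \<lparr>carrier = U, mult = (\<lambda>_ _ _. 0), one = (\<lambda>_. 0), zero = (\<lambda>_. 0),
     add = (\<lambda>x y s. x s + y s), smult = (\<lambda>c x s. c * x s)\<rparr>"

lemma fn_mod_simps [simp]:
  "carrier (fn_mod U) = U" "\<zero>\<^bsub>fn_mod U\<^esub> = 0" "x \<oplus>\<^bsub>fn_mod U\<^esub> y = x + y"
  "c \<odot>\<^bsub>fn_mod U\<^esub> x = fscale c x"
  by (auto simp: fn_mod_def fun_eq_iff)

text \<open>\<open>W\<close> is merely a record with operations, and every axiom is transported
  along the surjection \<open>h\<close>. Used for coordinate space onto \<open>U\<close>, then for
  \<open>U\<close> onto a quotient and for an annihilator onto a dual, it yields all vector spaces
  that occur. The zero of \<open>W\<close> is an independent record field, hence the separate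
  equation for it.\<close>

lemma linear_image_vectorspace:
  fixes V :: "('k::field, 'a) module" and W :: "('k, 'b) module"
  assumes V: "vectorspace class_ring V"
    and surj: "h ` carrier V = carrier W"
    and add: "\<And>x y. x \<in> carrier V \<Longrightarrow> y \<in> carrier V \<Longrightarrow> h (x \<oplus>\<^bsub>V\<^esub> y) = h x \<oplus>\<^bsub>W\<^esub> h y"
    and smult: "\<And>c x. x \<in> carrier V \<Longrightarrow> h (c \<odot>\<^bsub>V\<^esub> x) = c \<odot>\<^bsub>W\<^esub> h x"
    and zero: "h \<zero>\<^bsub>V\<^esub> = \<zero>\<^bsub>W\<^esub>"
  shows "vectorspace class_ring W" and "linear_map class_ring V W h"
proof -
  interpret V: vectorspace class_ring V by (fact V)
  have ex: "\<And>y. y \<in> carrier W \<Longrightarrow> \<exists>x\<in>carrier V. y = h x" and hW: "\<And>x. x \<in> carrier V \<Longrightarrow> h x \<in> carrier W"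
    using surj by auto
  have "abelian_group W"
  proof (rule abelian_groupI)
    fix x y assume "x \<in> carrier W" "y \<in> carrier W"
    then show "x \<oplus>\<^bsub>W\<^esub> y \<in> carrier W" "x \<oplus>\<^bsub>W\<^esub> y = y \<oplus>\<^bsub>W\<^esub> x"
      by (auto dest!: ex simp: hW V.a_comm simp flip: add)
  next
    show "\<zero>\<^bsub>W\<^esub> \<in> carrier W"
      using hW[of "\<zero>\<^bsub>V\<^esub>"] zero by simp
  next
    fix x y z assume "x \<in> carrier W" "y \<in> carrier W" "z \<in> carrier W"
    then show "x \<oplus>\<^bsub>W\<^esub> y \<oplus>\<^bsub>W\<^esub> z = x \<oplus>\<^bsub>W\<^esub> (y \<oplus>\<^bsub>W\<^esub> z)"
      by (auto dest!: ex simp: hW V.a_assoc simp flip: add)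
  next
    fix x assume "x \<in> carrier W"
    then obtain a where a: "a \<in> carrier V" "x = h a" using ex by blast
    then show "\<zero>\<^bsub>W\<^esub> \<oplus>\<^bsub>W\<^esub> x = x"
      by (simp flip: zero add)
    show "\<exists>y\<in>carrier W. y \<oplus>\<^bsub>W\<^esub> x = \<zero>\<^bsub>W\<^esub>"
      using a by (intro bexI[of _ "h (\<ominus>\<^bsub>V\<^esub> a)"]) (simp_all add: hW V.l_neg flip: zero add)
  qed
  then have "module class_ring W"
  proof (rule Module.moduleI[OF class_cring.is_cring])
    fix c :: 'k and x assume "x \<in> carrier W"
    then show "c \<odot>\<^bsub>W\<^esub> x \<in> carrier W"
      by (auto dest!: ex simp: hW simp flip: smult)
  next
    fix c d :: 'k and x assume "x \<in> carrier W"
    then obtain a where a: "a \<in> carrier V" "x = h a" using ex by blast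
    show "(c \<oplus>\<^bsub>class_ring\<^esub> d) \<odot>\<^bsub>W\<^esub> x = c \<odot>\<^bsub>W\<^esub> x \<oplus>\<^bsub>W\<^esub> d \<odot>\<^bsub>W\<^esub> x"
      using a V.smult_l_distr[of c d a] by (simp flip: smult add)
    show "(c \<otimes>\<^bsub>class_ring\<^esub> d) \<odot>\<^bsub>W\<^esub> x = c \<odot>\<^bsub>W\<^esub> (d \<odot>\<^bsub>W\<^esub> x)"
      using a V.smult_assoc1[of c d a] by (simp flip: smult add)
  next
    fix c :: 'k and x y assume "x \<in> carrier W" "y \<in> carrier W"
    then obtain a b where a: "a \<in> carrier V" "x = h a" "b \<in> carrier V" "y = h b" using ex by blast
    then show "c \<odot>\<^bsub>W\<^esub> (x \<oplus>\<^bsub>W\<^esub> y) = c \<odot>\<^bsub>W\<^esub> x \<oplus>\<^bsub>W\<^esub> c \<odot>\<^bsub>W\<^esub> y"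
      using V.smult_r_distr[of c a b] by (simp flip: smult add)
  next
    fix x assume "x \<in> carrier W"
    then obtain a where "a \<in> carrier V" "x = h a" using ex by blast
    then show "\<one>\<^bsub>class_ring\<^esub> \<odot>\<^bsub>W\<^esub> x = x"
      using V.smult_one[of a] by (simp flip: smult)
  qed
  then show W: "vectorspace class_ring W"
    by (simp add: vectorspace_def class_field)
  show "linear_map class_ring V W h"
    using V W by (auto simp: linear_map_def mod_hom_def mod_hom_axioms_def vectorspace_def
        LinearCombinations.module_hom_def hW add smult)
qed

lemma linear_image_fin_dim:
  assumes "linear_map class_ring V W h" "h ` carrier V = carrier W"
    "vectorspace.fin_dim class_ring V"
  shows "vectorspace.fin_dim class_ring W"
  using linear_map.surj_fin_dim[OF assms(1,3,2)] .

lemma linear_mapI: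
  assumes "vectorspace class_ring V" "vectorspace class_ring W"
    and "\<And>x. x \<in> carrier V \<Longrightarrow> h x \<in> carrier W"
    and "\<And>x y. x \<in> carrier V \<Longrightarrow> y \<in> carrier V \<Longrightarrow> h (x \<oplus>\<^bsub>V\<^esub> y) = h x \<oplus>\<^bsub>W\<^esub> h y"
    and "\<And>c x. x \<in> carrier V \<Longrightarrow> h (c \<odot>\<^bsub>V\<^esub> x) = c \<odot>\<^bsub>W\<^esub> h x"
  shows "linear_map class_ring V W h"
  using assms by (auto simp: linear_map_def mod_hom_def mod_hom_axioms_def vectorspace_def
        LinearCombinations.module_hom_def)

text \<open>Column vectors are read as functions on \<open>E\<close> through an enumeration of
  \<open>E\<close> and then projected, so \<open>U\<close> is a linear image of coordinate
  space.\<close>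

lemma fn_mod_vectorspace:
  fixes U :: "('s \<Rightarrow> 'k::field) set"
  assumes U: "fs.subspace U" "U \<subseteq> supported E" and E: "finite E"
  shows "vectorspace class_ring (fn_mod U)" and "vectorspace.fin_dim class_ring (fn_mod U)"
proof -
  obtain P where P: "Vector_Spaces.linear fscale fscale P" "range P = U" "\<And>u. u \<in> U \<Longrightarrow> P u = u"
    using subspace_projection[OF U(1)] by blast
  obtain i where i: "bij_betw i E {0..<card E}"
    using ex_bij_betw_finite_nat[OF E] by blast
  have iE: "i s < card E" if "s \<in> E" for s
    using bij_betwE[OF i] that by auto
  interpret vec: vec_space "TYPE('k)" "card E" .
  define h :: "'k Matrix.vec \<Rightarrow> 's \<Rightarrow> 'k" where "h v = (\<lambda>s. if s \<in> E then vec_index v (i s) else 0)" for v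
  have surj: "(P \<circ> h) ` carrier (module_vec TYPE('k) (card E)) = carrier (fn_mod U)"
  proof -
    have "\<exists>v\<in>carrier_vec (card E). u = P (h v)" if "u \<in> U" for u
    proof (intro bexI)
      have "h (Matrix.vec (card E) (\<lambda>j. u (inv_into E i j))) = u"
        using that U(2) i iE by (auto simp: h_def supported_def fun_eq_iff bij_betw_def)
      with P(3)[OF that] show "u = P (h (Matrix.vec (card E) (\<lambda>j. u (inv_into E i j))))" by simp
    qed auto
    with P(2) show ?thesis
      by (auto simp: module_vec_simps image_iff)
  qed
  have lin: "(P \<circ> h) (x \<oplus>\<^bsub>module_vec TYPE('k) (card E)\<^esub> y) = (P \<circ> h) x \<oplus>\<^bsub>fn_mod U\<^esub> (P \<circ> h) y"
    "(P \<circ> h) (c \<odot>\<^bsub>module_vec TYPE('k) (card E)\<^esub> x) = c \<odot>\<^bsub>fn_mod U\<^esub> (P \<circ> h) x"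
    if "x \<in> carrier (module_vec TYPE('k) (card E))" "y \<in> carrier (module_vec TYPE('k) (card E))" for x y c
  proof -
    have "h (x + y) = h x + h y" "h (c \<cdot>\<^sub>v x) = fscale c (h x)"
      using that iE by (auto simp: h_def fun_eq_iff module_vec_simps)
    then show "(P \<circ> h) (x \<oplus>\<^bsub>module_vec TYPE('k) (card E)\<^esub> y) = (P \<circ> h) x \<oplus>\<^bsub>fn_mod U\<^esub> (P \<circ> h) y"
    "(P \<circ> h) (c \<odot>\<^bsub>module_vec TYPE('k) (card E)\<^esub> x) = c \<odot>\<^bsub>fn_mod U\<^esub> (P \<circ> h) x"
      using fsp.linear_add[OF P(1)] fsp.linear_scale[OF P(1)] by (simp_all add: module_vec_simps)
  qed
  have "h (0\<^sub>v (card E)) = 0"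
    using iE by (auto simp: h_def fun_eq_iff)
  then have "(P \<circ> h) \<zero>\<^bsub>module_vec TYPE('k) (card E)\<^esub> = \<zero>\<^bsub>fn_mod U\<^esub>"
    using fsp.linear_0[OF P(1)] by (simp add: module_vec_simps)
  note * = linear_image_vectorspace[OF vec_vs surj lin(1) lin(2) this]
  show "vectorspace class_ring (fn_mod U)"
    using *(1) by (simp add: module_vec_simps)
  show "vectorspace.fin_dim class_ring (fn_mod U)"
    using linear_image_fin_dim[OF *(2) surj] vec.fin_dim by (simp add: module_vec_simps)
qed

text \<open>Precomposition with a projection onto \<open>U\<close> extends the functional to all
  functions; its values at the indicator functions of points of \<open>E\<close> are the
  coefficients.\<close>

lemma functional_representation:
  fixes U :: "('s \<Rightarrow> 'k::field) set"
  assumes U: "fs.subspace U" "U \<subseteq> supported E" and E: "finite E"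
    and add: "\<And>x y. x \<in> U \<Longrightarrow> y \<in> U \<Longrightarrow> \<phi> (x + y) = \<phi> x + \<phi> y"
    and scale: "\<And>c x. x \<in> U \<Longrightarrow> \<phi> (fscale c x) = c * \<phi> x"
  obtains y where "y \<in> supported E" "\<And>u. u \<in> U \<Longrightarrow> \<phi> u = (\<Sum>s\<in>E. y s * u s)"
proof -
  obtain P where P: "Vector_Spaces.linear fscale fscale P" "range P = U" "\<And>u. u \<in> U \<Longrightarrow> P u = u"
    using subspace_projection[OF U(1)] by blast
  define ind :: "'s \<Rightarrow> 's \<Rightarrow> 'k" where "ind s = (\<lambda>t. if t = s then 1 else 0)" for s
  define y where "y s = (if s \<in> E then \<phi> (P (ind s)) else 0)" for s
  have PU: "P x \<in> U" for x using P(2) by auto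
  have *: "\<phi> (P (\<lambda>t. if t \<in> F then u t else 0)) = (\<Sum>s\<in>F. y s * u s)" if "finite F" "F \<subseteq> E" for F u
    using that
  proof (induction F)
    case empty
    have "\<phi> (P 0) = 0 * \<phi> (P 0)"
      using scale[OF PU, of 0 0] fsp.linear_scale[OF P(1), of 0 0] by simp
    then show ?case by (simp add: zero_fun_def)
  next
    case (insert a F)
    have "(\<lambda>t. if t \<in> insert a F then u t else 0) = fscale (u a) (ind a) + (\<lambda>t. if t \<in> F then u t else 0)"
      using insert by (auto simp: fun_eq_iff ind_def)
    then have "\<phi> (P (\<lambda>t. if t \<in> insert a F then u t else 0)) =
        u a * \<phi> (P (ind a)) + \<phi> (P (\<lambda>t. if t \<in> F then u t else 0))"
      by (simp only: fsp.linear_add[OF P(1)] fsp.linear_scale[OF P(1)] add PU scale fs.subspace_scale[OF U(1)])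
    with insert show ?case by (simp add: y_def mult.commute)
  qed
  show thesis
  proof (rule that)
    show "y \<in> supported E" by (simp add: y_def supported_def)
    fix u assume u: "u \<in> U"
    then have "(\<lambda>t. if t \<in> E then u t else 0) = u"
      using U(2) by (auto simp: supported_def fun_eq_iff)
    with *[OF E subset_refl, of u] P(3)[OF u] show "\<phi> u = (\<Sum>s\<in>E. y s * u s)" by simp
  qed
qed

section \<open>Matrices, truncation and the standard pairing\<close>

definition mat_app :: "'s set \<Rightarrow> ('s \<Rightarrow> 't \<Rightarrow> 'k::field) \<Rightarrow> ('s \<Rightarrow> 'k) \<Rightarrow> 't \<Rightarrow> 'k" where
  "mat_app X A x = (\<lambda>t. \<Sum>s\<in>X. A s t * x s)"

definition rest :: "'s set \<Rightarrow> ('s \<Rightarrow> 'k::zero) \<Rightarrow> 's \<Rightarrow> 'k" where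
  "rest S x = (\<lambda>s. if s \<in> S then x s else 0)"

definition pairing :: "'s set \<Rightarrow> ('s \<Rightarrow> 'k::field) \<Rightarrow> ('s \<Rightarrow> 'k) \<Rightarrow> 'k" where
  "pairing X x y = (\<Sum>s\<in>X. x s * y s)"

lemma mat_app_add: "mat_app X A (x + y) = mat_app X A x + mat_app X A y"
  by (simp add: mat_app_def fun_eq_iff algebra_simps sum.distrib)

lemma mat_app_scale: "mat_app X A (fscale c x) = fscale c (mat_app X A x)"
  by (simp add: mat_app_def fun_eq_iff sum_distrib_left mult.left_commute)

lemma mat_app_mat_app:
  "mat_app Y B (mat_app X A x) = mat_app X (\<lambda>s u. \<Sum>t\<in>Y. A s t * B t u) x"
  unfolding mat_app_def sum_distrib_left sum_distrib_right
  by (subst sum.swap) (simp add: mult_ac)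

lemma mat_app_nonzero:
  assumes "mat_app X A x t \<noteq> 0"
  obtains s where "s \<in> X" "A s t \<noteq> 0" "x s \<noteq> 0"
proof -
  have "\<exists>s\<in>X. A s t * x s \<noteq> 0"
    using assms unfolding mat_app_def by (meson sum.neutral)
  then show thesis using that by auto
qed

lemma rest_add: "rest S (x + y) = rest S x + rest S (y :: 's \<Rightarrow> 'k::field)"
  by (auto simp: rest_def fun_eq_iff)

lemma rest_scale: "rest S (fscale c x) = fscale c (rest S x)"
  by (auto simp: rest_def fun_eq_iff)

lemma rest_diff: "rest S (x - y) = rest S x - rest S (y :: 's \<Rightarrow> 'k::field)"
  by (auto simp: rest_def fun_eq_iff)

lemma rest_id: "x \<in> supported S \<Longrightarrow> rest S x = x"
  by (auto simp: rest_def supported_def fun_eq_iff)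

lemma supported_mono: "x \<in> supported S \<Longrightarrow> S \<subseteq> T \<Longrightarrow> x \<in> supported T"
  by (auto simp: supported_def)

lemma rest_rest: "S \<subseteq> T \<Longrightarrow> rest S (rest T x) = rest S x"
  by (auto simp: rest_def fun_eq_iff)

text \<open>The tool for moving truncations past matrices: entries of \<open>x\<close> outside of
  \<open>S\<close> never reach \<open>T\<close>. Compatibility of truncated boundaries with each
  other and with chain maps reduces to locating the intermediate simplices.\<close>

lemma rest_mat_app_rest:
  assumes "\<And>s t. s \<in> X \<Longrightarrow> t \<in> T \<Longrightarrow> A s t \<noteq> 0 \<Longrightarrow> x s \<noteq> 0 \<Longrightarrow> s \<in> S"
  shows "rest T (mat_app X A (rest S x)) = rest T (mat_app X A x)"
proof
  fix t
  have "(\<Sum>s\<in>X. A s t * rest S x s) = (\<Sum>s\<in>X. A s t * x s)" if "t \<in> T"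
    using assms[OF _ that] by (intro sum.cong refl) (auto simp: rest_def)
  then show "rest T (mat_app X A (rest S x)) t = rest T (mat_app X A x) t"
    by (auto simp: mat_app_def rest_def)
qed

lemma pairing_mat_app: "pairing Y (mat_app X A x) y = pairing X x (mat_app Y (\<lambda>t s. A s t) y)"
  unfolding pairing_def mat_app_def sum_distrib_left sum_distrib_right
  by (subst sum.swap) (simp add: mult_ac)

lemma pairing_add:
  "pairing X (x + x') y = pairing X x y + pairing X x' y"
  "pairing X x (y + y') = pairing X x y + pairing X x y'"
  by (simp_all add: pairing_def algebra_simps sum.distrib)

lemma pairing_scale:
  "pairing X (fscale c x) y = c * pairing X x y"
  "pairing X x (fscale c y) = c * pairing X x y"
  by (simp_all add: pairing_def sum_distrib_left mult_ac)

lemma pairing_rest: "y \<in> supported S \<Longrightarrow> pairing X (rest S x) y = pairing X x y"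
  by (auto simp: pairing_def rest_def supported_def intro!: sum.cong)

lemma pairing_rest_right: "x \<in> supported S \<Longrightarrow> pairing X x (rest S y) = pairing X x y"
  by (auto simp: pairing_def rest_def supported_def intro!: sum.cong)

lemma pairing_zero [simp]: "pairing X 0 y = 0" "pairing X x 0 = 0"
  by (simp_all add: pairing_def)

section \<open>Quotients and duals\<close>

definition coset :: "('s \<Rightarrow> 'k::field) set \<Rightarrow> ('s \<Rightarrow> 'k) \<Rightarrow> ('s \<Rightarrow> 'k) set" where
  "coset B x = {y. y - x \<in> B}"

lemma a_r_coset_fn_mod: "B +>\<^bsub>fn_mod U\<^esub> x = coset B x"
proof -
  have "y \<in> coset B x \<longleftrightarrow> (\<exists>b\<in>B. y = b + x)" for y
    by (auto simp: coset_def intro: bexI[of _ "y - x"])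
  then show ?thesis
    by (auto simp: a_r_coset_def' intro: exI)
qed

lemma coset_self: "fs.subspace B \<Longrightarrow> x \<in> coset B x"
  by (simp add: coset_def fs.subspace_0)

lemma coset_eqI: "fs.subspace B \<Longrightarrow> x - y \<in> B \<Longrightarrow> coset B x = coset B y"
proof -
  assume B: "fs.subspace B" "x - y \<in> B"
  have "w - x \<in> B \<longleftrightarrow> w - y \<in> B" for w
    using fs.subspace_add[OF B(1) _ B(2), of "w - x"] fs.subspace_diff[OF B(1) _ B(2), of "w - y"]
    by auto
  then show ?thesis by (simp add: coset_def)
qed

lemma coset_eq_iff: "fs.subspace B \<Longrightarrow> coset B x = coset B y \<longleftrightarrow> x - y \<in> B"
  using coset_self[of B x] coset_eqI[of B x y] by (auto simp: coset_def)

lemma coset_some: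
  assumes "fs.subspace B"
  shows "(SOME y. y \<in> coset B x) - x \<in> B"
proof -
  have "(SOME y. y \<in> coset B x) \<in> coset B x"
    by (rule someI[where P = "\<lambda>y. y \<in> coset B x", OF coset_self[OF assms]])
  then show ?thesis by (simp add: coset_def)
qed

lemma carrier_quot_mod: "carrier (quot_mod (fn_mod U) B) = coset B ` U"
  by (auto simp: quot_mod_def A_RCOSETS_def' a_r_coset_fn_mod)

lemma zero_quot_mod: "fs.subspace B \<Longrightarrow> \<zero>\<^bsub>quot_mod (fn_mod U) B\<^esub> = coset B 0"
  by (simp add: quot_mod_def coset_def)

lemma add_quot_mod:
  assumes B: "fs.subspace B"
  shows "coset B x \<oplus>\<^bsub>quot_mod (fn_mod U) B\<^esub> coset B y = coset B (x + y)"
proof -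
  have "\<exists>a\<in>coset B x. \<exists>b\<in>coset B y. w = a + b" if "w \<in> coset B (x + y)" for w
    using that coset_self[OF B, of y]
    by (intro bexI[of _ "w - y"] bexI[of _ y]) (auto simp: coset_def algebra_simps)
  moreover have "a + b \<in> coset B (x + y)" if "a \<in> coset B x" "b \<in> coset B y" for a b
    using that fs.subspace_add[OF B, of "a - x" "b - y"] by (simp add: coset_def algebra_simps)
  ultimately show ?thesis
    by (auto simp: quot_mod_def set_add_def')
qed

lemma smult_quot_mod:
  assumes B: "fs.subspace B"
  shows "c \<odot>\<^bsub>quot_mod (fn_mod U) B\<^esub> coset B x = coset B (fscale c x)"
proof -
  have "coset B (fscale c a) = coset B (fscale c x)" if "a \<in> coset B x" for a
    using that fs.subspace_scale[OF B, of "a - x" c]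
    by (intro coset_eqI B) (simp add: coset_def fs.scale_right_diff_distrib)
  then have "(\<Union>a\<in>coset B x. coset B (fscale c a)) = coset B (fscale c x)"
    using coset_self[OF B, of x] by blast
  then show ?thesis
    by (simp add: quot_mod_def a_r_coset_fn_mod)
qed

text \<open>The condition on \<open>h\<close> concerns the coset of \<open>x\<close> only, because
  the matrix maps inserted for \<open>h\<close> later on are identified with chain maps on chains,
  not on all functions.\<close>

lemma quot_map_coset:
  assumes B: "fs.subspace B" and B': "fs.subspace B'"
    and h: "\<And>b. b - x \<in> B \<Longrightarrow> h b - h x \<in> B'"
  shows "quot_map (fn_mod U') B' h (coset B x) = coset B' (h x)"
proof -
  have "coset B' (h a) = coset B' (h x)" if "a \<in> coset B x" for a
    using that h by (intro coset_eqI B') (simp add: coset_def)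
  then have "(\<Union>a\<in>coset B x. coset B' (h a)) = coset B' (h x)"
    using coset_self[OF B, of x] by blast
  then show ?thesis
    by (simp add: quot_map_def a_r_coset_fn_mod)
qed

lemma quot_mod_vectorspace:
  assumes U: "fs.subspace U" "U \<subseteq> supported E" "finite E" and B: "fs.subspace B"
  shows "vectorspace class_ring (quot_mod (fn_mod U) B)"
    and "vectorspace.fin_dim class_ring (quot_mod (fn_mod U) B)"
proof -
  note 1 = fn_mod_vectorspace[OF U]
  have surj: "coset B ` carrier (fn_mod U) = carrier (quot_mod (fn_mod U) B)"
    by (simp add: carrier_quot_mod)
  note 2 = linear_image_vectorspace[OF 1(1) surj]
  have *: "vectorspace class_ring (quot_mod (fn_mod U) B)"
    "linear_map class_ring (fn_mod U) (quot_mod (fn_mod U) B) (coset B)"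
    by (rule 2; simp add: add_quot_mod smult_quot_mod zero_quot_mod B)+
  show "vectorspace class_ring (quot_mod (fn_mod U) B)" by (fact *)
  show "vectorspace.fin_dim class_ring (quot_mod (fn_mod U) B)"
    by (rule linear_image_fin_dim[OF *(2) surj 1(2)])
qed

section \<open>Functionals on quotients\<close>

lemma carrier_dual_mod:
  "\<phi> \<in> carrier (dual_mod V) \<longleftrightarrow> \<phi> \<in> extensional (carrier V) \<and>
    (\<forall>x\<in>carrier V. \<forall>y\<in>carrier V. \<phi> (x \<oplus>\<^bsub>V\<^esub> y) = \<phi> x + \<phi> y) \<and>
    (\<forall>c. \<forall>x\<in>carrier V. \<phi> (c \<odot>\<^bsub>V\<^esub> x) = c * \<phi> x)"
  by (auto simp: dual_mod_def LinearCombinations.module_hom_def field_mod_def PiE_def)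

lemma dual_mod_simps:
  "\<zero>\<^bsub>dual_mod V\<^esub> = (\<lambda>x\<in>carrier V. 0)"
  "\<phi> \<oplus>\<^bsub>dual_mod V\<^esub> \<psi> = (\<lambda>x\<in>carrier V. \<phi> x + \<psi> x)"
  "c \<odot>\<^bsub>dual_mod V\<^esub> \<phi> = (\<lambda>x\<in>carrier V. c * \<phi> x)"
  by (simp_all add: dual_mod_def class_ring.func_space_def)

definition annihilator :: "'s set \<Rightarrow> ('s \<Rightarrow> 'k::field) set \<Rightarrow> ('s \<Rightarrow> 'k) set" where
  "annihilator E B = {y \<in> supported E. \<forall>b\<in>B. pairing E y b = 0}"

lemma annihilator_subspace: "fs.subspace (annihilator E B)"
  using supported_subspace[of E]
  by (auto simp: fs.subspace_def annihilator_def pairing_add pairing_scale)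

text \<open>The value is taken at an arbitrary representative, which is harmless once
  \<open>y\<close> annihilates \<open>B\<close>. The restricted abstraction provides the normal form
  required of elements of the dual.\<close>

definition functional :: "'s set \<Rightarrow> ('s \<Rightarrow> 'k::field) set \<Rightarrow> ('s \<Rightarrow> 'k) set \<Rightarrow>
    ('s \<Rightarrow> 'k) \<Rightarrow> ('s \<Rightarrow> 'k) set \<Rightarrow> 'k" where
  "functional E U B y = (\<lambda>C\<in>coset B ` U. pairing E y (SOME x. x \<in> C))"

lemma functional_coset:
  assumes "fs.subspace B" "x \<in> U" "\<And>b. b \<in> B \<Longrightarrow> pairing E y b = 0"
  shows "functional E U B y (coset B x) = pairing E y x"
proof -
  have "pairing E y ((SOME x'. x' \<in> coset B x) - x + x) = pairing E y x"
    unfolding pairing_add using assms(3)[OF coset_some[OF assms(1)]] by simp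
  with assms(2) show ?thesis by (simp add: functional_def)
qed

lemma functional_in_dual:
  assumes U: "fs.subspace U" and B: "fs.subspace B" and y: "\<And>b. b \<in> B \<Longrightarrow> pairing E y b = 0"
  shows "functional E U B y \<in> carrier (dual_mod (quot_mod (fn_mod U) B))"
  unfolding carrier_dual_mod carrier_quot_mod
proof (intro conjI ballI allI)
  show "functional E U B y \<in> extensional (coset B ` U)" by (simp add: functional_def)
  note fc = functional_coset[where U = U and E = E, OF B _ y]
  show "functional E U B y (C \<oplus>\<^bsub>quot_mod (fn_mod U) B\<^esub> D) = functional E U B y C + functional E U B y D"
    if "C \<in> coset B ` U" "D \<in> coset B ` U" for C D
    using that fs.subspace_add[OF U] by (auto simp: add_quot_mod[OF B] fc pairing_add)
  show "functional E U B y (c \<odot>\<^bsub>quot_mod (fn_mod U) B\<^esub> C) = c * functional E U B y C"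
    if "C \<in> coset B ` U" for c C
    using that fs.subspace_scale[OF U] by (auto simp: smult_quot_mod[OF B] fc pairing_scale)
qed

text \<open>Pulled back to \<open>U\<close>, the functional is the pairing with some
  \<open>y\<close>; as it factors through the quotient, \<open>y\<close> annihilates
  \<open>B\<close>.\<close>

lemma ex_functional:
  assumes U: "fs.subspace U" "U \<subseteq> supported E" "finite E" and B: "fs.subspace B" "B \<subseteq> U"
    and \<phi>: "\<phi> \<in> carrier (dual_mod (quot_mod (fn_mod U) B))"
  obtains y where "y \<in> annihilator E B" "\<phi> = functional E U B y"
proof -
  note d = \<phi>[unfolded carrier_dual_mod carrier_quot_mod]
  have add: "\<phi> (coset B (x + y)) = \<phi> (coset B x) + \<phi> (coset B y)" if "x \<in> U" "y \<in> U" for x y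
    using d that by (metis add_quot_mod[OF B(1)] imageI)
  have scale: "\<phi> (coset B (fscale c x)) = c * \<phi> (coset B x)" if "x \<in> U" for c x
    using d that by (metis smult_quot_mod[OF B(1)] imageI)
  obtain y where y: "y \<in> supported E" "\<And>u. u \<in> U \<Longrightarrow> \<phi> (coset B u) = (\<Sum>s\<in>E. y s * u s)"
    using functional_representation[OF U, of "\<lambda>u. \<phi> (coset B u)"] add scale by blast
  have van: "\<phi> (coset B b) = 0" if "b \<in> B" for b
  proof -
    have "coset B b = coset B 0" using that by (intro coset_eqI B) simp
    moreover have "\<phi> (coset B (fscale 0 0)) = 0" using scale[OF fs.subspace_0[OF U(1)], of 0] by simp
    ultimately show ?thesis by simp
  qed
  have "pairing E y b = 0" if "b \<in> B" for b
    using van[OF that] y(2)[of b] B(2) that by (auto simp: pairing_def)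
  with y(1) have ann: "y \<in> annihilator E B"
    by (simp add: annihilator_def)
  have "\<phi> = functional E U B y"
  proof (rule extensionalityI)
    show "\<phi> \<in> extensional (coset B ` U)" using d by blast
    show "functional E U B y \<in> extensional (coset B ` U)" by (simp add: functional_def)
    show "\<phi> C = functional E U B y C" if "C \<in> coset B ` U" for C
      using that y(2) ann
      by (auto simp: functional_coset[OF B(1)] annihilator_def pairing_def)
  qed
  with ann that show thesis by blast
qed

text \<open>Pairing maps the annihilator of \<open>B\<close> onto the dual, and those
  \<open>y\<close> that vanish on all of \<open>U\<close> go to zero. A surjection is enough to
  transport the axioms and finite dimension.\<close>

lemma dual_quot_mod_vectorspace:
  assumes U: "fs.subspace U" "U \<subseteq> supported E" "finite E" and B: "fs.subspace B" "B \<subseteq> U"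
  shows "vectorspace class_ring (dual_mod (quot_mod (fn_mod U) B))"
    and "vectorspace.fin_dim class_ring (dual_mod (quot_mod (fn_mod U) B))"
proof -
  let ?N = "annihilator E B" and ?D = "dual_mod (quot_mod (fn_mod U) B)"
  have N: "fs.subspace ?N" "?N \<subseteq> supported E"
    using annihilator_subspace by (auto simp: annihilator_def)
  note 1 = fn_mod_vectorspace[OF N U(3)]
  have surj: "functional E U B ` carrier (fn_mod ?N) = carrier ?D"
    using functional_in_dual[OF U(1) B(1), of E] ex_functional[OF U B] by (force simp: annihilator_def)
  note 2 = linear_image_vectorspace[OF 1(1) surj]
  have *: "vectorspace class_ring ?D" "linear_map class_ring (fn_mod ?N) ?D (functional E U B)"
    by (rule 2; simp add: dual_mod_simps carrier_quot_mod functional_def pairing_add pairing_scale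
        fun_eq_iff restrict_def)+
  show "vectorspace class_ring ?D" by (fact *)
  show "vectorspace.fin_dim class_ring ?D"
    by (rule linear_image_fin_dim[OF *(2) surj 1(2)])
qed

text \<open>All spaces lie in one function space, so structure maps are induced by the identity and
  functoriality is seen on representatives. Homology uses this with cycles and boundaries at
  \<open>z\<close>, cohomology with cocycles and coboundaries of the cells above
  \<open>- z\<close>.\<close>

lemma persistence_module_quot:
  fixes M :: "('k::field, ('s \<Rightarrow> 'k) set, 'n::finite) pmod"
  assumes obj: "\<And>z. obj M z = quot_mod (fn_mod (U z)) (B z)"
    and arr: "\<And>z w. z \<le> w \<Longrightarrow> arr M z w = quot_map (fn_mod (U w)) (B w) (\<lambda>x. x)"
    and U: "\<And>z. fs.subspace (U z)" "\<And>z. U z \<subseteq> supported E" "finite E"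
    and B: "\<And>z. fs.subspace (B z)"
    and mono: "\<And>z w. z \<le> w \<Longrightarrow> U z \<subseteq> U w" "\<And>z w. z \<le> w \<Longrightarrow> B z \<subseteq> B w"
  shows "persistence_module M"
    and "\<And>z w x. z \<le> w \<Longrightarrow> arr M z w (coset (B z) x) = coset (B w) x"
proof -
  show a: "arr M z w (coset (B z) x) = coset (B w) x" if "z \<le> w" for z w x
    unfolding arr[OF that] by (rule quot_map_coset[OF B B]) (use mono(2)[OF that] in auto)
  show "persistence_module M"
    unfolding persistence_module_def
  proof (intro conjI allI impI ballI)
    fix z
    show v: "vectorspace class_ring (obj M z)" "vectorspace.fin_dim class_ring (obj M z)" for z
      using quot_mod_vectorspace[OF U(1,2,3) B] by (simp_all add: obj)
    show "arr M z z C = C" if "C \<in> carrier (obj M z)" for C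
      using that a[of z z] by (auto simp: obj carrier_quot_mod)
    fix w assume "z \<le> w"
    note a = a[OF this] and m = mono[OF this]
    show "linear_map class_ring (obj M z) (obj M w) (arr M z w)"
    proof (rule linear_mapI[OF v(1) v(1)])
      show "arr M z w C \<in> carrier (obj M w)" if "C \<in> carrier (obj M z)" for C
        using that m by (auto simp: obj carrier_quot_mod a)
      show "arr M z w (C \<oplus>\<^bsub>obj M z\<^esub> D) = arr M z w C \<oplus>\<^bsub>obj M w\<^esub> arr M z w D"
        if "C \<in> carrier (obj M z)" "D \<in> carrier (obj M z)" for C D
        using that by (auto simp: obj carrier_quot_mod a add_quot_mod[OF B])
      show "arr M z w (c \<odot>\<^bsub>obj M z\<^esub> C) = c \<odot>\<^bsub>obj M w\<^esub> arr M z w C"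
        if "C \<in> carrier (obj M z)" for c C
        using that by (auto simp: obj carrier_quot_mod a smult_quot_mod[OF B])
    qed
  next
    fix u v w C assume "u \<le> v" "v \<le> w" "C \<in> carrier (obj M u)"
    then show "arr M v w (arr M u v C) = arr M u w C"
      using a[of u v] a[of v w] a[of u w] by (auto simp: obj carrier_quot_mod)
  qed
qed

lemma minus_vec_le: "- w \<le> - z" if "z \<le> w" for z w :: "int^'n"
  using that by (simp add: Finite_Cartesian_Product.less_eq_vec_def)

lemma persistence_module_dual:
  fixes M :: "('k::field, 'a, 'n::finite) pmod"
  assumes M: "persistence_module M"
    and D: "\<And>z. vectorspace class_ring (dual_mod (obj M z))"
      "\<And>z. vectorspace.fin_dim class_ring (dual_mod (obj M z))"
  shows "persistence_module (dual_pmod M)"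
proof -
  have lin: "linear_map class_ring (obj M z) (obj M w) (arr M z w)" if "z \<le> w" for z w
    using M that by (auto simp: persistence_module_def)
  have hom: "arr M z w \<in> LinearCombinations.module_hom class_ring (obj M z) (obj M w)" if "z \<le> w" for z w
    using lin[OF that] by (simp add: linear_map_def mod_hom_def mod_hom_axioms_def)
  have c: "arr M z w x \<in> carrier (obj M w)" if "z \<le> w" "x \<in> carrier (obj M z)" for z w x
    using hom[OF that(1)] that(2) by (auto simp: LinearCombinations.module_hom_def)
  have ops: "x \<oplus>\<^bsub>obj M z\<^esub> y \<in> carrier (obj M z)" "k \<odot>\<^bsub>obj M z\<^esub> x \<in> carrier (obj M z)"
    if "x \<in> carrier (obj M z)" "y \<in> carrier (obj M z)" for z x y k
  proof -
    interpret vectorspace class_ring "obj M z" using M by (simp add: persistence_module_def)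
    show "x \<oplus>\<^bsub>obj M z\<^esub> y \<in> carrier (obj M z)" "k \<odot>\<^bsub>obj M z\<^esub> x \<in> carrier (obj M z)"
      using that by auto
  qed
  have ext: "\<phi> \<in> extensional (carrier (obj M z))" if "\<phi> \<in> carrier (dual_mod (obj M z))" for \<phi> z
    using that by (simp add: carrier_dual_mod)
  show ?thesis
    unfolding persistence_module_def dual_pmod_def pmod.simps
  proof (intro conjI allI impI ballI)
    fix z show "vectorspace class_ring (dual_mod (obj M (- z)))"
      "vectorspace.fin_dim class_ring (dual_mod (obj M (- z)))" by (rule D)+
    show "restrict (\<phi> \<circ> arr M (- z) (- z)) (carrier (obj M (- z))) = \<phi>"
      if "\<phi> \<in> carrier (dual_mod (obj M (- z)))" for \<phi>
      using ext[OF that] M by (intro extensionalityI[of _ "carrier (obj M (- z))"]) (auto simp: persistence_module_def)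
    fix w assume "z \<le> w"
    note n = minus_vec_le[OF this]
    show "linear_map class_ring (dual_mod (obj M (- z))) (dual_mod (obj M (- w)))
        (\<lambda>\<phi>. restrict (\<phi> \<circ> arr M (- w) (- z)) (carrier (obj M (- w))))"
    proof (rule linear_mapI[OF D(1) D(1)])
      fix \<phi> assume \<phi>: "\<phi> \<in> carrier (dual_mod (obj M (- z)))"
      show "restrict (\<phi> \<circ> arr M (- w) (- z)) (carrier (obj M (- w))) \<in> carrier (dual_mod (obj M (- w)))"
        using \<phi> hom[OF n] c[OF n] ops by (auto simp: carrier_dual_mod LinearCombinations.module_hom_def)
      show "restrict ((k \<odot>\<^bsub>dual_mod (obj M (- z))\<^esub> \<phi>) \<circ> arr M (- w) (- z)) (carrier (obj M (- w))) =
          k \<odot>\<^bsub>dual_mod (obj M (- w))\<^esub> restrict (\<phi> \<circ> arr M (- w) (- z)) (carrier (obj M (- w)))" for k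
        using c[OF n] by (auto simp: dual_mod_simps)
      fix \<psi> assume \<psi>: "\<psi> \<in> carrier (dual_mod (obj M (- z)))"
      show "restrict ((\<phi> \<oplus>\<^bsub>dual_mod (obj M (- z))\<^esub> \<psi>) \<circ> arr M (- w) (- z)) (carrier (obj M (- w))) =
          restrict (\<phi> \<circ> arr M (- w) (- z)) (carrier (obj M (- w))) \<oplus>\<^bsub>dual_mod (obj M (- w))\<^esub>
          restrict (\<psi> \<circ> arr M (- w) (- z)) (carrier (obj M (- w)))"
        using c[OF n] by (auto simp: dual_mod_simps)
    qed
  next
    fix u v w :: "int^'n" and \<phi> assume uvw: "u \<le> v" "v \<le> w" and "\<phi> \<in> carrier (dual_mod (obj M (- u)))"
    have "arr M (- v) (- u) (arr M (- w) (- v) x) = arr M (- w) (- u) x" if "x \<in> carrier (obj M (- w))" for x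
      using M minus_vec_le[OF uvw(1)] minus_vec_le[OF uvw(2)] that by (auto simp: persistence_module_def)
    then show "restrict (restrict (\<phi> \<circ> arr M (- v) (- u)) (carrier (obj M (- v))) \<circ> arr M (- w) (- v)) (carrier (obj M (- w))) =
        restrict (\<phi> \<circ> arr M (- w) (- u)) (carrier (obj M (- w)))"
      using c[OF minus_vec_le[OF uvw(2)]] by (auto simp: restrict_def fun_eq_iff)
  qed
qed

section \<open>Signs of oriented simplices\<close>

definition alternating :: "('v list \<Rightarrow> int) \<Rightarrow> bool" where
  "alternating u \<longleftrightarrow> (\<forall>as a b cs. u (as @ a # b # cs) = - u (as @ b # a # cs))"

text \<open>The alternating sum over deletions of one entry, expanded along the head; in this form
  the vanishing of its square is a short induction.\<close>

fun list_bd :: "('v list \<Rightarrow> int) \<Rightarrow> 'v list \<Rightarrow> int" where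
  "list_bd u [] = 0"
| "list_bd u (x # xs) = u xs - list_bd (\<lambda>ys. u (x # ys)) xs"

lemma list_bd_eq_sum: "list_bd u xs = (\<Sum>i<length xs. (- 1) ^ i * u (del_nth i xs))"
proof (induction xs arbitrary: u)
  case (Cons x xs)
  then show ?case
    by (simp add: sum.lessThan_Suc_shift del_nth_def sum_negf del: sum.lessThan_Suc)
qed simp

lemma list_bd_diff: "list_bd (\<lambda>ys. u ys - v ys) xs = list_bd u xs - list_bd v xs"
  by (induction xs arbitrary: u v) simp_all

text \<open>For \<open>x # xs\<close>, the two terms \<open>list_bd u xs\<close> in which the head
  is deleted first or second cancel. What remains is the claim for
  \<open>\<lambda>ys. u (x # ys)\<close> and \<open>xs\<close>.\<close>

lemma list_bd_list_bd: "list_bd (list_bd u) xs = 0"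
proof (induction xs arbitrary: u)
  case (Cons x xs)
  then show ?case by (simp add: list_bd_diff)
qed simp

lemma alternating_Cons: "alternating u \<Longrightarrow> alternating (\<lambda>ys. u (x # ys))"
  unfolding alternating_def by (metis append_Cons)

text \<open>Under an exchange of two adjacent entries, the terms that delete one of the two trade
  places with opposite signs, and in the other terms the exchange takes place inside the argument of
  \<open>u\<close>.\<close>

lemma alternating_list_bd:
  assumes "alternating u"
  shows "alternating (list_bd u)"
  unfolding alternating_def
proof (intro allI)
  fix as cs and a b :: 'a
  show "list_bd u (as @ a # b # cs) = - list_bd u (as @ b # a # cs)"
    using assms
  proof (induction as arbitrary: u)
    case Nil
    have "(\<lambda>ys. u (a # b # ys)) = (\<lambda>ys. 0 - u (b # a # ys))"
      using Nil unfolding alternating_def by (metis append_Nil diff_0)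
    moreover have "list_bd (\<lambda>ys. 0) cs = 0" for cs :: "'a list"
      by (induction cs) simp_all
    ultimately show ?case
      using list_bd_diff[of "\<lambda>_. 0" "\<lambda>ys. u (b # a # ys)" cs] by simp
  next
    case (Cons x as)
    have "u (as @ a # b # cs) = - u (as @ b # a # cs)"
      using Cons.prems unfolding alternating_def by blast
    with Cons.IH[OF alternating_Cons[OF Cons.prems]] show ?case
      by simp
  qed
qed

text \<open>Rearrangement generated by adjacent exchanges, to match the definition of
  \<open>alternating\<close>.\<close>

inductive swaps :: "'v list \<Rightarrow> 'v list \<Rightarrow> bool" where
  refl: "swaps xs xs"
| swap: "swaps xs (as @ a # b # cs) \<Longrightarrow> swaps xs (as @ b # a # cs)"

lemma swaps_trans: "swaps ys zs \<Longrightarrow> swaps xs ys \<Longrightarrow> swaps xs zs"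
  by (induction rule: swaps.induct) (auto intro: swaps.intros)

lemma swaps_append: "swaps xs ys \<Longrightarrow> swaps (as @ xs) (as @ ys)"
proof (induction rule: swaps.induct)
  case (swap xs bs a b cs)
  then show ?case using swaps.swap[of "as @ xs" "as @ bs" a b cs] by simp
qed (rule swaps.refl)

lemma swaps_to_front: "swaps (as @ a # bs) (a # as @ bs)"
proof (induction as)
  case (Cons x as)
  then have "swaps ((x # as) @ a # bs) ([x] @ a # as @ bs)"
    using swaps_append[of _ _ "[x]"] by fastforce
  then show ?case
    using swaps.swap[of _ "[]" x a "as @ bs"] by simp
qed (simp add: swaps.refl)

lemma swaps_if_mset_eq: "mset xs = mset ys \<Longrightarrow> swaps xs ys"
proof (induction ys arbitrary: xs)
  case (Cons y ys)
  then have "y \<in> set xs" by (metis list.set_intros(1) mset_eq_setD)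
  then obtain as bs where xs: "xs = as @ y # bs" by (auto dest: split_list)
  with Cons have "swaps (as @ bs) ys" by simp
  from swaps_append[OF this, of "[y]"] swaps_to_front[of as y bs] show ?case
    by (auto simp: xs intro: swaps_trans)
qed (simp add: swaps.refl)

text \<open>Every exchange changes the sign of both functions, so the factor \<open>c\<close>
  persists.\<close>

lemma alternating_swaps:
  assumes "alternating u" "alternating v" "swaps xs ys" "u xs = v xs * c"
  shows "u ys = v ys * c"
  using assms(3,4)
proof (induction rule: swaps.induct)
  case (swap xs as a b cs)
  have "u (as @ b # a # cs) = - u (as @ a # b # cs)" "v (as @ b # a # cs) = - v (as @ a # b # cs)"
    using assms(1,2) unfolding alternating_def by blast+
  with swap show ?case by simp
qed

text \<open>Two equal entries are brought next to each other; exchanging them shows that an integer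
  equals its negative. Vanishing then travels back along \<open>swaps\<close> with factor
  \<open>0\<close>.\<close>

lemma alternating_eq_0:
  assumes "alternating u" "\<not> distinct xs"
  shows "u xs = 0"
proof -
  obtain as bs cs y where xs: "xs = as @ [y] @ bs @ [y] @ cs"
    using assms(2) not_distinct_decomp by blast
  have "swaps (as @ y # y # bs @ cs) xs"
    by (rule swaps_if_mset_eq) (simp add: xs)
  moreover have "u (as @ y # y # bs @ cs) = - u (as @ y # y # bs @ cs)"
    using assms(1) unfolding alternating_def by blast
  ultimately show ?thesis
    using alternating_swaps[OF assms(1,1), of _ xs 0] by simp
qed

section \<open>Relative signs of orderings\<close>

lemma rel_sign_unique:
  assumes "distinct xs" "p permutes set xs" "map p xs = ys"
  shows "rel_sign xs ys = sign p"
proof -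
  have "(THE q. q permutes set xs \<and> map q xs = ys) = p"
    using assms by (intro the_equality) (auto simp: permutes_def fun_eq_iff, metis)
  then show ?thesis by (simp add: rel_sign_def)
qed

lemma rel_sign_self: "distinct xs \<Longrightarrow> rel_sign xs xs = 1"
  using rel_sign_unique[of xs id xs] by (simp add: permutes_id)

lemma ex_permutes_map:
  assumes "distinct xs" "distinct ys" "set xs = set ys"
  obtains p where "p permutes set xs" "map p xs = ys"
proof -
  have len: "length xs = length ys"
    using assms by (metis distinct_card)
  define p where "p x = (if x \<in> set xs then ys ! (THE i. i < length xs \<and> xs ! i = x) else x)" for x
  have nth: "p (xs ! i) = ys ! i" if "i < length xs" for i
  proof -
    have "(THE j. j < length xs \<and> xs ! j = xs ! i) = i"
      using that assms(1) by (auto simp: nth_eq_iff_index_eq)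
    then show ?thesis using that by (simp add: p_def)
  qed
  then have map: "map p xs = ys"
    using len by (intro nth_equalityI) auto
  have "bij_betw p (set xs) (set xs)"
    using map assms by (metis bij_betw_def distinct_map set_map)
  then have "p permutes set xs"
    by (rule bij_imp_permutes) (simp add: p_def)
  with map that show thesis by blast
qed

text \<open>A permutation taking the first list to \<open>ys\<close>, composed with the
  transposition of \<open>a\<close> and \<open>b\<close>, takes the second list to
  \<open>ys\<close>.\<close>

lemma rel_sign_swap:
  assumes "distinct (as @ a # b # cs)" "distinct ys" "set ys = set (as @ a # b # cs)"
  shows "rel_sign (as @ a # b # cs) ys = - rel_sign (as @ b # a # cs) ys"
proof -
  obtain p where p: "p permutes set (as @ a # b # cs)" "map p (as @ a # b # cs) = ys"
    using ex_permutes_map[of "as @ a # b # cs" ys] assms by metis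
  let ?t = "Transposition.transpose a b"
  have "map (p \<circ> ?t) (as @ b # a # cs) = ys"
    using p(2) assms(1) by (auto simp: Transposition.transpose_def)
  moreover have "?t permutes set (as @ a # b # cs)"
    by (rule permutes_swap_id) auto
  then have "(p \<circ> ?t) permutes set (as @ b # a # cs)"
    using permutes_compose[OF _ p(1)] by (simp add: insert_commute)
  ultimately have "rel_sign (as @ b # a # cs) ys = sign (p \<circ> ?t)"
    using assms(1) by (intro rel_sign_unique) auto
  also have "\<dots> = sign p * sign ?t"
    using p(1) by (intro sign_compose permutation_swap_id) (use permutation_permutes in blast)
  also have "sign ?t = -1"
    using assms(1) by (simp add: sign_swap_id)
  finally show ?thesis
    using rel_sign_unique[OF assms(1) p] by simp
qed

text \<open>Incidence numbers and coefficients of induced chain maps are expressed through these alternating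
  functions, so that their sign identities reduce to identities for \<^const>\<open>list_bd\<close>.\<close>

definition coord :: "('v set \<Rightarrow> 'v list) \<Rightarrow> 'v set \<Rightarrow> 'v list \<Rightarrow> int" where
  "coord ori \<tau> xs = (if distinct xs \<and> set xs = \<tau> then rel_sign xs (ori \<tau>) else 0)"

lemma alternating_coord:
  assumes "distinct (ori \<tau>)" "set (ori \<tau>) = \<tau>"
  shows "alternating (coord ori \<tau>)"
  unfolding alternating_def
proof (intro allI)
  fix as a b cs
  show "coord ori \<tau> (as @ a # b # cs) = - coord ori \<tau> (as @ b # a # cs)"
    using assms rel_sign_swap[of as a b cs "ori \<tau>"] by (auto simp: coord_def insert_commute)
qed

lemma coord_ori: "distinct (ori \<sigma>) \<Longrightarrow> set (ori \<sigma>) = \<sigma> \<Longrightarrow> coord ori \<sigma> (ori \<sigma>) = 1"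
  by (simp add: coord_def rel_sign_self)

lemma alternating_eq_coord_mult:
  assumes "alternating u" "distinct xs" "distinct (ori \<sigma>)" "set (ori \<sigma>) = \<sigma>" "set xs = \<sigma>"
  shows "u xs = coord ori \<sigma> xs * u (ori \<sigma>)"
proof -
  have "swaps (ori \<sigma>) xs"
    using assms by (intro swaps_if_mset_eq) (metis set_eq_iff_mset_eq_distinct)
  from alternating_swaps[OF assms(1) alternating_coord[of ori \<sigma>, OF assms(3,4)] this] show ?thesis
    by (simp add: coord_ori assms)
qed

lemma del_nth_split:
  assumes "i < length xs"
  obtains as bs where "xs = as @ xs ! i # bs" "del_nth i xs = as @ bs"
  using that[of "take i xs" "drop (Suc i) xs"] id_take_nth_drop[OF assms] by (simp add: del_nth_def)

lemma set_del_nth: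
  assumes "distinct xs" "i < length xs"
  shows "set (del_nth i xs) = set xs - {xs ! i}"
proof -
  obtain as bs where *: "xs = as @ xs ! i # bs" "del_nth i xs = as @ bs"
    using del_nth_split[OF assms(2)] .
  obtain x where x: "x = xs ! i" by simp
  have "xs = as @ x # bs" using *(1) x by simp
  with assms(1) have "set (as @ bs) = set xs - {x}" by auto
  with *(2) x show ?thesis by simp
qed

lemma distinct_del_nth: "distinct xs \<Longrightarrow> i < length xs \<Longrightarrow> distinct (del_nth i xs)"
  by (rule del_nth_split[of i xs], assumption)
    (metis distinct_append distinct.simps(2) list.set_intros(2) disjoint_iff)

lemma incidence_eq_list_bd:
  assumes "distinct (ori \<sigma>)"
  shows "incidence ori \<sigma> \<tau> = list_bd (coord ori \<tau>) (ori \<sigma>)"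
  unfolding incidence_def list_bd_eq_sum
  by (intro sum.cong) (auto simp: coord_def distinct_del_nth assms)

lemma map_coeff_eq_coord:
  assumes "distinct (ori \<sigma>)" "set (ori \<sigma>) = \<sigma>"
  shows "map_coeff ori ori' f \<sigma> \<tau> = coord ori' \<tau> (map f (ori \<sigma>))"
  using assms by (auto simp: map_coeff_def coord_def distinct_map)

lemma incidence_nonzero:
  assumes "incidence ori \<sigma> \<tau> \<noteq> 0" "distinct (ori \<sigma>)" "set (ori \<sigma>) = \<sigma>"
  shows "\<tau> \<subseteq> \<sigma>" "card \<sigma> = Suc (card \<tau>)"
proof -
  have "\<exists>i<length (ori \<sigma>). set (del_nth i (ori \<sigma>)) = \<tau>"
  proof (rule ccontr)
    assume "\<not> ?thesis"
    then have "incidence ori \<sigma> \<tau> = 0"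
      unfolding incidence_def by (intro sum.neutral) simp
    with assms(1) show False by simp
  qed
  then obtain i where i: "i < length (ori \<sigma>)" "set (del_nth i (ori \<sigma>)) = \<tau>" by blast
  with set_del_nth[OF assms(2) i(1)] assms(3) have \<tau>: "\<tau> = \<sigma> - {ori \<sigma> ! i}" by simp
  then show "\<tau> \<subseteq> \<sigma>" by auto
  have "finite \<sigma>" by (metis assms(3) List.finite_set)
  moreover have "ori \<sigma> ! i \<in> \<sigma>" by (metis assms(3) i(1) nth_mem)
  ultimately show "card \<sigma> = Suc (card \<tau>)"
    unfolding \<tau> by (rule card_Suc_Diff1[symmetric])
qed

section \<open>Boundary and chain map identities for oriented simplices\<close>

context
  fixes X :: "'v set set" and ori :: "'v set \<Rightarrow> 'v list"
  assumes fin: "finite X" and down: "\<And>\<sigma> \<tau>. \<sigma> \<in> X \<Longrightarrow> \<tau> \<subseteq> \<sigma> \<Longrightarrow> \<tau> \<in> X"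
    and ori: "\<And>\<sigma>. \<sigma> \<in> X \<Longrightarrow> distinct (ori \<sigma>) \<and> set (ori \<sigma>) = \<sigma>"
begin

text \<open>Only \<open>\<tau> = set xs\<close> contributes, with the sign that compares
  \<open>xs\<close> to the chosen ordering. Thus an alternating function is known from the chosen
  orderings; for a list with repetitions both sides vanish.\<close>

lemma sum_coord:
  assumes u: "alternating u" and xs: "distinct xs \<Longrightarrow> set xs \<in> X"
  shows "(\<Sum>\<tau>\<in>X. coord ori \<tau> xs * u (ori \<tau>)) = u xs"
proof (cases "distinct xs")
  case True
  have "(\<Sum>\<tau>\<in>X. coord ori \<tau> xs * u (ori \<tau>)) = (\<Sum>\<tau>\<in>{set xs}. coord ori \<tau> xs * u (ori \<tau>))"
    using fin xs[OF True] by (intro sum.mono_neutral_right) (auto simp: coord_def)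
  also have "\<dots> = u xs"
    using alternating_eq_coord_mult[of u xs ori "set xs"] True u ori[OF xs[OF True]] by simp
  finally show ?thesis .
next
  case False
  with alternating_eq_0[OF u False] show ?thesis by (simp add: coord_def)
qed

text \<open>Alternating functions play the role of cochains and \<open>list_bd u\<close> that of the
  coboundary of \<open>u\<close>. Once a sum over simplices has this form, the chosen orderings of
  the faces drop out.\<close>

lemma sum_incidence:
  assumes \<sigma>: "\<sigma> \<in> X" and u: "alternating u"
  shows "(\<Sum>\<tau>\<in>X. incidence ori \<sigma> \<tau> * u (ori \<tau>)) = list_bd u (ori \<sigma>)"
proof -
  have *: "(\<Sum>\<tau>\<in>X. coord ori \<tau> (del_nth i (ori \<sigma>)) * u (ori \<tau>)) = u (del_nth i (ori \<sigma>))"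
    if "i < length (ori \<sigma>)" for i
    using set_del_nth[of "ori \<sigma>" i] that ori[OF \<sigma>] down[OF \<sigma>] by (intro sum_coord u) auto
  have "(\<Sum>\<tau>\<in>X. incidence ori \<sigma> \<tau> * u (ori \<tau>)) =
      (\<Sum>\<tau>\<in>X. \<Sum>i<length (ori \<sigma>). (- 1) ^ i * (coord ori \<tau> (del_nth i (ori \<sigma>)) * u (ori \<tau>)))"
    using ori[OF \<sigma>] by (simp add: incidence_eq_list_bd list_bd_eq_sum sum_distrib_right mult.assoc)
  also have "\<dots> = (\<Sum>i<length (ori \<sigma>). (- 1) ^ i * (\<Sum>\<tau>\<in>X. coord ori \<tau> (del_nth i (ori \<sigma>)) * u (ori \<tau>)))"
    by (subst sum.swap) (simp add: sum_distrib_left)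
  also have "\<dots> = list_bd u (ori \<sigma>)"
    by (simp add: * list_bd_eq_sum)
  finally show ?thesis .
qed

lemma incidence_incidence:
  assumes "\<sigma> \<in> X" "\<rho> \<in> X"
  shows "(\<Sum>\<tau>\<in>X. incidence ori \<sigma> \<tau> * incidence ori \<tau> \<rho>) = 0"
proof -
  have "(\<Sum>\<tau>\<in>X. incidence ori \<sigma> \<tau> * incidence ori \<tau> \<rho>) =
      (\<Sum>\<tau>\<in>X. incidence ori \<sigma> \<tau> * list_bd (coord ori \<rho>) (ori \<tau>))"
    using ori by (simp add: incidence_eq_list_bd)
  also have "\<dots> = 0"
    using sum_incidence[OF assms(1) alternating_list_bd[OF alternating_coord[of ori \<rho>]]] ori[OF assms(2)]
    by (simp add: list_bd_list_bd)
  finally show ?thesis .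
qed

end

lemma alternating_map:
  assumes "alternating u"
  shows "alternating (\<lambda>xs. u (map f xs))"
  unfolding alternating_def
proof (intro allI)
  fix as cs and a b
  have "u (map f as @ f a # f b # map f cs) = - u (map f as @ f b # f a # map f cs)"
    using assms unfolding alternating_def by blast
  then show "u (map f (as @ a # b # cs)) = - u (map f (as @ b # a # cs))" by simp
qed

lemma del_nth_map: "del_nth i (map f xs) = map f (del_nth i xs)"
  by (simp add: del_nth_def take_map drop_map)

text \<open>Both sides equal \<open>list_bd (coord ori' \<rho>)\<close> at
  \<open>map f (ori \<sigma>)\<close>. Simplices on which \<open>f\<close> is not injective are
  covered by the same computation, since alternating functions vanish on lists with
  repetitions.\<close>

lemma map_coeff_chain_map:
  fixes X :: "'v set set" and Y :: "'w set set"
  assumes X: "finite X" "\<And>\<sigma> \<tau>. \<sigma> \<in> X \<Longrightarrow> \<tau> \<subseteq> \<sigma> \<Longrightarrow> \<tau> \<in> X"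
      "\<And>\<sigma>. \<sigma> \<in> X \<Longrightarrow> distinct (ori \<sigma>) \<and> set (ori \<sigma>) = \<sigma>"
    and Y: "finite Y" "\<And>\<sigma> \<tau>. \<sigma> \<in> Y \<Longrightarrow> \<tau> \<subseteq> \<sigma> \<Longrightarrow> \<tau> \<in> Y"
      "\<And>\<sigma>. \<sigma> \<in> Y \<Longrightarrow> distinct (ori' \<sigma>) \<and> set (ori' \<sigma>) = \<sigma>"
    and f: "\<And>\<sigma>. \<sigma> \<in> X \<Longrightarrow> f ` \<sigma> \<in> Y"
    and \<sigma>: "\<sigma> \<in> X" and \<rho>: "\<rho> \<in> Y"
  shows "(\<Sum>\<tau>\<in>X. incidence ori \<sigma> \<tau> * map_coeff ori ori' f \<tau> \<rho>) =
    (\<Sum>\<tau>\<in>Y. map_coeff ori ori' f \<sigma> \<tau> * incidence ori' \<tau> \<rho>)"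
proof -
  have alt: "alternating (coord ori' \<rho>)"
    using alternating_coord Y(3)[OF \<rho>] by blast
  have "(\<Sum>\<tau>\<in>X. incidence ori \<sigma> \<tau> * map_coeff ori ori' f \<tau> \<rho>) =
      (\<Sum>\<tau>\<in>X. incidence ori \<sigma> \<tau> * coord ori' \<rho> (map f (ori \<tau>)))"
    using X(3) by (simp add: map_coeff_eq_coord)
  also have "\<dots> = list_bd (\<lambda>xs. coord ori' \<rho> (map f xs)) (ori \<sigma>)"
    by (rule sum_incidence[OF X \<sigma> alternating_map[OF alt]])
  also have "\<dots> = list_bd (coord ori' \<rho>) (map f (ori \<sigma>))"
    by (simp add: list_bd_eq_sum del_nth_map)
  also have "\<dots> = (\<Sum>\<tau>\<in>Y. coord ori' \<tau> (map f (ori \<sigma>)) * list_bd (coord ori' \<rho>) (ori' \<tau>))"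
    using X(3)[OF \<sigma>] f[OF \<sigma>]
    by (intro sum_coord[OF Y alternating_list_bd[OF alt], symmetric]) simp_all
  also have "\<dots> = (\<Sum>\<tau>\<in>Y. map_coeff ori ori' f \<sigma> \<tau> * incidence ori' \<tau> \<rho>)"
    using X(3)[OF \<sigma>] Y(3) by (intro sum.cong) (simp_all add: map_coeff_eq_coord incidence_eq_list_bd)
  finally show ?thesis .
qed

section \<open>Graded complexes and connecting homomorphisms\<close>

locale graded_complex =
  fixes X :: "'s set" and g :: "'s \<Rightarrow> int^'n::finite" and dm :: "'s \<Rightarrow> int"
    and A :: "'s \<Rightarrow> 's \<Rightarrow> 'k::field"
  assumes fin: "finite X"
    and A_grade: "\<sigma> \<in> X \<Longrightarrow> \<tau> \<in> X \<Longrightarrow> A \<sigma> \<tau> \<noteq> 0 \<Longrightarrow> g \<tau> \<le> g \<sigma>"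
    and A_dim: "\<sigma> \<in> X \<Longrightarrow> \<tau> \<in> X \<Longrightarrow> A \<sigma> \<tau> \<noteq> 0 \<Longrightarrow> dm \<sigma> = dm \<tau> + 1"
    and A_A: "\<sigma> \<in> X \<Longrightarrow> \<rho> \<in> X \<Longrightarrow> (\<Sum>\<tau>\<in>X. A \<sigma> \<tau> * A \<tau> \<rho>) = 0"
begin

section \<open>Truncated chain complexes\<close>

definition Ch :: "'s set \<Rightarrow> int \<Rightarrow> ('s \<Rightarrow> 'k) set" where
  "Ch S d = supported {\<sigma>\<in>S. dm \<sigma> = d}"

definition bd :: "'s set \<Rightarrow> ('s \<Rightarrow> 'k) \<Rightarrow> 's \<Rightarrow> 'k" where
  "bd S x = rest S (mat_app X A x)"

definition Cyc :: "'s set \<Rightarrow> int \<Rightarrow> ('s \<Rightarrow> 'k) set" where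
  "Cyc S d = {x \<in> Ch S d. bd S x = 0}"

definition Bnd :: "'s set \<Rightarrow> int \<Rightarrow> ('s \<Rightarrow> 'k) set" where
  "Bnd S d = bd S ` Ch S (d + 1)"

definition exact :: "'s set \<Rightarrow> bool" where
  "exact S \<longleftrightarrow> (\<forall>d. Cyc S d \<subseteq> Bnd S d)"

lemma exactE:
  assumes "exact S" "x \<in> Cyc S d"
  obtains u where "u \<in> Ch S (d + 1)" "bd S u = x"
proof -
  have "x \<in> Bnd S d" using assms by (auto simp: exact_def)
  with that show thesis by (auto simp: Bnd_def)
qed

text \<open>Replacing \<open>z\<close> by \<open>\<infinity>\<close> in the coordinates in \<open>I\<close>, these cells carry the subquotient complex
  obtained after the coordinates in \<open>J\<close> have been processed.\<close>

definition cells :: "'n set \<Rightarrow> 'n set \<Rightarrow> int^'n \<Rightarrow> 's set" where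
  "cells J I z =
    {\<sigma>\<in>X. (\<forall>j\<in>J. z $ j < g \<sigma> $ j) \<and> (\<forall>j. j \<notin> J \<longrightarrow> j \<notin> I \<longrightarrow> g \<sigma> $ j \<le> z $ j)}"

text \<open>Convexity with respect to grades. Two consecutive nonzero boundary coefficients leading
  from one member to another pass through a grade between theirs, which is why the truncated
  boundary still squares to zero.\<close>

definition loc_closed :: "'s set \<Rightarrow> bool" where
  "loc_closed S \<longleftrightarrow> S \<subseteq> X \<and>
    (\<forall>\<sigma>\<in>S. \<forall>\<rho>\<in>S. \<forall>\<tau>\<in>X. g \<rho> \<le> g \<tau> \<longrightarrow> g \<tau> \<le> g \<sigma> \<longrightarrow> \<tau> \<in> S)"

lemma cells_subset: "cells J I z \<subseteq> X"
  by (auto simp: cells_def)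

lemma loc_closed_cells: "loc_closed (cells J I z)"
  unfolding loc_closed_def cells_def Finite_Cartesian_Product.less_eq_vec_def by (auto intro: less_le_trans order_trans)

lemma Ch_supported: "x \<in> Ch S d \<Longrightarrow> x \<in> supported S"
  unfolding Ch_def by (erule supported_mono) auto

lemma Ch_subspace: "fs.subspace (Ch S d)"
  by (simp add: Ch_def supported_subspace)

lemma Ch_0 [simp]: "0 \<in> Ch S d"
  by (simp add: fs.subspace_0 Ch_subspace)

lemma bd_add: "bd S (x + y) = bd S x + bd S y"
  by (simp add: bd_def mat_app_add rest_add)

lemma bd_scale: "bd S (fscale c x) = fscale c (bd S x)"
  by (simp add: bd_def mat_app_scale rest_scale)

lemma bd_0 [simp]: "bd S 0 = 0"
  using bd_scale[of S 0 0] by simp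

lemma bd_diff: "bd S (x - y) = bd S x - bd S y"
  using bd_add[of S "x - y" y] by (simp add: algebra_simps)

lemma Cyc_subspace: "fs.subspace (Cyc S d)"
  using Ch_subspace[of S d] by (auto simp: fs.subspace_def Cyc_def bd_add bd_scale)

lemma Bnd_subspace: "fs.subspace (Bnd S d)"
  unfolding Bnd_def
proof (rule fs.subspaceI)
  show "0 \<in> bd S ` Ch S (d + 1)" by (rule image_eqI[of _ _ 0]) simp_all
  show "x + y \<in> bd S ` Ch S (d + 1)" if "x \<in> bd S ` Ch S (d + 1)" "y \<in> bd S ` Ch S (d + 1)" for x y
    using that by (auto simp: image_iff bd_add intro!: bexI[OF _ fs.subspace_add[OF Ch_subspace]])
  show "fscale c x \<in> bd S ` Ch S (d + 1)" if "x \<in> bd S ` Ch S (d + 1)" for c x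
    using that by (auto simp: image_iff bd_scale intro!: bexI[OF _ fs.subspace_scale[OF Ch_subspace]])
qed

lemma bd_Ch:
  assumes "S \<subseteq> X" "x \<in> Ch S d"
  shows "bd S x \<in> Ch S (d - 1)"
  unfolding Ch_def supported_def
proof (intro CollectI allI impI)
  fix t assume t: "t \<notin> {\<sigma> \<in> S. dm \<sigma> = d - 1}"
  show "bd S x t = 0"
  proof (rule ccontr)
    assume *: "bd S x t \<noteq> 0"
    then have tS: "t \<in> S" and nz: "mat_app X A x t \<noteq> 0"
      by (auto simp: bd_def rest_def split: if_splits)
    from nz obtain s where s: "s \<in> X" "A s t \<noteq> 0" "x s \<noteq> 0"
      by (rule mat_app_nonzero)
    then have "dm s = d" using assms(2) by (auto simp: Ch_def supported_def)
    with A_dim[OF s(1) _ s(2)] tS t assms(1) show False by auto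
  qed
qed

lemma bd_Ch_Suc: "loc_closed S \<Longrightarrow> x \<in> Ch S (d + 1) \<Longrightarrow> bd S x \<in> Ch S d"
  using bd_Ch[of S x "d + 1"] by (simp add: loc_closed_def)

lemma bd_bd:
  assumes S: "loc_closed S" and x: "x \<in> supported S"
  shows "bd S (bd S x) = 0"
proof -
  have "rest S (mat_app X A (rest S (mat_app X A x))) = rest S (mat_app X A (mat_app X A x))"
  proof (rule rest_mat_app_rest)
    fix s t assume s: "s \<in> X" "t \<in> S" "A s t \<noteq> 0" "mat_app X A x s \<noteq> 0"
    from s(4) obtain r where r: "r \<in> X" "A r s \<noteq> 0" "x r \<noteq> 0"
      by (rule mat_app_nonzero)
    then have "r \<in> S" using x by (auto simp: supported_def)
    with S s r A_grade show "s \<in> S" unfolding loc_closed_def by blast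
  qed
  also have "\<dots> = 0"
  proof
    fix t
    have "(\<Sum>s\<in>X. (\<Sum>r\<in>X. A s r * A r t) * x s) = 0" if "t \<in> S"
      using S that by (intro sum.neutral) (auto simp: A_A loc_closed_def)
    then show "rest S (mat_app X A (mat_app X A x)) t = 0 t"
      unfolding mat_app_mat_app by (simp add: mat_app_def rest_def)
  qed
  finally show ?thesis by (simp add: bd_def)
qed

lemma Bnd_subset_Cyc:
  assumes "loc_closed S"
  shows "Bnd S d \<subseteq> Cyc S d"
  using bd_Ch_Suc[OF assms] bd_bd[OF assms] Ch_supported
  by (auto simp: Bnd_def Cyc_def)

text \<open>An isomorphism of homology in relational form. Linearity and the equivalence about
  boundaries make it well defined and injective on classes; the two existence clauses make it total
  and surjective.\<close>

definition correspondence :: "'s set \<Rightarrow> int \<Rightarrow> 's set \<Rightarrow> int \<Rightarrow> (('s \<Rightarrow> 'k) \<Rightarrow> ('s \<Rightarrow> 'k) \<Rightarrow> bool) \<Rightarrow> bool" where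
  "correspondence S d S' d' T \<longleftrightarrow>
    (\<forall>x y. T x y \<longrightarrow> x \<in> Cyc S d \<and> y \<in> Cyc S' d' \<and> (x \<in> Bnd S d \<longleftrightarrow> y \<in> Bnd S' d')) \<and>
    (\<forall>x\<in>Cyc S d. \<exists>y. T x y) \<and> (\<forall>y\<in>Cyc S' d'. \<exists>x. T x y) \<and>
    (\<forall>x y x' y'. T x y \<longrightarrow> T x' y' \<longrightarrow> T (x + x') (y + y')) \<and>
    (\<forall>c x y. T x y \<longrightarrow> T (fscale c x) (fscale c y))"

lemma correspondence_id: "correspondence S d S d (\<lambda>x y. x \<in> Cyc S d \<and> y = x)"
  using Cyc_subspace[of S d] by (auto simp: correspondence_def fs.subspace_def)

lemma correspondence_compose:
  assumes "correspondence S d S' d' T" "correspondence S' d' S'' d'' T'"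
  shows "correspondence S d S'' d'' (\<lambda>x y. \<exists>w. T x w \<and> T' w y)"
proof -
  note 1 = assms(1)[unfolded correspondence_def] and 2 = assms(2)[unfolded correspondence_def]
  show ?thesis
    unfolding correspondence_def
    apply (intro conjI allI impI ballI)
    subgoal using 1 by blast
    subgoal using 2 by blast
    subgoal using 1 2 by metis
    subgoal using 1 2 by metis
    subgoal using 1 2 by metis
    subgoal using 1 2 by metis
    subgoal using 1 2 by metis
    done
qed

text \<open>The connecting homomorphism of the short exact sequence of complexes of chains on \<open>S1\<close>,
  \<open>S\<close> and \<open>S2\<close>, as a relation between cycles and read backwards.\<close>

definition connect :: "'s set \<Rightarrow> 's set \<Rightarrow> 's set \<Rightarrow> int \<Rightarrow> ('s \<Rightarrow> 'k) \<Rightarrow> ('s \<Rightarrow> 'k) \<Rightarrow> bool" where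
  "connect S1 S S2 d x y \<longleftrightarrow>
    x \<in> supported S1 \<and> (\<exists>u\<in>Ch S (d + 1). bd S u = x \<and> rest S2 u = y)"

lemma rest_Ch: "u \<in> Ch S d \<Longrightarrow> S' \<subseteq> S \<Longrightarrow> rest S' u \<in> Ch S' d"
  by (auto simp: Ch_def rest_def supported_def)

lemma Ch_mono: "u \<in> Ch S d \<Longrightarrow> S \<subseteq> S' \<Longrightarrow> u \<in> Ch S' d"
  by (auto simp: Ch_def supported_def)

section \<open>Long exact sequence of a subcomplex and its quotient\<close>

context
  fixes S1 S S2 :: "'s set"
  assumes S: "loc_closed S" and S1: "loc_closed S1" and S2: "loc_closed S2"
    and un: "S = S1 \<union> S2" and dis: "S1 \<inter> S2 = {}"
    and closed: "\<And>\<sigma> \<tau>. \<sigma> \<in> S1 \<Longrightarrow> \<tau> \<in> S \<Longrightarrow> A \<sigma> \<tau> \<noteq> 0 \<Longrightarrow> \<tau> \<in> S1"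
begin

lemma bd_sub:
  assumes x: "x \<in> supported S1"
  shows "bd S x = bd S1 x"
proof
  fix t
  have "mat_app X A x t = 0" if t: "t \<in> S" "t \<notin> S1"
  proof (rule ccontr)
    assume "mat_app X A x t \<noteq> 0"
    then obtain s where "s \<in> X" "A s t \<noteq> 0" "x s \<noteq> 0" by (rule mat_app_nonzero)
    with x closed[of s t] t show False by (auto simp: supported_def)
  qed
  with un show "bd S x t = bd S1 x t" by (auto simp: bd_def rest_def)
qed

lemma rest_bd:
  assumes x: "x \<in> supported S"
  shows "rest S2 (bd S x) = bd S2 (rest S2 x)"
proof -
  have "rest S2 (mat_app X A (rest S2 x)) = rest S2 (mat_app X A x)"
  proof (rule rest_mat_app_rest)
    fix s t assume s: "s \<in> X" "t \<in> S2" "A s t \<noteq> 0" "x s \<noteq> 0"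
    with x have "s \<in> S" by (auto simp: supported_def)
    with s closed[of s t] un dis show "s \<in> S2" by auto
  qed
  with un show ?thesis by (simp add: bd_def rest_rest)
qed

lemma Ch_S1: "x \<in> Ch S d \<Longrightarrow> rest S2 x = 0 \<Longrightarrow> x \<in> Ch S1 d"
  using un by (auto simp: Ch_def supported_def rest_def fun_eq_iff split: if_splits)

lemma connect_cycles:
  assumes "connect S1 S S2 d x y"
  shows "x \<in> Cyc S1 d" "y \<in> Cyc S2 (d + 1)"
proof -
  obtain u where u: "x \<in> supported S1" "u \<in> Ch S (d + 1)" "bd S u = x" "rest S2 u = y"
    using assms by (auto simp: connect_def)
  have "x \<in> Ch S d"
    using bd_Ch_Suc[OF S u(2)] u(3) by simp
  moreover have r: "rest S2 x = 0"
    using u(1) dis by (auto simp: rest_def supported_def fun_eq_iff)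
  ultimately have x: "x \<in> Ch S1 d" by (rule Ch_S1)
  have "bd S1 x = 0"
    using bd_bd[OF S Ch_supported[OF u(2)]] bd_sub[OF u(1)] u(3) by simp
  with x show "x \<in> Cyc S1 d" by (simp add: Cyc_def)
  have "bd S2 y = 0" using rest_bd[OF Ch_supported[OF u(2)]] u(3,4) r by simp
  moreover have "y \<in> Ch S2 (d + 1)" using rest_Ch[OF u(2), of S2] un u(4) by simp
  ultimately show "y \<in> Cyc S2 (d + 1)" by (simp add: Cyc_def)
qed

text \<open>The cycle \<open>y\<close>, extended by zero, is its own lift; its boundary in
  \<open>S\<close> has no part in \<open>S2\<close>.\<close>

lemma ex_connect_left:
  assumes "y \<in> Cyc S2 (d + 1)"
  shows "\<exists>x. connect S1 S S2 d x y"
proof -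
  from assms have y: "y \<in> Ch S2 (d + 1)" "bd S2 y = 0" by (auto simp: Cyc_def)
  have yS: "y \<in> Ch S (d + 1)" using Ch_mono[OF y(1)] un by auto
  have ry: "rest S2 y = y" by (rule rest_id[OF Ch_supported[OF y(1)]])
  have "rest S2 (bd S y) = 0" using rest_bd[OF Ch_supported[OF yS]] ry y(2) by simp
  moreover have "bd S y \<in> Ch S d"
    by (rule bd_Ch_Suc[OF S yS])
  ultimately have "bd S y \<in> Ch S1 d" by (intro Ch_S1)
  then show ?thesis
    using yS ry Ch_supported unfolding connect_def by blast
qed

text \<open>If \<open>x\<close> is the boundary of \<open>v\<close> in \<open>S1\<close>, then
  \<open>u - v\<close> is a cycle in \<open>S\<close>, hence the boundary of some \<open>w\<close>,
  and the part of \<open>w\<close> in \<open>S2\<close> has boundary \<open>y\<close>. Conversely,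
  if \<open>y\<close> is the boundary of \<open>w\<close>, then subtracting \<open>bd S w\<close>
  moves the lift \<open>u\<close> into \<open>S1\<close> without changing its boundary.\<close>

lemma connect_Bnd:
  assumes acyc: "exact S" and c: "connect S1 S S2 d x y"
  shows "x \<in> Bnd S1 d \<longleftrightarrow> y \<in> Bnd S2 (d + 1)"
proof
  obtain u where u: "x \<in> supported S1" "u \<in> Ch S (d + 1)" "bd S u = x" "rest S2 u = y"
    using c by (auto simp: connect_def)
  show "y \<in> Bnd S2 (d + 1)" if B: "x \<in> Bnd S1 d"
  proof -
    obtain v where v: "v \<in> Ch S1 (d + 1)" "bd S1 v = x" using B by (auto simp: Bnd_def)
    have vS: "v \<in> Ch S (d + 1)" using Ch_mono[OF v(1)] un by auto
    have "bd S (u - v) = 0"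
      using u(3) v(2) bd_sub[OF Ch_supported[OF v(1)]] by (simp add: bd_diff)
    then have "u - v \<in> Cyc S (d + 1)"
      using fs.subspace_diff[OF Ch_subspace u(2) vS] by (simp add: Cyc_def)
    from exactE[OF acyc this] obtain w where w: "w \<in> Ch S (d + 1 + 1)" "bd S w = u - v" .
    have "rest S2 u = rest S2 (u - v)"
      using Ch_supported[OF v(1)] dis by (auto simp: rest_def supported_def fun_eq_iff)
    then have "y = bd S2 (rest S2 w)"
      using rest_bd[OF Ch_supported[OF w(1)]] w(2) u(4) by simp
    then show ?thesis
      using rest_Ch[OF w(1), of S2] un by (auto simp: Bnd_def)
  qed
  show "x \<in> Bnd S1 d" if B: "y \<in> Bnd S2 (d + 1)"
  proof -
    obtain w where w: "w \<in> Ch S2 (d + 1 + 1)" "bd S2 w = y" using B by (auto simp: Bnd_def)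
    have wS: "w \<in> Ch S (d + 1 + 1)" using Ch_mono[OF w(1)] un by auto
    have "rest S2 (bd S w) = y"
      using rest_bd[OF Ch_supported[OF wS]] rest_id[OF Ch_supported[OF w(1)]] w(2) by simp
    then have "rest S2 (u - bd S w) = 0"
      using u(4) by (simp add: rest_diff)
    moreover have bw: "bd S w \<in> Ch S (d + 1)"
      by (rule bd_Ch_Suc[OF S wS])
    then have "u - bd S w \<in> Ch S (d + 1)"
      using fs.subspace_diff[OF Ch_subspace u(2)] by blast
    ultimately have v: "u - bd S w \<in> Ch S1 (d + 1)" by (intro Ch_S1)
    have "bd S1 (u - bd S w) = x"
      using bd_sub[OF Ch_supported[OF v]] bd_bd[OF S Ch_supported[OF wS]] u(3) by (simp add: bd_diff)
    with v show ?thesis by (auto simp: Bnd_def)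
  qed
qed

lemma correspondence_connect:
  assumes acyc: "exact S"
  shows "correspondence S1 d S2 (d + 1) (connect S1 S S2 d)"
  unfolding correspondence_def
proof (intro conjI allI impI ballI)
  fix x y assume c: "connect S1 S S2 d x y"
  show "x \<in> Cyc S1 d" "y \<in> Cyc S2 (d + 1)" using connect_cycles[OF c] .
  show "x \<in> Bnd S1 d \<longleftrightarrow> y \<in> Bnd S2 (d + 1)" by (rule connect_Bnd[OF acyc c])
  fix k
  from c obtain u where u: "x \<in> supported S1" "u \<in> Ch S (d + 1)" "bd S u = x" "rest S2 u = y"
    by (auto simp: connect_def)
  then show "connect S1 S S2 d (fscale k x) (fscale k y)"
    unfolding connect_def
    by (auto simp: supported_def bd_scale rest_scale intro!: bexI[of _ "fscale k u"] fs.subspace_scale[OF Ch_subspace])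
  fix x' y' assume "connect S1 S S2 d x' y'"
  then obtain u' where u': "x' \<in> supported S1" "u' \<in> Ch S (d + 1)" "bd S u' = x'" "rest S2 u' = y'"
    by (auto simp: connect_def)
  show "connect S1 S S2 d (x + x') (y + y')"
    using u u' unfolding connect_def
    by (auto simp: supported_def bd_add rest_add intro!: bexI[of _ "u + u'"] fs.subspace_add[OF Ch_subspace])
next
  fix y assume "y \<in> Cyc S2 (d + 1)" then show "\<exists>x. connect S1 S S2 d x y" by (rule ex_connect_left)
next
  fix x assume "x \<in> Cyc S1 d"
  then have x: "x \<in> Ch S1 d" "bd S1 x = 0" by (auto simp: Cyc_def)
  then have "x \<in> Cyc S d"
    using bd_sub[OF Ch_supported[OF x(1)]] Ch_mono[OF x(1)] un by (auto simp: Cyc_def)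
  from exactE[OF acyc this] obtain u where "u \<in> Ch S (d + 1)" "bd S u = x" .
  then show "\<exists>y. connect S1 S S2 d x y"
    using Ch_supported[OF x(1)] unfolding connect_def by blast
qed

text \<open>In the long exact sequence the homology of the quotient sits between that of
  \<open>S\<close> and that of \<open>S1\<close> one degree lower.\<close>

lemma exact_quotient:
  assumes "exact S" "exact S1"
  shows "exact S2"
  unfolding exact_def
proof (intro allI subsetI)
  fix d y assume "y \<in> Cyc S2 d"
  then obtain x where c: "connect S1 S S2 (d - 1) x y" using ex_connect_left[of y "d - 1"] by auto
  with connect_cycles[OF c] assms(2) connect_Bnd[OF assms(1) c] show "y \<in> Bnd S2 d"
    unfolding exact_def by auto
qed

end

text \<open>These are the hypotheses on \<open>S1\<close>, \<open>S\<close> and \<open>S2\<close>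
  for one coordinate. Boundaries do not raise grades, so the simplices that are at most
  \<open>z $ i\<close> in coordinate \<open>i\<close> carry the subcomplex.\<close>

lemma cells_step:
  assumes "i \<notin> J" "i \<notin> I"
  shows "cells J (insert i I) z = cells J I z \<union> cells (insert i J) I z"
    "cells J I z \<inter> cells (insert i J) I z = {}"
    "\<sigma> \<in> cells J I z \<Longrightarrow> \<tau> \<in> cells J (insert i I) z \<Longrightarrow> A \<sigma> \<tau> \<noteq> 0 \<Longrightarrow> \<tau> \<in> cells J I z"
proof -
  show "cells J (insert i I) z = cells J I z \<union> cells (insert i J) I z"
    "cells J I z \<inter> cells (insert i J) I z = {}"
    using assms by (fastforce simp: cells_def not_le)+
  show "\<tau> \<in> cells J I z"
    if "\<sigma> \<in> cells J I z" "\<tau> \<in> cells J (insert i I) z" "A \<sigma> \<tau> \<noteq> 0"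
    using that A_grade[of \<sigma> \<tau>] unfolding cells_def Finite_Cartesian_Product.less_eq_vec_def by (auto intro: order_trans)
qed

text \<open>The tail is processed before the head, and every step raises the degree by one. The list
  is a parameter because the composite depends on the order up to sign.\<close>

fun zigzag :: "int^'n \<Rightarrow> int \<Rightarrow> 'n list \<Rightarrow> ('s \<Rightarrow> 'k) \<Rightarrow> ('s \<Rightarrow> 'k) \<Rightarrow> bool" where
  "zigzag z d [] = (\<lambda>x y. x \<in> Cyc (cells {} {} z) d \<and> y = x)"
| "zigzag z d (j # js) = (\<lambda>x y. \<exists>w. zigzag z d js x w \<and>
    connect (cells (set js) {} z) (cells (set js) {j} z) (cells (insert j (set js)) {} z)
      (d + int (length js)) w y)"

text \<open>A coordinate \<open>i\<close> enters \<open>J\<close> through the exact sequence whose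
  other terms have free coordinates \<open>insert i I\<close> and \<open>I\<close>; both are exact
  by induction, which is therefore done for all \<open>I\<close>.\<close>

lemma exact_cells:
  assumes acyc: "\<And>I. I \<noteq> {} \<Longrightarrow> exact (cells {} I z)"
    and "I \<noteq> {}" "I \<inter> J = {}"
  shows "exact (cells J I z)"
proof -
  have "finite J" by simp
  then show ?thesis
    using assms(2,3)
  proof (induction J arbitrary: I)
    case (insert i J)
    then have i: "i \<notin> J" "i \<notin> I" by auto
    show ?case
      using insert.prems i
      by (intro exact_quotient[OF loc_closed_cells loc_closed_cells loc_closed_cells cells_step[OF i]] insert.IH) auto
  qed (use acyc in auto)
qed

lemma correspondence_zigzag:
  assumes acyc: "\<And>I. I \<noteq> {} \<Longrightarrow> exact (cells {} I z)" and "distinct js"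
  shows "correspondence (cells {} {} z) d (cells (set js) {} z) (d + int (length js)) (zigzag z d js)"
  using assms(2)
proof (induction js)
  case Nil
  then show ?case using correspondence_id by simp
next
  case (Cons j js)
  then have j: "j \<notin> set js" "j \<notin> {}" by auto
  \<comment> \<open>The middle term has the free coordinate \<open>j\<close>, so it is exact and the
    connecting relation becomes a correspondence.\<close>
  have "exact (cells (set js) {j} z)"
    using exact_cells[OF acyc, of "{j}" "set js"] j by auto
  from correspondence_connect[OF loc_closed_cells loc_closed_cells loc_closed_cells cells_step[OF j] this]
  have "correspondence (cells (set js) {} z) (d + int (length js)) (cells (insert j (set js)) {} z)
      (d + int (length js) + 1) (connect (cells (set js) {} z) (cells (set js) {j} z)
        (cells (insert j (set js)) {} z) (d + int (length js)))" .
  from correspondence_compose[OF Cons.IH this] Cons.prems show ?case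
    by (simp add: algebra_simps)
qed

end

section \<open>Duality\<close>

lemma pairing_ind:
  assumes "finite X" "s \<in> X"
  shows "pairing X x (\<lambda>t. if t = s then 1 else 0) = x s"
  using assms by (simp add: pairing_def if_distrib cong: if_cong)

context graded_complex
begin

text \<open>Truncated to \<open>X\<close> only, unlike \<open>bd\<close>: the cells above
  \<open>z\<close> in all coordinates are closed under passing to larger grades, so the coboundary
  of a cochain on them stays there.\<close>

definition cobd :: "('s \<Rightarrow> 'k) \<Rightarrow> 's \<Rightarrow> 'k" where
  "cobd \<psi> = rest X (mat_app X (\<lambda>\<tau> \<sigma>. A \<sigma> \<tau>) \<psi>)"

definition Cocyc :: "'s set \<Rightarrow> int \<Rightarrow> ('s \<Rightarrow> 'k) set" where
  "Cocyc S p = {\<psi> \<in> Ch S p. cobd \<psi> = 0}"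

definition Cobnd :: "'s set \<Rightarrow> int \<Rightarrow> ('s \<Rightarrow> 'k) set" where
  "Cobnd S p = cobd ` Ch S (p - 1)"

definition up_closed :: "'s set \<Rightarrow> bool" where
  "up_closed S \<longleftrightarrow> S \<subseteq> X \<and> (\<forall>\<sigma>\<in>S. \<forall>\<tau>\<in>X. g \<sigma> \<le> g \<tau> \<longrightarrow> \<tau> \<in> S)"

lemma up_closed_cells: "up_closed (cells UNIV {} z)"
  unfolding up_closed_def cells_def Finite_Cartesian_Product.less_eq_vec_def
  by (auto intro: less_le_trans)

lemma cobd_add: "cobd (x + y) = cobd x + cobd y"
  by (simp add: cobd_def mat_app_add rest_add)

lemma cobd_scale: "cobd (fscale c x) = fscale c (cobd x)"
  by (simp add: cobd_def mat_app_scale rest_scale)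

lemma cobd_0 [simp]: "cobd 0 = 0"
  using cobd_scale[of 0 0] by simp

lemma cobd_diff: "cobd (x - y) = cobd x - cobd y"
  using cobd_add[of "x - y" y] by (simp add: algebra_simps)

lemma Cocyc_subspace: "fs.subspace (Cocyc S p)"
  using Ch_subspace[of S p] by (auto simp: fs.subspace_def Cocyc_def cobd_add cobd_scale)

lemma Cobnd_subspace: "fs.subspace (Cobnd S p)"
  unfolding Cobnd_def
proof (rule fs.subspaceI)
  show "0 \<in> cobd ` Ch S (p - 1)" by (rule image_eqI[of _ _ 0]) simp_all
  show "x + y \<in> cobd ` Ch S (p - 1)" if "x \<in> cobd ` Ch S (p - 1)" "y \<in> cobd ` Ch S (p - 1)" for x y
    using that by (auto simp: image_iff cobd_add intro!: bexI[OF _ fs.subspace_add[OF Ch_subspace]])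
  show "fscale c x \<in> cobd ` Ch S (p - 1)" if "x \<in> cobd ` Ch S (p - 1)" for c x
    using that by (auto simp: image_iff cobd_scale intro!: bexI[OF _ fs.subspace_scale[OF Ch_subspace]])
qed

lemma Ch_supported_X: "S \<subseteq> X \<Longrightarrow> x \<in> Ch S d \<Longrightarrow> x \<in> supported X"
  by (rule supported_mono[OF Ch_supported])

lemma Cyc_supported: "S \<subseteq> X \<Longrightarrow> Cyc S d \<subseteq> supported X"
  using Ch_supported_X by (auto simp: Cyc_def)

lemma Cocyc_supported: "S \<subseteq> X \<Longrightarrow> Cocyc S p \<subseteq> supported X"
  using Ch_supported_X by (auto simp: Cocyc_def)

lemma cobd_Ch:
  assumes S: "up_closed S" and \<psi>: "\<psi> \<in> Ch S p"
  shows "cobd \<psi> \<in> Ch S (p + 1)"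
  unfolding Ch_def supported_def
proof (intro CollectI allI impI)
  fix s assume s: "s \<notin> {\<sigma> \<in> S. dm \<sigma> = p + 1}"
  show "cobd \<psi> s = 0"
  proof (rule ccontr)
    assume "cobd \<psi> s \<noteq> 0"
    then have sX: "s \<in> X" and nz: "mat_app X (\<lambda>\<tau> \<sigma>. A \<sigma> \<tau>) \<psi> s \<noteq> 0"
      by (auto simp: cobd_def rest_def split: if_splits)
    from nz obtain t where t: "t \<in> X" "A s t \<noteq> 0" "\<psi> t \<noteq> 0"
      by (rule mat_app_nonzero)
    then have "t \<in> S" "dm t = p" using \<psi> by (auto simp: Ch_def supported_def)
    with A_dim[OF sX t(1,2)] A_grade[OF sX t(1,2)] S s sX show False
      unfolding up_closed_def by blast
  qed
qed

text \<open>The truncation in \<open>bd S\<close> is invisible to \<open>\<theta>\<close> and the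
  one in \<open>cobd\<close> is invisible to \<open>v\<close>; otherwise the two matrices are
  transposes of each other.\<close>

lemma pairing_bd:
  assumes "v \<in> supported X" "\<theta> \<in> supported S"
  shows "pairing X (bd S v) \<theta> = pairing X v (cobd \<theta>)"
  by (simp add: bd_def cobd_def pairing_rest[OF assms(2)] pairing_mat_app pairing_rest_right[OF assms(1)])

lemma cobd_apply: "s \<in> X \<Longrightarrow> cobd \<psi> s = pairing X (\<lambda>t. if t = s then 1 else 0) (cobd \<psi>)"
  by (simp add: pairing_def if_distrib[of "\<lambda>c. c * _"] fin cong: if_cong)

text \<open>Testing against indicator functions reduces this to the square of the boundary on all of
  \<open>X\<close>.\<close>

lemma cobd_cobd:
  assumes "\<theta> \<in> supported X"
  shows "cobd (cobd \<theta>) = 0"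
proof
  fix s
  have X: "loc_closed X" by (simp add: loc_closed_def)
  show "cobd (cobd \<theta>) s = 0 s"
  proof (cases "s \<in> X")
    case True
    let ?v = "\<lambda>t. if t = s then 1 else 0 :: 'k"
    have v: "?v \<in> supported X" using True by (simp add: supported_def)
    have c: "cobd \<theta> \<in> supported X" by (simp add: cobd_def rest_def supported_def)
    have b: "bd X ?v \<in> supported X" by (simp add: bd_def rest_def supported_def)
    have "cobd (cobd \<theta>) s = pairing X (bd X (bd X ?v)) \<theta>"
      unfolding cobd_apply[OF True] pairing_bd[OF v c, symmetric] pairing_bd[OF b assms] ..
    with bd_bd[OF X v] show ?thesis by simp
  qed (simp add: cobd_def rest_def)
qed

lemma Cobnd_subset_Cocyc:
  assumes "up_closed S"
  shows "Cobnd S p \<subseteq> Cocyc S p"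
proof
  fix x assume "x \<in> Cobnd S p"
  then obtain \<theta> where \<theta>: "\<theta> \<in> Ch S (p - 1)" "x = cobd \<theta>" by (auto simp: Cobnd_def)
  moreover have "\<theta> \<in> supported X"
    using Ch_supported_X[OF _ \<theta>(1)] assms by (simp add: up_closed_def)
  ultimately show "x \<in> Cocyc S p"
    using cobd_Ch[OF assms \<theta>(1)] cobd_cobd by (simp add: Cocyc_def)
qed

lemma pairing_Cyc_Cobnd:
  assumes "S \<subseteq> X" "y \<in> Cyc S p" "b \<in> Cobnd S p"
  shows "pairing X y b = 0"
proof -
  obtain \<theta> where \<theta>: "\<theta> \<in> Ch S (p - 1)" "b = cobd \<theta>" using assms(3) by (auto simp: Cobnd_def)
  have "y \<in> supported X" using assms(1,2) Ch_supported_X by (auto simp: Cyc_def)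
  from pairing_bd[OF this Ch_supported[OF \<theta>(1)]] show ?thesis
    using assms(2) \<theta>(2) by (simp add: Cyc_def)
qed

lemma pairing_Bnd_Cocyc:
  assumes "S \<subseteq> X" "y \<in> Bnd S p" "\<psi> \<in> Cocyc S p"
  shows "pairing X y \<psi> = 0"
proof -
  obtain v where v: "v \<in> Ch S (p + 1)" "y = bd S v" using assms(2) by (auto simp: Bnd_def)
  have "\<psi> \<in> supported S" using assms(3) Ch_supported by (auto simp: Cocyc_def)
  from pairing_bd[OF Ch_supported_X[OF assms(1) v(1)] this] show ?thesis
    using assms(3) v(2) by (simp add: Cocyc_def)
qed

lemma ind_Ch: "s \<in> S \<Longrightarrow> dm s = p \<Longrightarrow> (\<lambda>t. if t = s then 1 else 0) \<in> Ch S p"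
  by (auto simp: Ch_def supported_def)

text \<open>The injectivity half of duality. Pairing with \<open>y\<close> factors through
  \<open>cobd\<close> as a functional on coboundaries, and a chain that represents this functional
  has boundary \<open>y\<close>.\<close>

lemma Bnd_if_annihilates:
  assumes S: "up_closed S" and y: "y \<in> Ch S p" and ann: "\<And>\<psi>. \<psi> \<in> Cocyc S p \<Longrightarrow> pairing X y \<psi> = 0"
  shows "y \<in> Bnd S p"
proof -
  have SX: "S \<subseteq> X" using S by (simp add: up_closed_def)
  \<comment> \<open>The chosen preimage does not matter: two preimages differ by a cocycle, and
    \<open>y\<close> annihilates cocycles.\<close>
  define \<phi> where "\<phi> \<beta> = pairing X y (SOME \<psi>. \<psi> \<in> Ch S p \<and> cobd \<psi> = \<beta>)" for \<beta>
  have \<phi>: "\<phi> (cobd \<psi>) = pairing X y \<psi>" if \<psi>: "\<psi> \<in> Ch S p" for \<psi>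
  proof -
    define \<psi>' where "\<psi>' = (SOME \<psi>'. \<psi>' \<in> Ch S p \<and> cobd \<psi>' = cobd \<psi>)"
    have \<psi>': "\<psi>' \<in> Ch S p \<and> cobd \<psi>' = cobd \<psi>"
      unfolding \<psi>'_def by (rule someI[of _ \<psi>]) (simp add: \<psi>)
    then have "\<psi>' - \<psi> \<in> Cocyc S p"
      using fs.subspace_diff[OF Ch_subspace _ \<psi>] by (simp add: Cocyc_def cobd_diff)
    from ann[OF this] have "pairing X y (\<psi>' - \<psi> + \<psi>) = pairing X y \<psi>"
      unfolding pairing_add by simp
    then show ?thesis by (simp add: \<phi>_def \<psi>'_def)
  qed
  let ?U = "Cobnd S (p + 1)"
  have U: "?U \<subseteq> supported X"
    by (auto simp: Cobnd_def cobd_def rest_def supported_def)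
  have UE: "\<exists>\<psi>\<in>Ch S p. u = cobd \<psi>" if "u \<in> ?U" for u
    using that by (auto simp: Cobnd_def)
  have add: "\<phi> (u + u') = \<phi> u + \<phi> u'" if "u \<in> ?U" "u' \<in> ?U" for u u'
  proof -
    obtain \<psi> \<psi>' where p: "\<psi> \<in> Ch S p" "u = cobd \<psi>" "\<psi>' \<in> Ch S p" "u' = cobd \<psi>'"
      using UE \<open>u \<in> ?U\<close> \<open>u' \<in> ?U\<close> by blast
    then have "\<psi> + \<psi>' \<in> Ch S p" by (intro fs.subspace_add[OF Ch_subspace])
    from \<phi>[OF this] show ?thesis
      unfolding p(2,4) \<phi>[OF p(1)] \<phi>[OF p(3)] by (simp add: cobd_add pairing_add)
  qed
  have scale: "\<phi> (fscale c u) = c * \<phi> u" if "u \<in> ?U" for c u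
  proof -
    obtain \<psi> where p: "\<psi> \<in> Ch S p" "u = cobd \<psi>"
      using UE \<open>u \<in> ?U\<close> by blast
    then have "fscale c \<psi> \<in> Ch S p" by (intro fs.subspace_scale[OF Ch_subspace])
    from \<phi>[OF this] show ?thesis
      unfolding p(2) \<phi>[OF p(1)] by (simp add: cobd_scale pairing_scale)
  qed
  obtain w where w: "w \<in> supported X" "\<And>u. u \<in> ?U \<Longrightarrow> \<phi> u = (\<Sum>s\<in>X. w s * u s)"
    using functional_representation[OF Cobnd_subspace U fin add scale] by blast
  \<comment> \<open>The coboundaries in question are supported on these simplices, so discarding the
    rest of \<open>w\<close> keeps all pairings and leaves a chain.\<close>
  define v where "v = rest {\<sigma>\<in>S. dm \<sigma> = p + 1} w"
  have v: "v \<in> Ch S (p + 1)" by (auto simp: v_def Ch_def rest_def supported_def)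
  have vX: "v \<in> supported X" by (rule Ch_supported_X[OF SX v])
  have pv: "pairing X v (cobd \<psi>) = pairing X y \<psi>" if \<psi>: "\<psi> \<in> Ch S p" for \<psi>
  proof -
    have "cobd \<psi> \<in> ?U" using \<psi> by (simp add: Cobnd_def)
    from w(2)[OF this] \<phi>[OF \<psi>] have "pairing X y \<psi> = pairing X w (cobd \<psi>)"
      by (simp add: pairing_def)
    also have "\<dots> = pairing X v (cobd \<psi>)"
      using cobd_Ch[OF S \<psi>] unfolding v_def Ch_def by (rule pairing_rest[symmetric])
    finally show ?thesis by simp
  qed
  have "bd S v s = y s" for s
  proof (cases "s \<in> S \<and> dm s = p")
    case True
    then have i: "(\<lambda>t. if t = s then 1 else 0) \<in> Ch S p" and "s \<in> X"
      using ind_Ch SX by auto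
    then have "bd S v s = pairing X (bd S v) (\<lambda>t. if t = s then 1 else 0)"
      by (simp add: pairing_ind fin)
    also have "\<dots> = pairing X y (\<lambda>t. if t = s then 1 else 0)"
      using pairing_bd[OF vX Ch_supported[OF i]] pv[OF i] by simp
    also have "\<dots> = y s" using \<open>s \<in> X\<close> by (simp add: pairing_ind fin)
    finally show ?thesis .
  next
    case False
    with bd_Ch[OF SX v] y show ?thesis by (auto simp: Ch_def supported_def)
  qed
  then have "bd S v = y" by (simp add: fun_eq_iff)
  with v show ?thesis by (auto simp: Bnd_def)
qed

text \<open>The surjectivity half of duality. Truncation to the simplices of \<open>S\<close> in
  degree \<open>p\<close> does not affect pairings with cochains, and annihilating coboundaries then
  means having boundary zero.\<close>

lemma ex_Cyc_pairing:
  assumes S: "up_closed S" and y: "y \<in> annihilator X (Cobnd S p)"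
  obtains y' where "y' \<in> Cyc S p" "\<And>\<psi>. \<psi> \<in> Ch S p \<Longrightarrow> pairing X y' \<psi> = pairing X y \<psi>"
proof -
  have SX: "S \<subseteq> X" using S by (simp add: up_closed_def)
  define y' where "y' = rest {\<sigma>\<in>S. dm \<sigma> = p} y"
  have y': "y' \<in> Ch S p" by (auto simp: y'_def Ch_def rest_def supported_def)
  have p: "pairing X y' \<psi> = pairing X y \<psi>" if "\<psi> \<in> Ch S p" for \<psi>
    using that unfolding y'_def Ch_def by (rule pairing_rest)
  have "bd S y' s = 0" for s
  proof (cases "s \<in> S \<and> dm s = p - 1")
    case True
    then have i: "(\<lambda>t. if t = s then 1 else 0) \<in> Ch S (p - 1)" (is "?i \<in> _") and "s \<in> X"
      using ind_Ch SX by auto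
    then have "bd S y' s = pairing X (bd S y') ?i"
      by (simp add: pairing_ind fin)
    also have "\<dots> = pairing X y' (cobd ?i)"
      by (rule pairing_bd[OF Ch_supported_X[OF SX y'] Ch_supported[OF i]])
    also have "\<dots> = pairing X y (cobd ?i)"
      using p[of "cobd ?i"] cobd_Ch[OF S i] by simp
    also have "\<dots> = 0"
      using y i by (simp add: annihilator_def Cobnd_def)
    finally show ?thesis .
  next
    case False
    with bd_Ch[OF SX y'] show ?thesis by (auto simp: Ch_def supported_def)
  qed
  then have "y' \<in> Cyc S p" using y' by (simp add: Cyc_def fun_eq_iff)
  with p that show thesis by blast
qed

section \<open>The isomorphism from homology to the dual of cohomology\<close>

definition hom_mod :: "int^'n \<Rightarrow> int \<Rightarrow> ('k, ('s \<Rightarrow> 'k) set) module" where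
  "hom_mod z d = quot_mod (fn_mod (Cyc (cells {} {} z) d)) (Bnd (cells {} {} z) d)"

text \<open>Indexed so as to be the cohomology at \<open>- z\<close>; its dual is then the value at
  \<open>z\<close> of the dual persistence module.\<close>

definition coh_mod :: "int^'n \<Rightarrow> int \<Rightarrow> ('k, ('s \<Rightarrow> 'k) set) module" where
  "coh_mod z p = quot_mod (fn_mod (Cocyc (cells UNIV {} z) p)) (Cobnd (cells UNIV {} z) p)"

definition evaluation :: "int^'n \<Rightarrow> int \<Rightarrow> ('s \<Rightarrow> 'k) \<Rightarrow> ('s \<Rightarrow> 'k) set \<Rightarrow> 'k" where
  "evaluation z p = functional X (Cocyc (cells UNIV {} z) p) (Cobnd (cells UNIV {} z) p)"

definition dual_iso :: "'n list \<Rightarrow> int \<Rightarrow> int^'n \<Rightarrow> ('s \<Rightarrow> 'k) set \<Rightarrow> ('s \<Rightarrow> 'k) set \<Rightarrow> 'k" where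
  "dual_iso js d z C =
    evaluation z (d + int (length js)) (SOME y. \<exists>x\<in>C. zigzag z d js x y)"

lemma evaluation_coset:
  assumes "y \<in> Cyc (cells UNIV {} z) p" "\<psi> \<in> Cocyc (cells UNIV {} z) p"
  shows "evaluation z p y (coset (Cobnd (cells UNIV {} z) p) \<psi>) = pairing X y \<psi>"
  unfolding evaluation_def
  by (rule functional_coset[OF Cobnd_subspace assms(2)])
    (rule pairing_Cyc_Cobnd[OF cells_subset assms(1)])

lemma evaluation_extensional: "evaluation z p y \<in> extensional (carrier (coh_mod z p))"
  by (simp add: evaluation_def functional_def coh_mod_def carrier_quot_mod)

lemma evaluation_eq_iff:
  assumes "y \<in> Cyc (cells UNIV {} z) p" "y' \<in> Cyc (cells UNIV {} z) p"
  shows "evaluation z p y = evaluation z p y' \<longleftrightarrow> y - y' \<in> Bnd (cells UNIV {} z) p"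
proof
  let ?S = "cells UNIV {} z"
  have d: "y - y' \<in> Ch ?S p"
    using fs.subspace_diff[OF Cyc_subspace assms] by (simp add: Cyc_def)
  have pd: "pairing X (y - y') \<psi> = pairing X y \<psi> - pairing X y' \<psi>" for \<psi>
    using pairing_add(1)[of X "y - y'" y' \<psi>] by simp
  show "y - y' \<in> Bnd ?S p" if e: "evaluation z p y = evaluation z p y'"
    using evaluation_coset[OF assms(1)] evaluation_coset[OF assms(2)] e
    by (intro Bnd_if_annihilates[OF up_closed_cells d]) (simp add: pd)
  show "evaluation z p y = evaluation z p y'" if b: "y - y' \<in> Bnd ?S p"
  proof (rule extensionalityI[OF evaluation_extensional evaluation_extensional])
    fix D assume "D \<in> carrier (coh_mod z p)"
    then obtain \<psi> where \<psi>: "\<psi> \<in> Cocyc ?S p" "D = coset (Cobnd ?S p) \<psi>"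
      by (auto simp: coh_mod_def carrier_quot_mod)
    have "pairing X (y - y') \<psi> = 0"
      by (rule pairing_Bnd_Cocyc[OF cells_subset b \<psi>(1)])
    then show "evaluation z p y D = evaluation z p y' D"
      using \<psi> assms by (simp add: evaluation_coset pd)
  qed
qed

lemma evaluation_in_dual:
  assumes "y \<in> Cyc (cells UNIV {} z) p"
  shows "evaluation z p y \<in> carrier (dual_mod (coh_mod z p))"
  unfolding evaluation_def coh_mod_def
  by (rule functional_in_dual[OF Cocyc_subspace Cobnd_subspace])
    (rule pairing_Cyc_Cobnd[OF cells_subset assms])

lemma evaluation_add: "evaluation z p (y + y') = evaluation z p y \<oplus>\<^bsub>dual_mod (coh_mod z p)\<^esub> evaluation z p y'"
  by (auto simp: evaluation_def functional_def dual_mod_simps coh_mod_def carrier_quot_mod pairing_add fun_eq_iff restrict_def)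

lemma evaluation_scale: "evaluation z p (fscale c y) = c \<odot>\<^bsub>dual_mod (coh_mod z p)\<^esub> evaluation z p y"
  by (auto simp: evaluation_def functional_def dual_mod_simps coh_mod_def carrier_quot_mod pairing_scale fun_eq_iff restrict_def)

context
  fixes z :: "int^'n" and js :: "'n list"
  assumes exact: "\<And>I. I \<noteq> {} \<Longrightarrow> exact (cells {} I z)"
    and js: "distinct js" "set js = UNIV"
begin

lemma zigzag_facts:
  shows "zigzag z d js x y \<Longrightarrow> x \<in> Cyc (cells {} {} z) d"
    and "zigzag z d js x y \<Longrightarrow> y \<in> Cyc (cells UNIV {} z) (d + int (length js))"
    and "zigzag z d js x y \<Longrightarrow>
      x \<in> Bnd (cells {} {} z) d \<longleftrightarrow> y \<in> Bnd (cells UNIV {} z) (d + int (length js))"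
    and "x \<in> Cyc (cells {} {} z) d \<Longrightarrow> \<exists>y. zigzag z d js x y"
    and "y \<in> Cyc (cells UNIV {} z) (d + int (length js)) \<Longrightarrow> \<exists>x. zigzag z d js x y"
    and "zigzag z d js x y \<Longrightarrow> zigzag z d js x' y' \<Longrightarrow> zigzag z d js (x + x') (y + y')"
    and "zigzag z d js x y \<Longrightarrow> zigzag z d js (fscale c x) (fscale c y)"
  using correspondence_zigzag[OF exact js(1), of d] unfolding correspondence_def js(2) by blast+

lemma zigzag_diff:
  assumes "zigzag z d js x y" "zigzag z d js x' y'"
  shows "zigzag z d js (x - x') (y - y')"
  using zigzag_facts(6)[OF assms(1) zigzag_facts(7)[OF assms(2), of "- 1"]]
  by (simp add: fun_diff_def fscale_def plus_fun_def)

text \<open>Differences of related pairs are related. Representatives of one class differ by a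
  boundary, so their partners do too, and evaluation on cohomology ignores boundaries.\<close>

lemma dual_iso_coset:
  assumes zz: "zigzag z d js x y"
  shows "dual_iso js d z (coset (Bnd (cells {} {} z) d) x) = evaluation z (d + int (length js)) y"
proof -
  let ?C = "coset (Bnd (cells {} {} z) d) x"
  have "\<exists>y. \<exists>x\<in>?C. zigzag z d js x y"
    using zz coset_self[OF Bnd_subspace, of x] by blast
  from someI_ex[OF this] obtain x' where
    x': "x' \<in> ?C" "zigzag z d js x' (SOME y. \<exists>x\<in>?C. zigzag z d js x y)" (is "zigzag z d js x' ?y")
    by blast
  have "?y - y \<in> Bnd (cells UNIV {} z) (d + int (length js))"
    using zigzag_facts(3)[OF zigzag_diff[OF x'(2) zz]] x'(1) by (simp add: coset_def)
  then show ?thesis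
    unfolding dual_iso_def using zigzag_facts(2)[OF x'(2)] zigzag_facts(2)[OF zz] by (simp add: evaluation_eq_iff)
qed

lemma hom_zigzag:
  assumes "C \<in> carrier (hom_mod z d)"
  obtains x y where "C = coset (Bnd (cells {} {} z) d) x" "zigzag z d js x y"
    "dual_iso js d z C = evaluation z (d + int (length js)) y"
  using assms zigzag_facts(4) dual_iso_coset unfolding hom_mod_def carrier_quot_mod by blast

lemma dual_iso_linear:
  "linear_map class_ring (hom_mod z d) (dual_mod (coh_mod z (d + int (length js)))) (dual_iso js d z)"
proof (rule linear_mapI)
  show "vectorspace class_ring (hom_mod z d)"
    unfolding hom_mod_def
    by (rule quot_mod_vectorspace[OF Cyc_subspace Cyc_supported[OF cells_subset] fin Bnd_subspace])
  show "vectorspace class_ring (dual_mod (coh_mod z (d + int (length js))))"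
    unfolding coh_mod_def
    by (rule dual_quot_mod_vectorspace[OF Cocyc_subspace Cocyc_supported[OF cells_subset] fin
          Cobnd_subspace Cobnd_subset_Cocyc[OF up_closed_cells]])
  fix C assume C: "C \<in> carrier (hom_mod z d)"
  then obtain x y where x: "C = coset (Bnd (cells {} {} z) d) x" "zigzag z d js x y"
    "dual_iso js d z C = evaluation z (d + int (length js)) y" by (rule hom_zigzag)
  show "dual_iso js d z C \<in> carrier (dual_mod (coh_mod z (d + int (length js))))"
    unfolding x(3) by (rule evaluation_in_dual[OF zigzag_facts(2)[OF x(2)]])
  show "dual_iso js d z (c \<odot>\<^bsub>hom_mod z d\<^esub> C) = c \<odot>\<^bsub>dual_mod (coh_mod z (d + int (length js)))\<^esub> dual_iso js d z C" for c
    using dual_iso_coset[OF zigzag_facts(7)[OF x(2), of c]]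
    by (simp add: x(1) dual_iso_coset[OF x(2)] hom_mod_def smult_quot_mod Bnd_subspace evaluation_scale)
  fix D assume "D \<in> carrier (hom_mod z d)"
  then obtain x' y' where x': "D = coset (Bnd (cells {} {} z) d) x'" "zigzag z d js x' y'"
    "dual_iso js d z D = evaluation z (d + int (length js)) y'" by (rule hom_zigzag)
  show "dual_iso js d z (C \<oplus>\<^bsub>hom_mod z d\<^esub> D) = dual_iso js d z C \<oplus>\<^bsub>dual_mod (coh_mod z (d + int (length js)))\<^esub> dual_iso js d z D"
    using dual_iso_coset[OF zigzag_facts(6)[OF x(2) x'(2)]]
    by (simp add: x(1) x'(1) dual_iso_coset[OF x(2)] dual_iso_coset[OF x'(2)] hom_mod_def add_quot_mod Bnd_subspace evaluation_add)
qed

lemma dual_iso_bij: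
  "bij_betw (dual_iso js d z) (carrier (hom_mod z d)) (carrier (dual_mod (coh_mod z (d + int (length js)))))"
  unfolding bij_betw_def
proof
  let ?p = "d + int (length js)"
  show "inj_on (dual_iso js d z) (carrier (hom_mod z d))"
  proof (rule inj_onI)
    fix C D assume CD: "C \<in> carrier (hom_mod z d)" "D \<in> carrier (hom_mod z d)"
      and eq: "dual_iso js d z C = dual_iso js d z D"
    from CD(1) obtain x y where x: "C = coset (Bnd (cells {} {} z) d) x" "zigzag z d js x y"
      "dual_iso js d z C = evaluation z ?p y" by (rule hom_zigzag)
    from CD(2) obtain x' y' where x': "D = coset (Bnd (cells {} {} z) d) x'" "zigzag z d js x' y'"
      "dual_iso js d z D = evaluation z ?p y'" by (rule hom_zigzag)
    have "y - y' \<in> Bnd (cells UNIV {} z) ?p"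
      using eq x(3) x'(3) evaluation_eq_iff[OF zigzag_facts(2)[OF x(2)] zigzag_facts(2)[OF x'(2)]] by simp
    then have "x - x' \<in> Bnd (cells {} {} z) d"
      using zigzag_facts(3)[OF zigzag_diff[OF x(2) x'(2)]] by simp
    then show "C = D" unfolding x(1) x'(1) by (rule coset_eqI[OF Bnd_subspace])
  qed
  show "dual_iso js d z ` carrier (hom_mod z d) = carrier (dual_mod (coh_mod z ?p))"
  proof
    show "dual_iso js d z ` carrier (hom_mod z d) \<subseteq> carrier (dual_mod (coh_mod z ?p))"
      using hom_zigzag evaluation_in_dual[OF zigzag_facts(2)] by (metis image_subsetI)
    show "carrier (dual_mod (coh_mod z ?p)) \<subseteq> dual_iso js d z ` carrier (hom_mod z d)"
    proof
      fix \<phi> assume \<phi>: "\<phi> \<in> carrier (dual_mod (coh_mod z ?p))"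
      let ?S = "cells UNIV {} z"
      obtain y where y: "y \<in> annihilator X (Cobnd ?S ?p)" "\<phi> = evaluation z ?p y"
        using ex_functional[OF Cocyc_subspace Cocyc_supported[OF cells_subset] fin Cobnd_subspace
            Cobnd_subset_Cocyc[OF up_closed_cells] \<phi>[unfolded coh_mod_def]]
        unfolding evaluation_def by blast
      \<comment> \<open>A function annihilating coboundaries need not be a cycle, and the zigzag
        relates cycles only; so it is replaced by a cycle with the same pairings.\<close>
      obtain y' where y': "y' \<in> Cyc ?S ?p" "\<And>\<psi>. \<psi> \<in> Ch ?S ?p \<Longrightarrow> pairing X y' \<psi> = pairing X y \<psi>"
        using ex_Cyc_pairing[OF up_closed_cells y(1)] by blast
      have "\<phi> = evaluation z ?p y'"
        unfolding y(2)
      proof (rule extensionalityI[OF evaluation_extensional evaluation_extensional])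
        fix D assume "D \<in> carrier (coh_mod z ?p)"
        then obtain \<psi> where \<psi>: "\<psi> \<in> Cocyc ?S ?p" "D = coset (Cobnd ?S ?p) \<psi>"
          by (auto simp: coh_mod_def carrier_quot_mod)
        have "evaluation z ?p y D = pairing X y \<psi>"
          unfolding \<psi>(2) evaluation_def using y(1)
          by (intro functional_coset[OF Cobnd_subspace \<psi>(1)]) (simp add: annihilator_def)
        with evaluation_coset[OF y'(1) \<psi>(1)] y'(2)[of \<psi>] \<psi> show "evaluation z ?p y D = evaluation z ?p y' D"
          by (simp add: Cocyc_def)
      qed
      moreover obtain x where x: "zigzag z d js x y'" using zigzag_facts(5)[OF y'(1)] by blast
      moreover have "coset (Bnd (cells {} {} z) d) x \<in> carrier (hom_mod z d)"
        using zigzag_facts(1)[OF x] by (simp add: hom_mod_def carrier_quot_mod)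
      ultimately show "\<phi> \<in> dual_iso js d z ` carrier (hom_mod z d)"
        using dual_iso_coset[OF x] by (metis imageI)
    qed
  qed
qed

end

end

section \<open>Naturality\<close>

text \<open>The main results go from level \<open>z\<close> of the source to a level
  \<open>w \<ge> z\<close> of the target. Induced maps are the case \<open>z = w\<close>, structure
  maps the case of the identity matrix.\<close>

locale graded_complex_map = K: graded_complex X g dm A + L: graded_complex Y h em B
  for X :: "'s set" and g :: "'s \<Rightarrow> int^'n::finite" and dm and A :: "'s \<Rightarrow> 's \<Rightarrow> 'k::field"
    and Y :: "'t set" and h :: "'t \<Rightarrow> int^'n" and em and B :: "'t \<Rightarrow> 't \<Rightarrow> 'k" +
  fixes m :: "'s \<Rightarrow> 't \<Rightarrow> 'k"
  assumes m_grade: "s \<in> X \<Longrightarrow> t \<in> Y \<Longrightarrow> m s t \<noteq> 0 \<Longrightarrow> h t \<le> g s"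
    and m_dim: "s \<in> X \<Longrightarrow> t \<in> Y \<Longrightarrow> m s t \<noteq> 0 \<Longrightarrow> em t = dm s"
    and m_chain: "s \<in> X \<Longrightarrow> t \<in> Y \<Longrightarrow> (\<Sum>r\<in>X. A s r * m r t) = (\<Sum>r\<in>Y. m s r * B r t)"
begin

definition img :: "'t set \<Rightarrow> ('s \<Rightarrow> 'k) \<Rightarrow> 't \<Rightarrow> 'k" where
  "img T x = rest T (mat_app X m x)"

definition coimg :: "('t \<Rightarrow> 'k) \<Rightarrow> 's \<Rightarrow> 'k" where
  "coimg \<psi> = rest X (mat_app Y (\<lambda>t s. m s t) \<psi>)"

lemma img_add: "img T (x + y) = img T x + img T y"
  by (simp add: img_def mat_app_add rest_add)

lemma img_scale: "img T (fscale c x) = fscale c (img T x)"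
  by (simp add: img_def mat_app_scale rest_scale)

lemma img_0 [simp]: "img T 0 = 0"
  using img_scale[of T 0 0] by simp

lemma img_diff: "img T (x - y) = img T x - img T y"
  using img_add[of T "x - y" y] by (simp add: algebra_simps)

lemma coimg_add: "coimg (x + y) = coimg x + coimg y"
  by (simp add: coimg_def mat_app_add rest_add)

lemma coimg_diff: "coimg (x - y) = coimg x - coimg y"
  using coimg_add[of "x - y" y] by (simp add: algebra_simps)

lemma img_cong:
  assumes "\<And>s t. s \<in> X \<Longrightarrow> x s \<noteq> 0 \<Longrightarrow> m s t \<noteq> 0 \<Longrightarrow> t \<in> T \<longleftrightarrow> t \<in> T'"
  shows "img T x = img T' x"
proof
  fix t
  have "mat_app X m x t = 0" if "\<not> (t \<in> T \<longleftrightarrow> t \<in> T')"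
    using that assms mat_app_nonzero[of X m x t] by metis
  then show "img T x t = img T' x t" by (auto simp: img_def rest_def)
qed

lemma img_Ch:
  assumes "T \<subseteq> Y" "x \<in> K.Ch S d"
  shows "img T x \<in> L.Ch T d"
  unfolding L.Ch_def supported_def
proof (intro CollectI allI impI)
  fix t assume t: "t \<notin> {\<sigma> \<in> T. em \<sigma> = d}"
  show "img T x t = 0"
  proof (rule ccontr)
    assume "img T x t \<noteq> 0"
    then have tT: "t \<in> T" and nz: "mat_app X m x t \<noteq> 0"
      by (auto simp: img_def rest_def split: if_splits)
    from nz obtain s where s: "s \<in> X" "m s t \<noteq> 0" "x s \<noteq> 0" by (rule mat_app_nonzero)
    then have "dm s = d" using assms(2) by (auto simp: K.Ch_def supported_def)
    with m_dim[OF s(1) _ s(2)] tT t assms(1) show False by auto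
  qed
qed

lemma mat_app_chain:
  "t \<in> Y \<Longrightarrow> mat_app X m (mat_app X A x) t = mat_app Y B (mat_app X m x) t"
  unfolding mat_app_mat_app by (simp add: mat_app_def m_chain)

text \<open>Grades of intermediate simplices are squeezed between those of the ends: in the
  coordinates in \<open>J\<close> they exceed \<open>w\<close>, hence \<open>z\<close>, and outside
  of \<open>J\<close> and \<open>I\<close> they are at most \<open>z\<close>, hence at most
  \<open>w\<close>. So neither inner truncation removes anything relevant.\<close>

lemma img_bd:
  assumes zw: "z \<le> w" and x: "x \<in> supported (K.cells J I z)"
  shows "img (L.cells J I w) (K.bd (K.cells J I z) x) = L.bd (L.cells J I w) (img (L.cells J I w) x)"
proof -
  let ?S = "K.cells J I z" and ?T = "L.cells J I w"
  note le = zw[unfolded Finite_Cartesian_Product.less_eq_vec_def, rule_format]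
  have "rest ?T (mat_app X m (rest ?S (mat_app X A x))) = rest ?T (mat_app X m (mat_app X A x))"
  proof (rule rest_mat_app_rest)
    fix s t assume s: "s \<in> X" "t \<in> ?T" "m s t \<noteq> 0" "mat_app X A x s \<noteq> 0"
    from s(4) obtain r where r: "r \<in> X" "A r s \<noteq> 0" "x r \<noteq> 0" by (rule mat_app_nonzero)
    then have rS: "r \<in> ?S" using x by (auto simp: supported_def)
    have tY: "t \<in> Y" using s(2) L.cells_subset by blast
    have "h t \<le> g s" "g s \<le> g r" using m_grade[OF s(1) tY s(3)] K.A_grade[OF r(1) s(1) r(2)] .
    then have 1: "h t $ j \<le> g s $ j" "g s $ j \<le> g r $ j" for j
      by (simp_all add: Finite_Cartesian_Product.less_eq_vec_def)
    show "s \<in> ?S"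
      unfolding K.cells_def
    proof (intro CollectI conjI ballI allI impI s(1))
      show "z $ j < g s $ j" if "j \<in> J" for j
        using s(2) that 1(1)[of j] le[of j] by (fastforce simp: L.cells_def)
      show "g s $ j \<le> z $ j" if "j \<notin> J" "j \<notin> I" for j
        using rS that 1(2)[of j] by (fastforce simp: K.cells_def)
    qed
  qed
  also have "\<dots> = rest ?T (mat_app Y B (mat_app X m x))"
    using L.cells_subset[of J I w] by (auto simp: rest_def fun_eq_iff mat_app_chain subset_iff)
  also have "\<dots> = rest ?T (mat_app Y B (rest ?T (mat_app X m x)))"
  proof (rule rest_mat_app_rest[symmetric])
    fix s t assume s: "s \<in> Y" "t \<in> ?T" "B s t \<noteq> 0" "mat_app X m x s \<noteq> 0"
    from s(4) obtain r where r: "r \<in> X" "m r s \<noteq> 0" "x r \<noteq> 0" by (rule mat_app_nonzero)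
    then have rS: "r \<in> ?S" using x by (auto simp: supported_def)
    have tY: "t \<in> Y" using s(2) L.cells_subset by blast
    have "h t \<le> h s" "h s \<le> g r" using L.A_grade[OF s(1) tY s(3)] m_grade[OF r(1) s(1) r(2)] .
    then have 1: "h t $ j \<le> h s $ j" "h s $ j \<le> g r $ j" for j
      by (simp_all add: Finite_Cartesian_Product.less_eq_vec_def)
    show "s \<in> ?T"
      unfolding L.cells_def
    proof (intro CollectI conjI ballI allI impI s(1))
      show "w $ j < h s $ j" if "j \<in> J" for j
        using s(2) that 1(1)[of j] by (fastforce simp: L.cells_def)
      show "h s $ j \<le> w $ j" if "j \<notin> J" "j \<notin> I" for j
        using rS that 1(2)[of j] le[of j] by (fastforce simp: K.cells_def)
    qed
  qed
  finally show ?thesis by (simp add: img_def K.bd_def L.bd_def)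
qed

lemma connect_map:
  assumes zw: "z \<le> w" and i: "i \<notin> J" "i \<notin> I"
    and c: "K.connect (K.cells J I z) (K.cells J (insert i I) z) (K.cells (insert i J) I z) d x y"
  shows "L.connect (L.cells J I w) (L.cells J (insert i I) w) (L.cells (insert i J) I w) d
    (img (L.cells J I w) x) (img (L.cells (insert i J) I w) y)"
proof -
  let ?S1 = "K.cells J I z" and ?S = "K.cells J (insert i I) z" and ?S2 = "K.cells (insert i J) I z"
  let ?T1 = "L.cells J I w" and ?T = "L.cells J (insert i I) w" and ?T2 = "L.cells (insert i J) I w"
  obtain u where u: "x \<in> supported ?S1" "u \<in> K.Ch ?S (d + 1)" "K.bd ?S u = x" "rest ?S2 u = y"
    using c by (auto simp: K.connect_def)
  note le = zw[unfolded Finite_Cartesian_Product.less_eq_vec_def, rule_format, of i]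
  have gr: "h t $ i \<le> g s $ i" if "s \<in> X" "t \<in> Y" "m s t \<noteq> 0" for s t
    using m_grade[OF that] by (simp add: Finite_Cartesian_Product.less_eq_vec_def)
  have "L.bd ?T (img ?T u) = img ?T x"
    using img_bd[OF zw K.Ch_supported[OF u(2)]] u(3) by simp
  \<comment> \<open>In coordinate \<open>i\<close>, the support of \<open>x\<close> is at most
    \<open>z\<close>, and so its image is at most \<open>w\<close>.\<close>
  also have "img ?T x = img ?T1 x"
  proof (rule img_cong)
    fix s t assume s: "s \<in> X" "x s \<noteq> 0" "m s t \<noteq> 0"
    then have "g s $ i \<le> z $ i" using u(1) i by (auto simp: supported_def K.cells_def)
    with gr[OF s(1) _ s(3)] le show "t \<in> ?T \<longleftrightarrow> t \<in> ?T1"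
      using i by (fastforce simp: L.cells_def)
  qed
  finally have 1: "L.bd ?T (img ?T u) = img ?T1 x" .
  have "rest ?T2 (img ?T u) = img ?T2 u"
    using L.cells_step(1)[OF i] by (simp add: img_def rest_rest)
  \<comment> \<open>The part of \<open>u\<close> that is at most \<open>z\<close> in coordinate
    \<open>i\<close> has no image above \<open>w\<close> there.\<close>
  also have "\<dots> = img ?T2 y"
    unfolding img_def u(4)[symmetric]
  proof (rule rest_mat_app_rest[symmetric])
    fix s t assume s: "s \<in> X" "t \<in> ?T2" "m s t \<noteq> 0" "u s \<noteq> 0"
    then have "s \<in> ?S" using K.Ch_supported[OF u(2)] by (auto simp: supported_def)
    moreover have "z $ i < g s $ i"
      using s(2) gr[OF s(1) _ s(3)] le by (fastforce simp: L.cells_def)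
    ultimately show "s \<in> ?S2" using i by (auto simp: K.cells_def)
  qed
  finally have 2: "rest ?T2 (img ?T u) = img ?T2 y" .
  have "img ?T u \<in> L.Ch ?T (d + 1)" by (rule img_Ch[OF L.cells_subset u(2)])
  moreover have "img ?T1 x \<in> supported ?T1" by (simp add: img_def rest_def supported_def)
  ultimately show ?thesis using 1 2 unfolding L.connect_def by blast
qed

lemma img_Cyc:
  assumes "z \<le> w" "x \<in> K.Cyc (K.cells J I z) d"
  shows "img (L.cells J I w) x \<in> L.Cyc (L.cells J I w) d"
proof -
  from assms(2) have x: "x \<in> K.Ch (K.cells J I z) d" "K.bd (K.cells J I z) x = 0"
    by (simp_all add: K.Cyc_def)
  from img_bd[OF assms(1) K.Ch_supported[OF x(1)]] x(2) img_Ch[OF L.cells_subset x(1)] show ?thesis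
    by (simp add: L.Cyc_def)
qed

lemma img_Bnd:
  assumes "z \<le> w" "x \<in> K.Bnd (K.cells J I z) d"
  shows "img (L.cells J I w) x \<in> L.Bnd (L.cells J I w) d"
proof -
  from assms(2) obtain v where v: "v \<in> K.Ch (K.cells J I z) (d + 1)" "x = K.bd (K.cells J I z) v"
    by (auto simp: K.Bnd_def)
  from img_bd[OF assms(1) K.Ch_supported[OF v(1)]] img_Ch[OF L.cells_subset v(1)] show ?thesis
    unfolding v(2) L.Bnd_def by blast
qed

lemma zigzag_map:
  assumes "z \<le> w" "distinct js" "K.zigzag z d js x y"
  shows "L.zigzag w d js (img (L.cells {} {} w) x) (img (L.cells (set js) {} w) y)"
  using assms(2,3)
proof (induction js arbitrary: y)
  case Nil
  with img_Cyc[OF assms(1)] show ?case by auto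
next
  case (Cons j js)
  then obtain v where v: "K.zigzag z d js x v"
    "K.connect (K.cells (set js) {} z) (K.cells (set js) {j} z) (K.cells (insert j (set js)) {} z)
      (d + int (length js)) v y" by auto
  have "L.zigzag w d js (img (L.cells {} {} w) x) (img (L.cells (set js) {} w) v)"
    using Cons.IH[OF _ v(1)] Cons.prems(1) by simp
  moreover have "L.connect (L.cells (set js) {} w) (L.cells (set js) {j} w)
      (L.cells (insert j (set js)) {} w) (d + int (length js))
      (img (L.cells (set js) {} w) v) (img (L.cells (insert j (set js)) {} w) y)"
    using connect_map[OF assms(1) _ _ v(2)] Cons.prems(1) by simp
  ultimately show ?case by auto
qed

lemma coimg_Ch:
  assumes zw: "z \<le> w" and \<psi>: "\<psi> \<in> L.Ch (L.cells UNIV {} w) p"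
  shows "coimg \<psi> \<in> K.Ch (K.cells UNIV {} z) p"
  unfolding K.Ch_def supported_def
proof (intro CollectI allI impI)
  fix s assume s: "s \<notin> {\<sigma> \<in> K.cells UNIV {} z. dm \<sigma> = p}"
  show "coimg \<psi> s = 0"
  proof (rule ccontr)
    assume "coimg \<psi> s \<noteq> 0"
    then have sX: "s \<in> X" and nz: "mat_app Y (\<lambda>t s. m s t) \<psi> s \<noteq> 0"
      by (auto simp: coimg_def rest_def split: if_splits)
    from nz obtain t where t: "t \<in> Y" "m s t \<noteq> 0" "\<psi> t \<noteq> 0" by (rule mat_app_nonzero)
    then have tc: "t \<in> L.cells UNIV {} w" "em t = p" using \<psi> by (auto simp: L.Ch_def supported_def)
    have "dm s = p" using m_dim[OF sX t(1,2)] tc(2) by simp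
    moreover have "z $ j < g s $ j" for j
    proof -
      have "z $ j \<le> w $ j" "h t $ j \<le> g s $ j"
        using zw m_grade[OF sX t(1,2)] by (simp_all add: Finite_Cartesian_Product.less_eq_vec_def)
      moreover have "w $ j < h t $ j" using tc(1) by (simp add: L.cells_def)
      ultimately show ?thesis by linarith
    qed
    ultimately show False using s sX by (simp add: K.cells_def)
  qed
qed

lemma coimg_cobd:
  "coimg (L.cobd \<psi>) = K.cobd (coimg \<psi>)"
proof
  fix s
  show "coimg (L.cobd \<psi>) s = K.cobd (coimg \<psi>) s"
  proof (cases "s \<in> X")
    case True
    have "coimg (L.cobd \<psi>) s = mat_app Y (\<lambda>t s. m s t) (mat_app Y (\<lambda>\<tau> \<sigma>. B \<sigma> \<tau>) \<psi>) s"
      using True by (auto simp: coimg_def L.cobd_def rest_def mat_app_def intro!: sum.cong)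
    also have "\<dots> = (\<Sum>t\<in>Y. (\<Sum>r\<in>Y. m s r * B r t) * \<psi> t)"
      unfolding mat_app_mat_app by (simp add: mat_app_def mult.commute)
    also have "\<dots> = (\<Sum>t\<in>Y. (\<Sum>r\<in>X. A s r * m r t) * \<psi> t)"
      using m_chain[OF True] by (intro sum.cong) simp_all
    also have "\<dots> = mat_app X (\<lambda>\<tau> \<sigma>. A \<sigma> \<tau>) (mat_app Y (\<lambda>t s. m s t) \<psi>) s"
      unfolding mat_app_mat_app by (simp add: mat_app_def mult.commute)
    also have "\<dots> = K.cobd (coimg \<psi>) s"
      using True by (auto simp: coimg_def K.cobd_def rest_def mat_app_def intro!: sum.cong)
    finally show ?thesis .
  qed (simp add: coimg_def K.cobd_def rest_def)
qed

lemma coimg_0 [simp]: "coimg 0 = 0"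
  using coimg_diff[of 0 0] by simp

lemma coimg_Cocyc:
  "z \<le> w \<Longrightarrow> \<psi> \<in> L.Cocyc (L.cells UNIV {} w) p \<Longrightarrow> coimg \<psi> \<in> K.Cocyc (K.cells UNIV {} z) p"
  using coimg_Ch[of z w \<psi> p] coimg_cobd[of \<psi>] by (simp add: L.Cocyc_def K.Cocyc_def)

lemma coimg_Cobnd:
  "z \<le> w \<Longrightarrow> \<psi> \<in> L.Cobnd (L.cells UNIV {} w) p \<Longrightarrow> coimg \<psi> \<in> K.Cobnd (K.cells UNIV {} z) p"
  using coimg_Ch[of z w _ "p - 1"] coimg_cobd by (auto simp: L.Cobnd_def K.Cobnd_def)

text \<open>The zigzag of the image is the image of the zigzag; what is left is that
  \<open>img\<close> and \<open>coimg\<close> are adjoint for the pairing.\<close>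

lemma dual_iso_map:
  assumes zw: "z \<le> w"
    and ex: "\<And>I. I \<noteq> {} \<Longrightarrow> K.exact (K.cells {} I z)" "\<And>I. I \<noteq> {} \<Longrightarrow> L.exact (L.cells {} I w)"
    and js: "distinct js" "set js = UNIV"
    and x: "x \<in> K.Cyc (K.cells {} {} z) d"
    and \<psi>: "\<psi> \<in> L.Cocyc (L.cells UNIV {} w) (d + int (length js))"
  shows "L.dual_iso js d w (coset (L.Bnd (L.cells {} {} w) d) (img (L.cells {} {} w) x))
      (coset (L.Cobnd (L.cells UNIV {} w) (d + int (length js))) \<psi>) =
    K.dual_iso js d z (coset (K.Bnd (K.cells {} {} z) d) x)
      (coset (K.Cobnd (K.cells UNIV {} z) (d + int (length js))) (coimg \<psi>))"
proof -
  let ?p = "d + int (length js)"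
  obtain y where y: "K.zigzag z d js x y" using K.zigzag_facts(4)[OF ex(1) js x] by blast
  have y': "L.zigzag w d js (img (L.cells {} {} w) x) (img (L.cells UNIV {} w) y)"
    using zigzag_map[OF zw js(1) y] js(2) by simp
  have yc: "y \<in> K.Cyc (K.cells UNIV {} z) ?p" by (rule K.zigzag_facts(2)[OF ex(1) js y])
  have yX: "y \<in> supported X" using yc K.Cyc_supported[OF K.cells_subset] by blast
  have \<psi>s: "\<psi> \<in> supported (L.cells UNIV {} w)"
    using \<psi> L.Ch_supported by (auto simp: L.Cocyc_def)
  have "pairing Y (img (L.cells UNIV {} w) y) \<psi> = pairing X y (coimg \<psi>)"
    by (simp add: img_def coimg_def pairing_rest[OF \<psi>s] pairing_mat_app pairing_rest_right[OF yX])
  then show ?thesis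
    by (simp add: K.dual_iso_coset[OF ex(1) js y] L.dual_iso_coset[OF ex(2) js y']
        K.evaluation_coset[OF yc coimg_Cocyc[OF zw \<psi>]]
        L.evaluation_coset[OF L.zigzag_facts(2)[OF ex(2) js y'] \<psi>])
qed

end

section \<open>Filtrations\<close>

lemma dim_0_carrier:
  assumes "vectorspace F V" "vectorspace.fin_dim F V" "vectorspace.dim F V = 0"
  shows "carrier V = {\<zero>\<^bsub>V\<^esub>}"
proof -
  interpret vectorspace F V by fact
  obtain \<beta> where \<beta>: "finite \<beta>" "basis \<beta>" using finite_basis_exists[OF assms(2)] by blast
  then have "\<beta> = {}" using dim_basis[of \<beta>] assms(3) by simp
  with \<beta>(2) show ?thesis by (simp add: basis_def span_empty)
qed

lemma infsum_enat_infinite: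
  fixes f :: "'a \<Rightarrow> enat"
  assumes "infinite S" "\<And>x. x \<in> S \<Longrightarrow> f x \<noteq> 0"
  shows "infsum f UNIV = \<infinity>"
proof -
  have "infsum f S = \<infinity>"
    using assms(2) by (intro infsum_superconst_infinite_enat[of S 1] assms(1))
      (auto simp: one_eSuc ileI1 eSuc_ile_mono zero_less_iff_neq_zero)
  moreover have "infsum f S \<le> infsum f UNIV"
    by (rule infsum_mono_neutral) auto
  ultimately show ?thesis by simp
qed

lemma fn_mod_carrier_update: "(fn_mod U)\<lparr>carrier := V\<rparr> = fn_mod V"
  by (simp add: fn_mod_def)

text \<open>Finiteness of homology depends on the scalars, which do not occur in the types of
  \<open>K\<close> and \<open>ori\<close>; hence the type argument.\<close>

locale finite_homology =
  fixes field_type :: "'k::field itself" and K :: "int^'n::finite \<Rightarrow> 'v set set"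
    and ori :: "'v set \<Rightarrow> 'v list"
  assumes finite_homology: "finite_homology_filtration TYPE('k) K ori"
begin

lemma down_K: "\<sigma> \<in> K z \<Longrightarrow> \<tau> \<subseteq> \<sigma> \<Longrightarrow> \<tau> \<in> K z"
  using finite_homology
  unfolding finite_homology_filtration_def simplicial_filtration_def simplicial_complex_def by blast

lemma down_X: "\<sigma> \<in> total_complex K \<Longrightarrow> \<tau> \<subseteq> \<sigma> \<Longrightarrow> \<tau> \<in> total_complex K"
  using down_K unfolding total_complex_def by blast

lemma fin_X: "finite (total_complex K)"
  and ori_X: "\<sigma> \<in> total_complex K \<Longrightarrow> distinct (ori \<sigma>) \<and> set (ori \<sigma>) = \<sigma>"
  using finite_homology
  by (auto simp: finite_homology_filtration_def finite_filtration_def orientation_def)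

lemma mem_iff_grade_le:
  assumes "\<sigma> \<in> total_complex K"
  shows "\<sigma> \<in> K z \<longleftrightarrow> grade K \<sigma> \<le> z"
proof -
  obtain g where g: "\<sigma> \<in> K g" "\<And>z. \<sigma> \<in> K z \<Longrightarrow> g \<le> z"
    using finite_homology assms by (auto simp: finite_homology_filtration_def one_critical_def)
  have "grade K \<sigma> = g"
    unfolding grade_def by (rule Least_equality) (fact g)+
  moreover have "K g \<subseteq> K z" if "g \<le> z"
    using finite_homology that by (simp add: finite_homology_filtration_def simplicial_filtration_def)
  ultimately show ?thesis using g by blast
qed

sublocale graded_complex "total_complex K" "grade K" "\<lambda>\<sigma>. int (card \<sigma>) - 1"
  "\<lambda>\<sigma> \<tau>. of_int (incidence ori \<sigma> \<tau>) :: 'k"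
proof
  show "finite (total_complex K)" by (fact fin_X)
  fix \<sigma> assume \<sigma>: "\<sigma> \<in> total_complex K"
  show "grade K \<tau> \<le> grade K \<sigma>" "int (card \<sigma>) - 1 = int (card \<tau>) - 1 + 1"
    if "\<tau> \<in> total_complex K" "of_int (incidence ori \<sigma> \<tau>) \<noteq> (0 :: 'k)" for \<tau>
  proof -
    from that(2) have "incidence ori \<sigma> \<tau> \<noteq> 0" by auto
    note inc = incidence_nonzero[OF this ori_X[OF \<sigma>, THEN conjunct1] ori_X[OF \<sigma>, THEN conjunct2]]
    show "int (card \<sigma>) - 1 = int (card \<tau>) - 1 + 1" using inc(2) by simp
    have "\<sigma> \<in> K (grade K \<sigma>)" using mem_iff_grade_le[OF \<sigma>] by simp
    then have "\<tau> \<in> K (grade K \<sigma>)" using down_K inc(1) by blast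
    then show "grade K \<tau> \<le> grade K \<sigma>" using mem_iff_grade_le[OF that(1)] by simp
  qed
  show "(\<Sum>\<tau>\<in>total_complex K. of_int (incidence ori \<sigma> \<tau>) * of_int (incidence ori \<tau> \<rho>)) = (0 :: 'k)"
    if "\<rho> \<in> total_complex K" for \<rho>
    using incidence_incidence[OF fin_X down_X ori_X \<sigma> that]
    by (simp flip: of_int_mult of_int_sum)
qed

section \<open>Homology and cohomology of a filtration as those of truncated complexes\<close>

lemma cells_le: "\<sigma> \<in> cells {} {} z \<longleftrightarrow> \<sigma> \<in> total_complex K \<and> grade K \<sigma> \<le> z"
  by (auto simp: cells_def Finite_Cartesian_Product.less_eq_vec_def)

text \<open>Here the shift by \<open>1\<close> in the cochain modules becomes a strict inequality
  between integers.\<close>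

lemma cells_gt: "\<sigma> \<in> cells UNIV {} (- u) \<longleftrightarrow> \<sigma> \<in> total_complex K \<and> - grade K \<sigma> + 1 \<le> u"
proof -
  have "- u $ j < grade K \<sigma> $ j \<longleftrightarrow> - grade K \<sigma> $ j + 1 \<le> u $ j" for j by linarith
  then show ?thesis by (auto simp: cells_def Finite_Cartesian_Product.less_eq_vec_def)
qed

lemma free_sum_eq:
  assumes S: "\<And>\<sigma>. \<sigma> \<in> S \<longleftrightarrow> \<sigma> \<in> total_complex K \<and> \<gamma> \<sigma> \<le> z"
  shows "obj (dsum_pmod (simplices K d) (\<lambda>\<sigma>. free_pmod (\<gamma> \<sigma>))) z = fn_mod (Ch S d)"
proof -
  have "finite {i. f i \<noteq> (0 :: 'k)}" if "\<forall>i. i \<notin> simplices K d \<longrightarrow> f i = 0" for f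
  proof (rule finite_subset)
    show "{i. f i \<noteq> 0} \<subseteq> total_complex K" using that by (auto simp: simplices_def)
  qed (rule fin_X)
  then have "{f. (\<forall>i\<in>simplices K d. f i \<in> (if \<gamma> i \<le> z then UNIV else {0})) \<and>
      (\<forall>i. i \<notin> simplices K d \<longrightarrow> f i = 0) \<and> finite {i. f i \<noteq> (0 :: 'k)}} = Ch S d"
    by (auto simp: Ch_def supported_def S simplices_def split: if_splits)
  then show ?thesis
    by (simp add: dsum_pmod_def dsum_mod_def free_pmod_def field_mod_def fn_mod_def)
qed

lemma obj_chains: "obj (chains K d) z = fn_mod (Ch (cells {} {} z) d)"
  unfolding chains_def by (rule free_sum_eq[OF cells_le])

lemma obj_cochains: "obj (cochains K p) u = fn_mod (Ch (cells UNIV {} (- u)) p)"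
  unfolding cochains_def by (rule free_sum_eq[OF cells_gt])

lemma arr_chains: "arr (chains K d) z w = (\<lambda>x. x)" "arr (cochains K d) z w = (\<lambda>x. x)"
  by (simp_all add: chains_def cochains_def dsum_pmod_def free_pmod_def)

lemma sum_simplices:
  assumes "x \<in> Ch S d"
  shows "(\<Sum>s\<in>simplices K d. f s * x s) = (\<Sum>s\<in>total_complex K. f s * x s)"
  using assms by (intro sum.mono_neutral_left fin_X) (auto simp: simplices_def Ch_def supported_def)

text \<open>One side truncates by dimension, the other by grade; a nonzero coefficient on a chain at
  \<open>z\<close> of degree \<open>d\<close> forces both conditions.\<close>

lemma boundary_eq:
  assumes x: "x \<in> Ch (cells {} {} z) d"
  shows "boundary K ori d z x = bd (cells {} {} z) x"
proof
  fix t
  let ?S = "cells {} {} z"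
  have "boundary K ori d z x t = (if t \<in> simplices K (d - 1) then mat_app (total_complex K)
      (\<lambda>\<sigma> \<tau>. of_int (incidence ori \<sigma> \<tau>)) x t else 0)"
    by (simp add: boundary_def matrix_map_def mat_app_def sum_simplices[OF x])
  also have "\<dots> = bd ?S x t"
  proof (cases "mat_app (total_complex K) (\<lambda>\<sigma> \<tau>. of_int (incidence ori \<sigma> \<tau>)) x t = 0")
    case True
    then show ?thesis by (simp add: bd_def rest_def)
  next
    case False
    then obtain s where s: "s \<in> total_complex K" "of_int (incidence ori s t) \<noteq> (0 :: 'k)" "x s \<noteq> 0"
      by (rule mat_app_nonzero)
    then have sS: "s \<in> ?S" "int (card s) - 1 = d" using x by (auto simp: Ch_def supported_def)
    show ?thesis
    proof (cases "t \<in> total_complex K")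
      case True
      with A_grade[OF s(1) _ s(2)] A_dim[OF s(1) _ s(2)] sS
      show ?thesis by (auto simp: bd_def rest_def simplices_def cells_le)
    qed (auto simp: bd_def rest_def simplices_def cells_le)
  qed
  finally show "boundary K ori d z x t = bd ?S x t" .
qed

lemma coboundary_eq:
  assumes x: "x \<in> Ch S d"
  shows "coboundary K ori d u x = cobd x"
proof
  fix t
  have "coboundary K ori d u x t = (if t \<in> simplices K (d + 1) then mat_app (total_complex K)
      (\<lambda>\<tau> \<sigma>. of_int (incidence ori \<sigma> \<tau>)) x t else 0)"
    by (simp add: coboundary_def matrix_map_def mat_app_def sum_simplices[OF x])
  also have "\<dots> = cobd x t"
  proof (cases "mat_app (total_complex K) (\<lambda>\<tau> \<sigma>. of_int (incidence ori \<sigma> \<tau>)) x t = 0")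
    case True
    then show ?thesis by (simp add: cobd_def rest_def)
  next
    case False
    then obtain s where s: "s \<in> total_complex K" "of_int (incidence ori t s) \<noteq> (0 :: 'k)" "x s \<noteq> 0"
      by (rule mat_app_nonzero)
    then have "int (card s) - 1 = d" using x by (auto simp: Ch_def supported_def)
    with A_dim[OF _ s(1,2)] show ?thesis
      by (auto simp: cobd_def rest_def simplices_def)
  qed
  finally show "coboundary K ori d u x t = cobd x t" .
qed

lemma ker_chains:
  "ker_mod (chains K d) (chains K (d - 1)) (boundary K ori d) z = fn_mod (Cyc (cells {} {} z) d)"
  by (auto simp: ker_mod_def obj_chains fn_mod_carrier_update Cyc_def boundary_eq
      intro!: arg_cong[of _ _ fn_mod])

lemma ker_cochains:
  "ker_mod (cochains K p) (cochains K (p + 1)) (coboundary K ori p) u =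
    fn_mod (Cocyc (cells UNIV {} (- u)) p)"
  by (auto simp: ker_mod_def obj_cochains fn_mod_carrier_update Cocyc_def coboundary_eq
      intro!: arg_cong[of _ _ fn_mod])

lemma im_chains:
  "boundary K ori (d + 1) z ` carrier (obj (chains K (d + 1)) z) = Bnd (cells {} {} z) d"
  unfolding Bnd_def obj_chains fn_mod_simps by (rule image_cong) (simp_all add: boundary_eq)

lemma im_cochains:
  "coboundary K ori (p - 1) u ` carrier (obj (cochains K (p - 1)) u) = Cobnd (cells UNIV {} (- u)) p"
  unfolding Cobnd_def obj_cochains fn_mod_simps by (rule image_cong) (simp_all add: coboundary_eq)

lemma obj_homology: "obj (homology K ori d) z = hom_mod z d"
  unfolding homology_def homology_pmod_def pmod.simps ker_chains im_chains hom_mod_def ..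

lemma obj_cohomology: "obj (cohomology K ori p) u = coh_mod (- u) p"
  unfolding cohomology_def homology_pmod_def pmod.simps ker_cochains im_cochains coh_mod_def ..

lemma arr_homology: "arr (homology K ori d) z w =
    quot_map (fn_mod (Cyc (cells {} {} w) d)) (Bnd (cells {} {} w) d) (\<lambda>x. x)"
  unfolding homology_def homology_pmod_def pmod.simps ker_chains im_chains arr_chains ..

lemma arr_cohomology: "arr (cohomology K ori p) u v =
    quot_map (fn_mod (Cocyc (cells UNIV {} (- v)) p)) (Cobnd (cells UNIV {} (- v)) p) (\<lambda>x. x)"
  unfolding cohomology_def homology_pmod_def pmod.simps ker_cochains im_cochains arr_chains ..

text \<open>Along a direction in which only the coordinates in \<open>I\<close> grow, the homology is eventually constant,
  so it must vanish.\<close>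

lemma exact_far:
  assumes I: "I \<noteq> {}"
  shows "exact (cells {} I z)"
proof (rule ccontr)
  let ?S = "cells {} I z"
  assume "\<not> exact ?S"
  then obtain d x where x: "x \<in> Cyc ?S d" "x \<notin> Bnd ?S d" by (auto simp: exact_def)
  \<comment> \<open>For a void complex this is the maximum of the empty set, but then there is no
    grade to be bounded.\<close>
  obtain b where b: "\<And>\<sigma> i. \<sigma> \<in> total_complex K \<Longrightarrow> grade K \<sigma> $ i \<le> b"
  proof
    show "grade K \<sigma> $ i \<le> Max ((\<lambda>(\<sigma>, i). grade K \<sigma> $ i) ` (total_complex K \<times> UNIV))"
      if "\<sigma> \<in> total_complex K" for \<sigma> i
      using that fin_X by (intro Max_ge) (auto intro!: image_eqI[of _ _ "(\<sigma>, i)"])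
  qed
  \<comment> \<open>These degrees lie beyond every grade in the coordinates in \<open>I\<close>, so
    all of them see the same cells; they are pairwise different because \<open>I\<close> is
    nonempty.\<close>
  define far :: "nat \<Rightarrow> int^'n" where "far N = (\<chi> i. if i \<in> I then b + int N else z $ i)" for N
  have cells: "cells {} {} (far N) = ?S" for N
  proof -
    have "grade K \<sigma> $ i \<le> b + int N" if "\<sigma> \<in> total_complex K" for \<sigma> i
      using b[OF that, of i] by simp
    then show ?thesis by (auto simp: cells_def far_def)
  qed
  have "inj far"
  proof (rule injI)
    fix M N assume "far M = far N"
    then have "far M $ i = far N $ i" for i by simp
    moreover obtain i where "i \<in> I" using I by blast
    ultimately show "M = N" by (simp add: far_def split: if_splits) (metis add_left_imp_eq of_nat_eq_iff)
  qed
  then have inf: "infinite (range far)" using finite_imageD by blast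
  have "vectorspace.dim class_ring (hom_mod (far N) d) \<noteq> 0" for N
  proof
    assume 0: "vectorspace.dim class_ring (hom_mod (far N) d) = 0"
    note v = quot_mod_vectorspace[OF Cyc_subspace Cyc_supported[OF cells_subset] fin_X Bnd_subspace]
    have "carrier (hom_mod (far N) d) = {\<zero>\<^bsub>hom_mod (far N) d\<^esub>}"
      using 0 unfolding hom_mod_def by (rule dim_0_carrier[OF v])
    moreover have "coset (Bnd ?S d) x \<in> carrier (hom_mod (far N) d)"
      using x(1) by (simp add: hom_mod_def cells carrier_quot_mod)
    ultimately have "coset (Bnd ?S d) x = coset (Bnd ?S d) 0"
      by (simp add: hom_mod_def cells zero_quot_mod[OF Bnd_subspace])
    with x(2) show False by (simp add: coset_eq_iff[OF Bnd_subspace])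
  qed
  then have "total_dim (homology K ori d :: ('k, ('v set \<Rightarrow> 'k) set, 'n) pmod) = \<infinity>"
    unfolding total_dim_def obj_homology
    by (intro infsum_enat_infinite[OF inf]) (auto simp: zero_enat_def)
  moreover have "total_dim (homology K ori d :: ('k, ('v set \<Rightarrow> 'k) set, 'n) pmod) < \<infinity>"
    using finite_homology unfolding finite_homology_filtration_def by blast
  ultimately show False by simp
qed

text \<open>Structure maps are the case of the identity chain map between different degrees \<open>z \<le> w\<close>.\<close>

sublocale self: graded_complex_map "total_complex K" "grade K" "\<lambda>\<sigma>. int (card \<sigma>) - 1"
  "\<lambda>\<sigma> \<tau>. of_int (incidence ori \<sigma> \<tau>) :: 'k" "total_complex K" "grade K"
  "\<lambda>\<sigma>. int (card \<sigma>) - 1" "\<lambda>\<sigma> \<tau>. of_int (incidence ori \<sigma> \<tau>)" "\<lambda>s t. if s = t then 1 else 0"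
proof
  fix s t assume "s \<in> total_complex K" "t \<in> total_complex K"
  then show "(\<Sum>r\<in>total_complex K. of_int (incidence ori s r) * (if r = t then 1 else 0)) =
      (\<Sum>r\<in>total_complex K. (if s = r then 1 else 0) * of_int (incidence ori r t) :: 'k)"
    using fin_X by (simp add: if_distrib[of "\<lambda>c. c * _"] if_distrib[of "\<lambda>c. _ * c"] cong: if_cong)
qed (auto split: if_splits)

lemma self_img: "x \<in> supported T \<Longrightarrow> T \<subseteq> total_complex K \<Longrightarrow> self.img T x = x"
  using fin_X by (auto simp: self.img_def mat_app_def rest_def supported_def fun_eq_iff
      if_distrib[of "\<lambda>c. c * _"] cong: if_cong)

lemma self_coimg: "x \<in> supported (total_complex K) \<Longrightarrow> self.coimg x = x"
  using fin_X by (auto simp: self.coimg_def mat_app_def rest_def supported_def fun_eq_iff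
      if_distrib[of "\<lambda>c. c * _"] cong: if_cong)

lemma cells_mono: "z \<le> w \<Longrightarrow> cells {} {} z \<subseteq> cells {} {} w"
  by (auto simp: cells_le)

lemma Cyc_mono:
  assumes "z \<le> w"
  shows "Cyc (cells {} {} z) d \<subseteq> Cyc (cells {} {} w) d"
proof
  fix x assume x: "x \<in> Cyc (cells {} {} z) d"
  then have "x \<in> supported (cells {} {} w)"
    using supported_mono[OF Ch_supported cells_mono[OF assms]] by (auto simp: Cyc_def)
  with self.img_Cyc[OF assms x] show "x \<in> Cyc (cells {} {} w) d"
    by (simp add: self_img cells_subset)
qed

lemma Bnd_mono:
  assumes "z \<le> w"
  shows "Bnd (cells {} {} z) d \<subseteq> Bnd (cells {} {} w) d"
proof
  fix x assume x: "x \<in> Bnd (cells {} {} z) d"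
  then have "x \<in> Cyc (cells {} {} z) d" using Bnd_subset_Cyc[OF loc_closed_cells] by blast
  then have "x \<in> supported (cells {} {} w)"
    using supported_mono[OF Ch_supported cells_mono[OF assms]] by (auto simp: Cyc_def)
  with self.img_Bnd[OF assms x] show "x \<in> Bnd (cells {} {} w) d"
    by (simp add: self_img cells_subset)
qed

lemma Cocyc_antimono:
  assumes "z \<le> w"
  shows "Cocyc (cells UNIV {} w) p \<subseteq> Cocyc (cells UNIV {} z) p"
proof
  fix x assume x: "x \<in> Cocyc (cells UNIV {} w) p"
  then have "x \<in> supported (total_complex K)" using Cocyc_supported[OF cells_subset] by blast
  with self.coimg_Cocyc[OF assms x] show "x \<in> Cocyc (cells UNIV {} z) p" by (simp add: self_coimg)
qed

lemma Cobnd_antimono: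
  assumes "z \<le> w"
  shows "Cobnd (cells UNIV {} w) p \<subseteq> Cobnd (cells UNIV {} z) p"
proof
  fix x assume x: "x \<in> Cobnd (cells UNIV {} w) p"
  then have "x \<in> supported (total_complex K)"
    using Cobnd_subset_Cocyc[OF up_closed_cells] Cocyc_supported[OF cells_subset] by blast
  with self.coimg_Cobnd[OF assms x] show "x \<in> Cobnd (cells UNIV {} z) p" by (simp add: self_coimg)
qed

lemma homology_persistence:
  shows persistence_module_homology: "persistence_module (homology K ori d :: ('k, ('v set \<Rightarrow> 'k) set, 'n) pmod)"
    and arr_homology_coset: "z \<le> w \<Longrightarrow>
      arr (homology K ori d) z w (coset (Bnd (cells {} {} z) d) x) = coset (Bnd (cells {} {} w) d) x"
  using persistence_module_quot[of "homology K ori d" "\<lambda>z. Cyc (cells {} {} z) d"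
      "\<lambda>z. Bnd (cells {} {} z) d" "total_complex K"]
    Cyc_subspace Bnd_subspace fin_X Cyc_supported[OF cells_subset] Cyc_mono Bnd_mono
  by (simp_all add: obj_homology hom_mod_def arr_homology)

lemma cohomology_persistence:
  shows persistence_module_cohomology: "persistence_module (cohomology K ori p :: ('k, ('v set \<Rightarrow> 'k) set, 'n) pmod)"
    and arr_cohomology_coset: "u \<le> v \<Longrightarrow>
      arr (cohomology K ori p) u v (coset (Cobnd (cells UNIV {} (- u)) p) x) =
        coset (Cobnd (cells UNIV {} (- v)) p) x"
  using persistence_module_quot[of "cohomology K ori p" "\<lambda>u. Cocyc (cells UNIV {} (- u)) p"
      "\<lambda>u. Cobnd (cells UNIV {} (- u)) p" "total_complex K"]
    Cocyc_subspace Cobnd_subspace fin_X Cocyc_supported[OF cells_subset]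
    Cocyc_antimono[OF minus_vec_le] Cobnd_antimono[OF minus_vec_le]
  by (simp_all add: obj_cohomology coh_mod_def arr_cohomology)

lemma persistence_module_dual_cohomology:
  "persistence_module (dual_pmod (cohomology K ori p :: ('k, ('v set \<Rightarrow> 'k) set, 'n) pmod))"
proof (rule persistence_module_dual[OF persistence_module_cohomology])
  note v = dual_quot_mod_vectorspace[OF Cocyc_subspace Cocyc_supported[OF cells_subset] fin_X
          Cobnd_subspace Cobnd_subset_Cocyc[OF up_closed_cells]]
  show "vectorspace class_ring (dual_mod (obj (cohomology K ori p) u) :: ('k, ('v set \<Rightarrow> 'k) set \<Rightarrow> 'k) module)"
    "vectorspace.fin_dim class_ring (dual_mod (obj (cohomology K ori p) u) :: ('k, ('v set \<Rightarrow> 'k) set \<Rightarrow> 'k) module)" for u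
    unfolding obj_cohomology coh_mod_def by (rule v)+
qed

context
  fixes js :: "'n list"
  assumes js: "distinct js" "set js = UNIV"
begin

lemma length_js: "length js = CARD('n)"
  using distinct_card[OF js(1)] js(2) by simp

lemma dual_iso_extensional: "dual_iso js d z C \<in> extensional (carrier (coh_mod z (d + int CARD('n))))"
  unfolding dual_iso_def length_js by (rule evaluation_extensional)

text \<open>Linearity and bijectivity hold degree by degree. The naturality square for
  \<open>z \<le> w\<close> is \<open>dual_iso_map\<close> for the identity chain map, tested on
  cohomology classes.\<close>

lemma pmod_iso_dual_iso:
  "pmod_iso (homology K ori d) (dual_pmod (cohomology K ori (d + int CARD('n)))) (dual_iso js d)"
  unfolding pmod_iso_def pmod_hom_def
proof (intro conjI allI impI ballI)
  let ?p = "d + int CARD('n)"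
  let ?D = "dual_pmod (cohomology K ori ?p) :: ('k, _, 'n) pmod"
  let ?H = "homology K ori d :: ('k, _, 'n) pmod"
  show "persistence_module (homology K ori d :: ('k, _, 'n) pmod)" by (rule persistence_module_homology)
  show "persistence_module ?D" by (rule persistence_module_dual_cohomology)
  have obj_D: "obj ?D z = dual_mod (coh_mod z ?p)" for z
    by (simp add: dual_pmod_def obj_cohomology)
  fix z
  show "linear_map class_ring (obj (homology K ori d) z) (obj ?D z) (dual_iso js d z)"
    unfolding obj_D obj_homology unfolding length_js[symmetric] by (rule dual_iso_linear[OF exact_far js])
  show "bij_betw (dual_iso js d z) (carrier (obj (homology K ori d) z)) (carrier (obj ?D z))"
    unfolding obj_D obj_homology unfolding length_js[symmetric] by (rule dual_iso_bij[OF exact_far js])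
  fix w C assume zw: "z \<le> w" and "C \<in> carrier (obj ?H z)"
  then obtain x where x: "x \<in> Cyc (cells {} {} z) d" "C = coset (Bnd (cells {} {} z) d) x"
    by (auto simp: obj_homology hom_mod_def carrier_quot_mod)
  have xw: "self.img (cells {} {} w) x = x"
    using x(1) supported_mono[OF Ch_supported cells_mono[OF zw]]
    by (intro self_img cells_subset) (auto simp: Cyc_def)
  have arr_D: "arr ?D z w \<phi> =
      restrict (\<phi> \<circ> arr (cohomology K ori ?p) (- w) (- z)) (carrier (coh_mod w ?p))" for \<phi>
    by (simp add: dual_pmod_def obj_cohomology)
  show "dual_iso js d w (arr ?H z w C) = arr ?D z w (dual_iso js d z C)"
  proof (rule extensionalityI[OF dual_iso_extensional])
    show "arr ?D z w (dual_iso js d z C) \<in> extensional (carrier (coh_mod w ?p))"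
      by (simp add: arr_D)
    fix E assume E: "E \<in> carrier (coh_mod w ?p)"
    then obtain \<psi> where \<psi>: "\<psi> \<in> Cocyc (cells UNIV {} w) ?p" "E = coset (Cobnd (cells UNIV {} w) ?p) \<psi>"
      by (auto simp: coh_mod_def carrier_quot_mod)
    have "self.coimg \<psi> = \<psi>"
      using \<psi>(1) Cocyc_supported[OF cells_subset] by (intro self_coimg) blast
    then have "dual_iso js d w (coset (Bnd (cells {} {} w) d) x) E =
        dual_iso js d z C (coset (Cobnd (cells UNIV {} z) ?p) \<psi>)"
      using self.dual_iso_map[OF zw exact_far exact_far js x(1) \<psi>(1)[folded length_js]]
      by (simp add: length_js \<psi>(2) x(2) xw)
    moreover have "arr (cohomology K ori ?p) (- w) (- z) E = coset (Cobnd (cells UNIV {} z) ?p) \<psi>"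
      using arr_cohomology_coset[OF minus_vec_le[OF zw], of ?p \<psi>] \<psi>(2) by simp
    ultimately show "dual_iso js d w (arr ?H z w C) E = arr ?D z w (dual_iso js d z C) E"
      using E by (simp add: arr_D x(2) arr_homology_coset[OF zw])
  qed
qed

end

end

section \<open>Maps induced by filtered simplicial maps\<close>

locale finite_homology_map = K: finite_homology field_type K ori + L: finite_homology field_type L ori'
  for field_type :: "'k::field itself" and K :: "int^'n::finite \<Rightarrow> 'v set set" and ori
    and L :: "int^'n \<Rightarrow> 'w set set" and ori' +
  fixes f :: "'v \<Rightarrow> 'w"
  assumes filtered: "filtered_map K L f"
begin

text \<open>A nonzero coefficient means that \<open>f\<close> is injective on \<open>s\<close> with
  image \<open>t\<close>; so dimensions agree, and \<open>t\<close> is present wherever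
  \<open>s\<close> is.\<close>

sublocale graded_complex_map "total_complex K" "grade K" "\<lambda>\<sigma>. int (card \<sigma>) - 1"
  "\<lambda>\<sigma> \<tau>. of_int (incidence ori \<sigma> \<tau>) :: 'k" "total_complex L" "grade L"
  "\<lambda>\<sigma>. int (card \<sigma>) - 1" "\<lambda>\<sigma> \<tau>. of_int (incidence ori' \<sigma> \<tau>)"
  "\<lambda>s t. of_int (map_coeff ori ori' f s t)"
proof
  have fK: "f ` s \<in> L z" if "s \<in> K z" for s z
    using filtered that by (simp add: filtered_map_def)
  have f: "f ` s \<in> total_complex L" if "s \<in> total_complex K" for s
    using fK that unfolding total_complex_def by blast
  fix s t assume s: "s \<in> total_complex K" and t: "t \<in> total_complex L"
  show "(\<Sum>r\<in>total_complex K. of_int (incidence ori s r) * of_int (map_coeff ori ori' f r t)) =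
      (\<Sum>r\<in>total_complex L. of_int (map_coeff ori ori' f s r) * of_int (incidence ori' r t) :: 'k)"
    using map_coeff_chain_map[OF K.fin_X K.down_X K.ori_X L.fin_X L.down_X L.ori_X f s t]
    by (simp flip: of_int_mult of_int_sum)
  assume "of_int (map_coeff ori ori' f s t) \<noteq> (0 :: 'k)"
  then have "map_coeff ori ori' f s t \<noteq> 0" by auto
  then have inj: "inj_on f s" and ts: "t = f ` s" by (auto simp: map_coeff_def split: if_splits)
  show "int (card t) - 1 = int (card s) - 1" by (simp add: ts card_image[OF inj])
  have "s \<in> K (grade K s)" using K.mem_iff_grade_le[OF s] by simp
  then have "t \<in> L (grade K s)" using fK ts by simp
  then show "grade L t \<le> grade K s" using L.mem_iff_grade_le[OF t] by simp
qed

lemma matrix_map_img: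
  assumes x: "x \<in> K.Ch (K.cells {} {} z) d"
  shows "matrix_map (simplices K d) (simplices L d) (map_coeff ori ori' f) z x = img (L.cells {} {} z) x"
proof
  fix t
  let ?m = "mat_app (total_complex K) (\<lambda>s t. of_int (map_coeff ori ori' f s t)) x t"
  have "matrix_map (simplices K d) (simplices L d) (map_coeff ori ori' f) z x t =
      (if t \<in> simplices L d then ?m else 0)"
    by (simp add: matrix_map_def mat_app_def K.sum_simplices[OF x])
  also have "\<dots> = img (L.cells {} {} z) x t"
  proof (cases "?m = 0")
    case True
    then show ?thesis by (simp add: img_def rest_def)
  next
    case False
    then obtain s where s: "s \<in> total_complex K" "of_int (map_coeff ori ori' f s t) \<noteq> (0 :: 'k)" "x s \<noteq> 0"
      by (rule mat_app_nonzero)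
    then have sS: "s \<in> K.cells {} {} z" "int (card s) - 1 = d" using x by (auto simp: K.Ch_def supported_def)
    show ?thesis
    proof (cases "t \<in> total_complex L")
      case True
      with m_grade[OF s(1) _ s(2)] m_dim[OF s(1) _ s(2)] sS
      show ?thesis by (auto simp: img_def rest_def simplices_def K.cells_le L.cells_le)
    qed (auto simp: img_def rest_def simplices_def L.cells_le)
  qed
  finally show "matrix_map (simplices K d) (simplices L d) (map_coeff ori ori' f) z x t =
    img (L.cells {} {} z) x t" .
qed

lemma matrix_map_coimg:
  assumes x: "\<psi> \<in> L.Ch S p"
  shows "matrix_map (simplices L p) (simplices K p) (\<lambda>\<tau> \<sigma>. map_coeff ori ori' f \<sigma> \<tau>) u \<psi> = coimg \<psi>"
proof
  fix s
  let ?m = "mat_app (total_complex L) (\<lambda>t s. of_int (map_coeff ori ori' f s t)) \<psi> s"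
  have "matrix_map (simplices L p) (simplices K p) (\<lambda>\<tau> \<sigma>. map_coeff ori ori' f \<sigma> \<tau>) u \<psi> s =
      (if s \<in> simplices K p then ?m else 0)"
    by (simp add: matrix_map_def mat_app_def L.sum_simplices[OF x])
  also have "\<dots> = coimg \<psi> s"
  proof (cases "?m = 0")
    case True
    then show ?thesis by (simp add: coimg_def rest_def)
  next
    case False
    then obtain t where t: "t \<in> total_complex L" "of_int (map_coeff ori ori' f s t) \<noteq> (0 :: 'k)" "\<psi> t \<noteq> 0"
      by (rule mat_app_nonzero)
    then have "int (card t) - 1 = p" using x by (auto simp: L.Ch_def supported_def)
    with m_dim[OF _ t(1,2)] show ?thesis
      by (auto simp: coimg_def rest_def simplices_def)
  qed
  finally show "matrix_map (simplices L p) (simplices K p) (\<lambda>\<tau> \<sigma>. map_coeff ori ori' f \<sigma> \<tau>) u \<psi> s = coimg \<psi> s" .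
qed

lemma homology_map_coset:
  assumes x: "x \<in> K.Cyc (K.cells {} {} z) d"
  shows "homology_map K ori L ori' f d z (coset (K.Bnd (K.cells {} {} z) d) x) =
    coset (L.Bnd (L.cells {} {} z) d) (img (L.cells {} {} z) x)"
proof -
  have xC: "x \<in> K.Ch (K.cells {} {} z) d" using x by (simp add: K.Cyc_def)
  have "homology_map K ori L ori' f d z (coset (K.Bnd (K.cells {} {} z) d) x) =
    coset (L.Bnd (L.cells {} {} z) d)
      (matrix_map (simplices K d) (simplices L d) (map_coeff ori ori' f) z x)"
    unfolding homology_map_def L.ker_chains L.im_chains
  proof (rule quot_map_coset[OF K.Bnd_subspace L.Bnd_subspace])
    fix b assume b: "b - x \<in> K.Bnd (K.cells {} {} z) d"
    then have "b - x \<in> K.Cyc (K.cells {} {} z) d"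
      using K.Bnd_subset_Cyc[OF K.loc_closed_cells] by blast
    \<comment> \<open>Not only the difference but \<open>b\<close> itself must be a chain before the
      matrix map at \<open>b\<close> can be replaced by \<open>img\<close>.\<close>
    then have "b - x + x \<in> K.Ch (K.cells {} {} z) d"
      using xC by (intro fs.subspace_add[OF K.Ch_subspace]) (simp_all add: K.Cyc_def)
    then have "b \<in> K.Ch (K.cells {} {} z) d" by simp
    with img_Bnd[OF order_refl b] show
      "matrix_map (simplices K d) (simplices L d) (map_coeff ori ori' f) z b -
       matrix_map (simplices K d) (simplices L d) (map_coeff ori ori' f) z x \<in> L.Bnd (L.cells {} {} z) d"
      by (simp add: matrix_map_img xC img_diff)
  qed
  then show ?thesis by (simp add: matrix_map_img xC)
qed

lemma cohomology_map_coset: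
  assumes \<psi>: "\<psi> \<in> L.Cocyc (L.cells UNIV {} (- u)) p"
  shows "cohomology_map K ori L ori' f p u (coset (L.Cobnd (L.cells UNIV {} (- u)) p) \<psi>) =
    coset (K.Cobnd (K.cells UNIV {} (- u)) p) (coimg \<psi>)"
proof -
  let ?h = "matrix_map (simplices L p) (simplices K p) (\<lambda>\<tau> \<sigma>. map_coeff ori ori' f \<sigma> \<tau>) u
    :: ('w set \<Rightarrow> 'k) \<Rightarrow> _"
  have \<psi>C: "\<psi> \<in> L.Ch (L.cells UNIV {} (- u)) p" using \<psi> by (simp add: L.Cocyc_def)
  have "cohomology_map K ori L ori' f p u (coset (L.Cobnd (L.cells UNIV {} (- u)) p) \<psi>) =
    coset (K.Cobnd (K.cells UNIV {} (- u)) p) (?h \<psi>)"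
    unfolding cohomology_map_def K.ker_cochains K.im_cochains
  proof (rule quot_map_coset[OF L.Cobnd_subspace K.Cobnd_subspace])
    fix b assume b: "b - \<psi> \<in> L.Cobnd (L.cells UNIV {} (- u)) p"
    then have "b - \<psi> \<in> L.Cocyc (L.cells UNIV {} (- u)) p"
      using L.Cobnd_subset_Cocyc[OF L.up_closed_cells] by blast
    then have "b - \<psi> + \<psi> \<in> L.Ch (L.cells UNIV {} (- u)) p"
      using \<psi>C by (intro fs.subspace_add[OF L.Ch_subspace]) (simp_all add: L.Cocyc_def)
    then have "b \<in> L.Ch (L.cells UNIV {} (- u)) p" by simp
    with coimg_Cobnd[OF order_refl b] show "?h b - ?h \<psi> \<in> K.Cobnd (K.cells UNIV {} (- u)) p"
      by (simp add: matrix_map_coimg[OF \<psi>C] matrix_map_coimg[of b] coimg_diff)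
  qed
  then show ?thesis by (simp add: matrix_map_coimg[OF \<psi>C])
qed

lemma dual_iso_natural:
  assumes js: "distinct js" "set js = UNIV" and C: "C \<in> carrier (obj (homology K ori d) z)"
  shows "L.dual_iso js d z (homology_map K ori L ori' f d z C) =
    dual_map (cohomology L ori' (d + int CARD('n)))
      (cohomology_map K ori L ori' f (d + int CARD('n))) z (K.dual_iso js d z C)"
    (is "?l = ?r")
proof -
  let ?p = "d + int CARD('n)"
  obtain x where x: "x \<in> K.Cyc (K.cells {} {} z) d" "C = coset (K.Bnd (K.cells {} {} z) d) x"
    using C by (auto simp: K.obj_homology K.hom_mod_def carrier_quot_mod)
  have r: "?r = restrict (K.dual_iso js d z C \<circ> cohomology_map K ori L ori' f ?p (- z)) (carrier (L.coh_mod z ?p))"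
    by (simp add: dual_map_def L.obj_cohomology)
  show ?thesis
  proof (rule extensionalityI[OF L.dual_iso_extensional[OF js]])
    show "?r \<in> extensional (carrier (L.coh_mod z ?p))" by (simp add: r)
    fix E assume E: "E \<in> carrier (L.coh_mod z ?p)"
    then obtain \<psi> where \<psi>: "\<psi> \<in> L.Cocyc (L.cells UNIV {} z) ?p" "E = coset (L.Cobnd (L.cells UNIV {} z) ?p) \<psi>"
      by (auto simp: L.coh_mod_def carrier_quot_mod)
    have "cohomology_map K ori L ori' f ?p (- z) E = coset (K.Cobnd (K.cells UNIV {} z) ?p) (coimg \<psi>)"
      using cohomology_map_coset[of \<psi> "- z" ?p] \<psi> by simp
    with dual_iso_map[OF order_refl K.exact_far L.exact_far js x(1) \<psi>(1)[folded K.length_js[OF js]]] E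
    show "?l E = ?r E"
      unfolding r by (simp add: x(2) \<psi>(2) homology_map_coset[OF x(1)] K.length_js[OF js])
  qed
qed

end

theorem proposition6:
  shows "\<exists>\<Phi> :: (int^'n::finite \<Rightarrow> 'v set set) \<Rightarrow> ('v set \<Rightarrow> 'v list) \<Rightarrow> int \<Rightarrow>
               int^'n \<Rightarrow> ('v set \<Rightarrow> 'k::field) set \<Rightarrow> ('v set \<Rightarrow> 'k) set \<Rightarrow> 'k.
    (\<forall>K ori. finite_homology_filtration TYPE('k) K ori \<longrightarrow>
      (\<forall>d. pmod_iso (homology K ori d)
             (dual_pmod (cohomology K ori (d + int CARD('n)))) (\<Phi> K ori d))) \<and>
    (\<forall>K ori L ori' f. finite_homology_filtration TYPE('k) K ori \<longrightarrow>
      finite_homology_filtration TYPE('k) L ori' \<longrightarrow> filtered_map K L f \<longrightarrow>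
      (\<forall>d z. \<forall>x\<in>carrier (obj (homology K ori d) z).
        \<Phi> L ori' d z (homology_map K ori L ori' f d z x) =
        dual_map (cohomology L ori' (d + int CARD('n)))
          (cohomology_map K ori L ori' f (d + int CARD('n))) z (\<Phi> K ori d z x)))"
proof -
  \<comment> \<open>One enumeration of the coordinates for all filtrations, so that source and
    target of a filtered map use composites with the same sign.\<close>
  obtain js :: "'n list" where js: "distinct js" "set js = UNIV"
    using finite_distinct_list[of "UNIV :: 'n set"] by auto
  \<comment> \<open>The constant is taken with explicit parameters, so the family is defined for
    arbitrary \<open>K\<close> and \<open>ori\<close> before any hypothesis on them is
    available.\<close>
  define \<Phi> :: "(int^'n \<Rightarrow> 'v set set) \<Rightarrow> ('v set \<Rightarrow> 'v list) \<Rightarrow> int \<Rightarrow>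
               int^'n \<Rightarrow> ('v set \<Rightarrow> 'k) set \<Rightarrow> ('v set \<Rightarrow> 'k) set \<Rightarrow> 'k"
    where "\<Phi> K ori = graded_complex.dual_iso (total_complex K) (grade K) (\<lambda>\<sigma>. int (card \<sigma>) - 1)
      (\<lambda>\<sigma> \<tau>. of_int (incidence ori \<sigma> \<tau>)) js" for K ori
  show ?thesis
  proof (intro exI[of _ \<Phi>] conjI allI impI ballI)
    fix K :: "int^'n \<Rightarrow> 'v set set" and ori
    assume K: "finite_homology_filtration TYPE('k) K ori"
    interpret K: finite_homology "TYPE('k)" K ori by standard (fact K)
    show "pmod_iso (homology K ori d) (dual_pmod (cohomology K ori (d + int CARD('n)))) (\<Phi> K ori d)" for d
      unfolding \<Phi>_def by (rule K.pmod_iso_dual_iso[OF js])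
    fix L :: "int^'n \<Rightarrow> 'v set set" and ori' f d z x
    assume L: "finite_homology_filtration TYPE('k) L ori'" and f: "filtered_map K L f"
      and x: "x \<in> carrier (obj (homology K ori d :: ('k, _, _) pmod) z)"
    interpret finite_homology_map "TYPE('k)" K ori L ori' f
      by unfold_locales (fact L, fact f)
    show "\<Phi> L ori' d z (homology_map K ori L ori' f d z x) =
        dual_map (cohomology L ori' (d + int CARD('n)))
          (cohomology_map K ori L ori' f (d + int CARD('n))) z (\<Phi> K ori d z x)"
      unfolding \<Phi>_def by (rule dual_iso_natural[OF js x])
  qed
qed

end
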